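(* The dual of $H^A$ is $B$: under the usual identification of $\mathrm{BMO}$ with $(H^1)^*$, restricting functionals from $H^1$ to $H^A$ induces a Banach space isomorphism of $B=\mathrm{BMO}/\!\sim_2$ onto $(H^A)^*$.
   Context: All functions are on $\mathbb{R}$. An atom with defining interval $I$ (a bounded interval) is a function $a$ with $\operatorname{supp}(a)\subseteq I$, $|a(x)|\le 1/|I|$ and $\int_I a(x)\,dx=0$. $H^1=H^1(\mathbb{R})$ is the Banach space of all $f=\sum_{j=1}^\infty\lambda_j a_j$ (convergence in $L^1$ and in the sense of distributions) with $a_j$ atoms and $\sum_j|\lambda_j|<\infty$, normed by $\|f\|_{H^1}=\inf\sum_j|\lambda_j|$ over all such decompositions. $H^A=\{f\in H^1:\int_0^{\infty}f(x)\,dx=0\}$, with the norm of $H^1$. $\mathrm{BMO}$ is the Banach space, modulo constants, of locally integrable $\varphi$ with $\|\varphi\|_*=\sup_I\frac1{|I|}\int_I|\varphi-\varphi_I|\,dx<\infty$, where $\varphi_I=\frac1{|I|}\int_I\varphi$ and $I$ ranges over all bounded intervals. The identification $\mathrm{BMO}=(H^1)^*$ (with equivalence of norms) sends $\varphi$ to the bounded extension to $H^1$ of the functional $f\mapsto\int_{\mathbb{R}}f\varphi$ defined on compactly supported bounded $f\in H^1$. For $\varphi,\psi\in\mathrm{BMO}$, $\varphi\sim_2\psi$ means that for some constants $c,d$, $\varphi-\psi=d\,\chi_{(-\infty,0]}+c\,\chi_{[0,\infty)}$ a.e. $B=\mathrm{BMO}/\!\sim_2$ is normed as follows: if $\Phi\in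 B$ has representative $\varphi$, then $\|\Phi\|_B=\inf\{\|\psi\|_*:\psi\in\mathrm{BMO},\ \varphi\sim_2\psi\}$. *)

theory Defs
  imports "HOL-Analysis.Analysis"
begin

text \<open>
  Elements of \<open>H\<^sup>1\<close> and \<open>BMO\<close> are represented by functions \<open>real \<Rightarrow> real\<close> rather than by
  almost-everywhere (or modulo-constants) classes. This is harmless for \<open>H\<^sup>1\<close>: functions that
  agree a.e. have distance \<open>0\<close> in \<^term>\<open>h1_norm\<close> below, so a functional bounded with respect
  to it takes the same value on both.
\<close>

definition bdd_interval :: "real set \<Rightarrow> bool" where
  "bdd_interval I \<longleftrightarrow> is_interval I \<and> bounded I \<and> 0 < measure lebesgue I"

definition atom_on :: "real set \<Rightarrow> (real \<Rightarrow> real) \<Rightarrow> bool" where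
  "atom_on I a \<longleftrightarrow> bdd_interval I \<and> a \<in> borel_measurable lebesgue \<and>
     closure {x. a x \<noteq> 0} \<subseteq> I \<and> (\<forall>x. \<bar>a x\<bar> \<le> 1 / measure lebesgue I) \<and>
     (LINT x:I|lebesgue. a x) = 0"

text \<open>The series converges in \<open>L\<^sup>1\<close>, hence also in the sense of distributions.\<close>

definition atomic_decomp ::
    "(real \<Rightarrow> real) \<Rightarrow> (nat \<Rightarrow> real) \<Rightarrow> (nat \<Rightarrow> real \<Rightarrow> real) \<Rightarrow> bool" where
  "atomic_decomp f l a \<longleftrightarrow>
     (\<forall>j. \<exists>I. atom_on I (a j)) \<and> summable (\<lambda>j. \<bar>l j\<bar>) \<and> integrable lebesgue f \<and>
     (\<lambda>n. LINT x|lebesgue. \<bar>f x - (\<Sum>j<n. l j * a j x)\<bar>) \<longlonglongrightarrow> 0"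

definition H1 :: "(real \<Rightarrow> real) set" where
  "H1 = {f. \<exists>l a. atomic_decomp f l a}"

definition h1_norm :: "(real \<Rightarrow> real) \<Rightarrow> real" where
  "h1_norm f = Inf {(\<Sum>j. \<bar>l j\<bar>) | l a. atomic_decomp f l a}"

definition HA :: "(real \<Rightarrow> real) set" where
  "HA = {f \<in> H1. (LINT x:{0..}|lebesgue. f x) = 0}"

text \<open>
  The continuous dual of a linear space \<open>V\<close> of functions with (semi)norm \<open>N\<close>. Functionals are
  extensional (\<^term>\<open>undefined\<close> outside \<open>V\<close>), so that they are determined by their values on \<open>V\<close>.
\<close>

definition dual_space ::
    "(real \<Rightarrow> real) set \<Rightarrow> ((real \<Rightarrow> real) \<Rightarrow> real) \<Rightarrow> ((real \<Rightarrow> real) \<Rightarrow> real) set" where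
  "dual_space V N = {L \<in> extensional V.
     (\<forall>f\<in>V. \<forall>g\<in>V. \<forall>s t. L (\<lambda>x. s * f x + t * g x) = s * L f + t * L g) \<and>
     (\<exists>C. \<forall>f\<in>V. \<bar>L f\<bar> \<le> C * N f)}"

definition dual_norm ::
    "(real \<Rightarrow> real) set \<Rightarrow> ((real \<Rightarrow> real) \<Rightarrow> real) \<Rightarrow> ((real \<Rightarrow> real) \<Rightarrow> real) \<Rightarrow> real" where
  "dual_norm V N L = Sup {\<bar>L f\<bar> | f. f \<in> V \<and> N f \<le> 1}"

definition mean :: "(real \<Rightarrow> real) \<Rightarrow> real set \<Rightarrow> real" where
  "mean \<phi> I = (LINT x:I|lebesgue. \<phi> x) / measure lebesgue I"

definition mean_osc :: "(real \<Rightarrow> real) \<Rightarrow> real set \<Rightarrow> real" where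
  "mean_osc \<phi> I = mean (\<lambda>x. \<bar>\<phi> x - mean \<phi> I\<bar>) I"

definition BMO :: "(real \<Rightarrow> real) set" where
  "BMO = {\<phi>. (\<forall>K. compact K \<longrightarrow> set_integrable lebesgue K \<phi>) \<and>
             bdd_above (mean_osc \<phi> ` Collect bdd_interval)}"

definition bmo_norm :: "(real \<Rightarrow> real) \<Rightarrow> real" where
  "bmo_norm \<phi> = (SUP I \<in> Collect bdd_interval. mean_osc \<phi> I)"

text \<open>The functional on \<open>H\<^sup>1\<close> identified with \<open>\<phi> \<in> BMO\<close>.\<close>

definition bmo_functional :: "(real \<Rightarrow> real) \<Rightarrow> (real \<Rightarrow> real) \<Rightarrow> real" where
  "bmo_functional \<phi> = (THE L. L \<in> dual_space H1 h1_norm \<and>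
     (\<forall>f\<in>H1. bounded (range f) \<and> compact (closure {x. f x \<noteq> 0}) \<longrightarrow>
        L f = (LINT x|lebesgue. f x * \<phi> x)))"

definition sim2 :: "((real \<Rightarrow> real) \<times> (real \<Rightarrow> real)) set" where
  "sim2 = {(\<phi>, \<psi>). \<phi> \<in> BMO \<and> \<psi> \<in> BMO \<and>
     (\<exists>c d. AE x in lebesgue. \<phi> x - \<psi> x = d * indicator {..0} x + c * indicator {0..} x)}"

text \<open>Constants are absorbed by \<^term>\<open>sim2\<close> (take \<open>c = d\<close>), so this is \<open>BMO\<close> modulo
  constants, divided by \<open>\<sim>\<^sub>2\<close>.\<close>

definition bmo_quot :: "(real \<Rightarrow> real) set set" where
  "bmo_quot = BMO // sim2"

definition bmo_quot_norm :: "(real \<Rightarrow> real) set \<Rightarrow> real" where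
  "bmo_quot_norm \<Phi> = (INF \<psi>\<in>\<Phi>. bmo_norm \<psi>)"

end

theory Submission
  imports Defs
begin

text \<open>
  The subspace \<open>HA\<close> of \<open>H1\<close> is the kernel of one bounded functional, \<open>f \<mapsto> \<integral>\<^sub>0\<^sup>\<infinity> f\<close>, which is the functional
  of the \<open>BMO\<close> function \<open>\<chi>\<close> that is the indicator of \<open>[0,\<infinity>)\<close>. It therefore has an explicit bounded
  projection \<open>HA_proj f = f - (\<integral>\<^sub>0\<^sup>\<infinity> f) \<cdot> jump\<close>, where \<open>jump\<close> is a multiple of an atom with integral one
  over \<open>[0,\<infinity>)\<close>. Composing with this projection extends every functional on \<open>HA\<close> to \<open>H1\<close> with at most
  three times its norm, so that no Hahn-Banach theorem is needed, and for a functional that comes from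
  \<open>p\<close> in \<open>BMO\<close> this amounts to replacing \<open>p\<close> by \<open>p - k \<cdot> \<chi>\<close>. Up to the constants, everything is thereby
  reduced to the duality of \<open>H1\<close> and \<open>BMO\<close>, which is proved here in three steps.

  \<^item> \<^emph>\<open>Every \<open>p\<close> in \<open>BMO\<close> gives a functional of norm at most \<open>bmo_norm p\<close>\<close>
    (\<open>BMO_representing_functional\<close>). Truncate \<open>p\<close> at height \<open>n\<close>. The pairing of an atom on \<open>I\<close> with the
    truncation is at most the mean oscillation of \<open>p\<close> itself over \<open>I\<close>, because truncation is
    1-Lipschitz. A bounded function may be paired termwise with an atomic decomposition, and the limit
    \<open>n \<rightarrow> \<infinity>\<close> is taken by dominated convergence. The value of the limit does not depend on the
    decomposition, and on bounded functions of compact support it is the integral.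

  \<^item> \<^emph>\<open>On bounded functions with mean zero on an interval, the \<open>H1\<close> norm is bounded by the \<open>L\<^sup>2\<close> norm\<close>
    (\<open>L2_h1_norm\<close>). For dyadic step functions the bound follows from a Calderon-Zygmund stopping time
    argument, by induction on the number of generations, with a constant independent of that number.
    Density of the step functions and countable subadditivity of the norm give the general case.

  \<^item> \<^emph>\<open>Every functional on \<open>H1\<close> is given by some \<open>p\<close> in \<open>BMO\<close>\<close> (\<open>dual_H1_represented\<close>). By the
    previous step the functional is bounded in \<open>L\<^sup>2\<close> on each interval, so minimising
    \<open>\<integral> f\<^sup>2 / 2 - L f\<close> represents it there. The representing functions for different intervals differ by
    constants and are glued. The mean oscillation of \<open>p\<close> over \<open>I\<close> is the value of the functional at a
    test function of norm at most \<open>2 |I|\<close>, divided by \<open>|I|\<close> (\<open>osc_test_function\<close>), which bounds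
    \<open>bmo_norm p\<close>.

  The last estimate also gives the lower bound for the dual norm, and, for the zero functional,
  injectivity: a function all of whose mean oscillations vanish is constant almost everywhere.
\<close>

section \<open>Series in \<open>L\<^sup>1\<close>\<close>

lemma L1_series:
  fixes d :: "nat \<Rightarrow> 'a \<Rightarrow> real"
  assumes int: "\<And>i. integrable M (d i)" and summ: "summable (\<lambda>i. LINT x|M. \<bar>d i x\<bar>)"
  shows "AE x in M. summable (\<lambda>i. \<bar>d i x\<bar>)"
    and "integrable M (\<lambda>x. \<Sum>i. d i x)"
    and "(\<lambda>n. LINT x|M. \<bar>(\<Sum>i. d i x) - (\<Sum>i<n. d i x)\<bar>) \<longlonglongrightarrow> 0"
proof -
  have [measurable]: "\<And>i. d i \<in> borel_measurable M" using int by auto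
  show ae: "AE x in M. summable (\<lambda>i. \<bar>d i x\<bar>)"
  proof -
    have "(\<integral>\<^sup>+x. (\<Sum>i. ennreal \<bar>d i x\<bar>) \<partial>M) = (\<Sum>i. \<integral>\<^sup>+x. ennreal \<bar>d i x\<bar> \<partial>M)"
      by (intro nn_integral_suminf) auto
    also have "\<dots> = (\<Sum>i. ennreal (LINT x|M. \<bar>d i x\<bar>))"
      using int by (intro arg_cong[where f=suminf] ext nn_integral_eq_integral) auto
    also have "\<dots> \<noteq> \<infinity>"
      using summ by (simp add: ennreal_suminf_neq_top)
    finally have "AE x in M. (\<Sum>i. ennreal \<bar>d i x\<bar>) \<noteq> \<infinity>"
      by (intro nn_integral_PInf_AE) auto
    then show ?thesis
      by eventually_elim (auto intro: summable_suminf_not_top)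
  qed
  then have ae': "AE x in M. summable (\<lambda>i. norm (d i x))" by simp
  have summ': "summable (\<lambda>i. LINT x|M. norm (d i x))" using summ by simp
  show I: "integrable M (\<lambda>x. \<Sum>i. d i x)"
    by (rule integrable_suminf[OF int ae' summ'])
  define t where "t = (\<lambda>n. (\<Sum>i. LINT x|M. \<bar>d i x\<bar>) - (\<Sum>i<n. LINT x|M. \<bar>d i x\<bar>))"
  have t0: "t \<longlonglongrightarrow> 0"
    unfolding t_def
    using tendsto_diff[OF tendsto_const[of "\<Sum>i. LINT x|M. \<bar>d i x\<bar>"] summable_LIMSEQ[OF summ]]
    by simp
  have le: "(LINT x|M. \<bar>(\<Sum>i. d i x) - (\<Sum>i<n. d i x)\<bar>) \<le> t n" for n
  proof -
    have aen: "AE x in M. summable (\<lambda>i. norm \<bar>d (i+n) x\<bar>)"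
      using ae by eventually_elim (simp add: summable_iff_shift[of "\<lambda>i. \<bar>d i _\<bar>"])
    have sn: "summable (\<lambda>i. LINT x|M. norm \<bar>d (i+n) x\<bar>)"
      using summ by (simp add: summable_iff_shift[of "\<lambda>i. LINT x|M. \<bar>d i x\<bar>"])
    have In: "integrable M (\<lambda>x. \<Sum>i. \<bar>d (i+n) x\<bar>)"
      by (rule integrable_suminf[OF _ aen sn]) (use int in auto)
    have "(LINT x|M. \<bar>(\<Sum>i. d i x) - (\<Sum>i<n. d i x)\<bar>) \<le> (LINT x|M. (\<Sum>i. \<bar>d (i+n) x\<bar>))"
    proof (rule integral_mono_AE)
      show "AE x in M. \<bar>(\<Sum>i. d i x) - (\<Sum>i<n. d i x)\<bar> \<le> (\<Sum>i. \<bar>d (i+n) x\<bar>)"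
        using ae
      proof eventually_elim
        case (elim x)
        have "(\<Sum>i. d i x) - (\<Sum>i<n. d i x) = (\<Sum>i. d (i+n) x)"
          using suminf_minus_initial_segment[of "\<lambda>i. d i x" n] elim summable_rabs_cancel by fastforce
        moreover have "summable (\<lambda>i. \<bar>d (i+n) x\<bar>)"
          using elim by (simp add: summable_iff_shift[of "\<lambda>i. \<bar>d i x\<bar>"])
        ultimately show ?case using summable_rabs by fastforce
      qed
    qed (use I In int in auto)
    also have "\<dots> = (\<Sum>i. LINT x|M. \<bar>d (i+n) x\<bar>)"
      by (rule integral_suminf[OF _ aen sn]) (use int in auto)
    also have "\<dots> = t n"
      unfolding t_def using suminf_minus_initial_segment[OF summ] by simp
    finally show ?thesis .
  qed
  show "(\<lambda>n. LINT x|M. \<bar>(\<Sum>i. d i x) - (\<Sum>i<n. d i x)\<bar>) \<longlonglongrightarrow> 0"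
    by (rule tendsto_sandwich[OF _ _ tendsto_const t0]) (use le in auto)
qed

lemma L1_lim_AE_unique:
  fixes f g :: "'a \<Rightarrow> real"
  assumes [simp]: "integrable M f" "integrable M g" "\<And>n. integrable M (s n)"
    and f: "(\<lambda>n. LINT x|M. \<bar>f x - s n x\<bar>) \<longlonglongrightarrow> 0"
    and g: "(\<lambda>n. LINT x|M. \<bar>g x - s n x\<bar>) \<longlonglongrightarrow> 0"
  shows "AE x in M. f x = g x"
proof -
  have "(LINT x|M. \<bar>f x - g x\<bar>) \<le> (LINT x|M. \<bar>f x - s n x\<bar>) + (LINT x|M. \<bar>g x - s n x\<bar>)" for n
  proof -
    have "(LINT x|M. \<bar>f x - g x\<bar>) \<le> (LINT x|M. \<bar>f x - s n x\<bar> + \<bar>g x - s n x\<bar>)"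
      by (rule integral_mono) auto
    then show ?thesis by simp
  qed
  then have "(LINT x|M. \<bar>f x - g x\<bar>) \<le> 0 + 0"
    by (intro LIMSEQ_le[OF tendsto_const tendsto_add[OF f g]]) auto
  then have "(LINT x|M. \<bar>f x - g x\<bar>) = 0"
    by (simp add: antisym)
  then have "AE x in M. \<bar>f x - g x\<bar> = 0"
    by (subst (asm) integral_nonneg_eq_0_iff_AE) auto
  then show ?thesis by auto
qed

section \<open>Atoms and the atomic norm\<close>

lemma interval_lmeasurable: "bdd_interval I \<Longrightarrow> I \<in> lmeasurable"
  by (auto simp: bdd_interval_def is_interval_convex intro: measurable_convex)

lemma atom_on_bound:
  assumes "atom_on I a" shows "\<bar>a x\<bar> \<le> indicator I x / measure lebesgue I"
proof (cases "x \<in> I")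
  case False
  moreover have "{y. a y \<noteq> 0} \<subseteq> I" using assms closure_subset[of "{y. a y \<noteq> 0}"] by (auto simp: atom_on_def)
  ultimately have "a x = 0" by auto
  then show ?thesis using False by simp
qed (use assms in \<open>auto simp: atom_on_def\<close>)

lemma atom_integrable:
  assumes "atom_on I a" shows "integrable lebesgue a" "(LINT x|lebesgue. \<bar>a x\<bar>) \<le> 1"
    "(LINT x|lebesgue. a x) = 0"
proof -
  have I: "I \<in> lmeasurable" and p: "measure lebesgue I > 0"
    using assms interval_lmeasurable by (auto simp: atom_on_def bdd_interval_def)
  have i: "integrable lebesgue (\<lambda>x. indicator I x / measure lebesgue I)"
    using I by (auto simp: fmeasurable_def)
  show J: "integrable lebesgue a"
    by (rule Bochner_Integration.integrable_bound[OF i])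
       (use assms atom_on_bound[OF assms] in \<open>auto simp: atom_on_def\<close>)
  have "(LINT x|lebesgue. \<bar>a x\<bar>) \<le> (LINT x|lebesgue. indicator I x / measure lebesgue I)"
    using i J atom_on_bound[OF assms] by (intro integral_mono) auto
  also have "\<dots> = 1" using I p by simp
  finally show "(LINT x|lebesgue. \<bar>a x\<bar>) \<le> 1" .
  have "(LINT x|lebesgue. a x) = (LINT x:I|lebesgue. a x)"
    unfolding set_lebesgue_integral_def
  proof (rule Bochner_Integration.integral_cong)
    fix x show "a x = indicator I x *\<^sub>R a x"
      using atom_on_bound[OF assms, of x] by (cases "x \<in> I") auto
  qed simp
  then show "(LINT x|lebesgue. a x) = 0" using assms by (simp add: atom_on_def)
qed

lemma bdd_interval_Icc: "a < b \<Longrightarrow> bdd_interval {a..b}"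
  by (simp add: bdd_interval_def is_interval_cc)

lemma atom_on_zero: "atom_on {0..1} (\<lambda>x. 0)"
  by (simp add: atom_on_def bdd_interval_Icc)

lemma atomic_decomp_terms:
  assumes "\<And>j. \<exists>I. atom_on I (a j)" "summable (\<lambda>j. \<bar>l j :: real\<bar>)"
  shows "integrable lebesgue (\<lambda>x. l j * a j x)" "(LINT x|lebesgue. \<bar>l j * a j x\<bar>) \<le> \<bar>l j\<bar>"
    "summable (\<lambda>j. LINT x|lebesgue. \<bar>l j * a j x\<bar>)"
proof -
  have i: "integrable lebesgue (a j)" "(LINT x|lebesgue. \<bar>a j x\<bar>) \<le> 1" for j
    using assms(1)[of j] atom_integrable by blast+
  show "integrable lebesgue (\<lambda>x. l j * a j x)" using i by auto
  have *: "(LINT x|lebesgue. \<bar>l j * a j x\<bar>) \<le> \<bar>l j\<bar>" for j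
    using i(2)[of j] by (simp add: abs_mult mult_left_le)
  then show "(LINT x|lebesgue. \<bar>l j * a j x\<bar>) \<le> \<bar>l j\<bar>" .
  show "summable (\<lambda>j. LINT x|lebesgue. \<bar>l j * a j x\<bar>)"
    by (rule summable_comparison_test[OF _ assms(2)]) (use * in auto)
qed

lemma atomic_decomp_AE:
  assumes "atomic_decomp f l a"
  shows "AE x in lebesgue. summable (\<lambda>j. \<bar>l j * a j x\<bar>) \<and> f x = (\<Sum>j. l j * a j x)"
proof -
  have A: "\<And>j. \<exists>I. atom_on I (a j)" "summable (\<lambda>j. \<bar>l j\<bar>)" and f: "integrable lebesgue f"
    "(\<lambda>n. LINT x|lebesgue. \<bar>f x - (\<Sum>j<n. l j * a j x)\<bar>) \<longlonglongrightarrow> 0"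
    using assms by (auto simp: atomic_decomp_def)
  note t = atomic_decomp_terms[of a l, OF A]
  note s = L1_series[of lebesgue "\<lambda>j x. l j * a j x", OF t(1) t(3)]
  have "AE x in lebesgue. f x = (\<Sum>j. l j * a j x)"
    by (rule L1_lim_AE_unique[OF f(1) s(2) _ f(2) s(3)]) (use t(1) in auto)
  with s(1) show ?thesis by eventually_elim auto
qed

text \<open>
  The series of an atomic decomposition converges absolutely almost everywhere, so convergence in
  \<open>L\<^sup>1\<close> may be replaced by convergence almost everywhere. The pointwise form makes it easy to
  rearrange decompositions.
\<close>

lemma atomic_decomp_AE_I:
  assumes A: "\<And>j. \<exists>I. atom_on I (a j)" "summable (\<lambda>j. \<bar>l j\<bar>)"
    and f: "f \<in> borel_measurable lebesgue" "AE x in lebesgue. f x = (\<Sum>j. l j * a j x)"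
  shows "atomic_decomp f l a"
proof -
  note t = atomic_decomp_terms[of a l, OF A]
  note s = L1_series[of lebesgue "\<lambda>j x. l j * a j x", OF t(1) t(3)]
  have m[measurable]: "\<And>j. a j \<in> borel_measurable lebesgue" "f \<in> borel_measurable lebesgue"
    using A(1) f(1) by (auto simp: atom_on_def)
  have "integrable lebesgue f"
    by (rule integrable_cong_AE_imp[OF s(2)]) (use f in auto)
  moreover have "(LINT x|lebesgue. \<bar>(\<Sum>i. l i * a i x) - (\<Sum>i<n. l i * a i x)\<bar>)
       = (LINT x|lebesgue. \<bar>f x - (\<Sum>i<n. l i * a i x)\<bar>)" for n
    by (rule integral_cong_AE) (use f(2) in auto)
  ultimately show ?thesis
    unfolding atomic_decomp_def using A s(3) by simp
qed

lemma h1_norm_le: "atomic_decomp f l a \<Longrightarrow> h1_norm f \<le> (\<Sum>j. \<bar>l j\<bar>)"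
  unfolding h1_norm_def
  by (rule cInf_lower) (auto intro!: bdd_belowI[where m=0] suminf_nonneg simp: atomic_decomp_def)

lemma H1_I: "atomic_decomp f l a \<Longrightarrow> f \<in> H1"
  by (auto simp: H1_def)

lemma h1_norm_nonneg: "f \<in> H1 \<Longrightarrow> 0 \<le> h1_norm f"
  unfolding h1_norm_def
  by (rule cInf_greatest) (auto intro!: suminf_nonneg simp: atomic_decomp_def H1_def)

lemma h1_norm_decomp:
  assumes "f \<in> H1" "h1_norm f < c"
  obtains l a where "atomic_decomp f l a" "(\<Sum>j. \<bar>l j\<bar>) < c"
proof -
  have "\<exists>x\<in>{(\<Sum>j. \<bar>l j\<bar>) | l a. atomic_decomp f l a}. x < c"
    using assms(2) unfolding h1_norm_def
    by (subst (asm) cInf_less_iff)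
       (use assms(1) in \<open>auto intro!: bdd_belowI[where m=0] suminf_nonneg simp: atomic_decomp_def H1_def\<close>)
  then show ?thesis using that by auto
qed

lemma H1_integrable: "f \<in> H1 \<Longrightarrow> integrable lebesgue f"
  by (auto simp: H1_def atomic_decomp_def)

lemma atomic_decomp_L1_le:
  assumes "atomic_decomp f l a" shows "(LINT x|lebesgue. \<bar>f x\<bar>) \<le> (\<Sum>j. \<bar>l j\<bar>)"
proof -
  have A: "\<And>j. \<exists>I. atom_on I (a j)" "summable (\<lambda>j. \<bar>l j\<bar>)" and f: "integrable lebesgue f"
    "(\<lambda>n. LINT x|lebesgue. \<bar>f x - (\<Sum>j<n. l j * a j x)\<bar>) \<longlonglongrightarrow> 0"
    using assms by (auto simp: atomic_decomp_def)
  note t = atomic_decomp_terms[of a l, OF A]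
  have "(LINT x|lebesgue. \<bar>f x\<bar>) \<le> (LINT x|lebesgue. \<bar>f x - (\<Sum>j<n. l j * a j x)\<bar>) + (\<Sum>j. \<bar>l j\<bar>)" for n
  proof -
    have "(LINT x|lebesgue. \<bar>f x\<bar>) \<le> (LINT x|lebesgue. \<bar>f x - (\<Sum>j<n. l j * a j x)\<bar> + (\<Sum>j<n. \<bar>l j * a j x\<bar>))"
    proof (rule integral_mono)
      fix x
      have "\<bar>\<Sum>j<n. l j * a j x\<bar> \<le> (\<Sum>j<n. \<bar>l j * a j x\<bar>)" by (rule sum_abs)
      then show "\<bar>f x\<bar> \<le> \<bar>f x - (\<Sum>j<n. l j * a j x)\<bar> + (\<Sum>j<n. \<bar>l j * a j x\<bar>)" by linarith
    qed (use t(1) f(1) in auto)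
    also have "\<dots> = (LINT x|lebesgue. \<bar>f x - (\<Sum>j<n. l j * a j x)\<bar>) + (\<Sum>j<n. LINT x|lebesgue. \<bar>l j * a j x\<bar>)"
      using t(1) f(1) by (subst Bochner_Integration.integral_add) auto
    also have "(\<Sum>j<n. LINT x|lebesgue. \<bar>l j * a j x\<bar>) \<le> (\<Sum>j<n. \<bar>l j\<bar>)"
      by (intro sum_mono t(2))
    also have "\<dots> \<le> (\<Sum>j. \<bar>l j\<bar>)" using A(2) by (intro sum_le_suminf) auto
    finally show ?thesis by simp
  qed
  then have "(LINT x|lebesgue. \<bar>f x\<bar>) \<le> 0 + (\<Sum>j. \<bar>l j\<bar>)"
    by (intro LIMSEQ_le[OF tendsto_const tendsto_add[OF f(2) tendsto_const]]) auto
  then show ?thesis by simp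
qed

lemma H1_L1_le:
  assumes "f \<in> H1" shows "(LINT x|lebesgue. \<bar>f x\<bar>) \<le> h1_norm f"
proof (rule dense_ge)
  fix c assume "h1_norm f < c"
  then obtain l a where "atomic_decomp f l a" "(\<Sum>j. \<bar>l j\<bar>) < c" using h1_norm_decomp assms by blast
  then show "(LINT x|lebesgue. \<bar>f x\<bar>) \<le> c" using atomic_decomp_L1_le by force
qed

lemma H1_integral_zero:
  assumes "f \<in> H1" shows "(LINT x|lebesgue. f x) = 0"
proof -
  obtain l a where "atomic_decomp f l a" using assms by (auto simp: H1_def)
  then have A: "\<And>j. \<exists>I. atom_on I (a j)" "summable (\<lambda>j. \<bar>l j\<bar>)" and f: "integrable lebesgue f"
    "(\<lambda>n. LINT x|lebesgue. \<bar>f x - (\<Sum>j<n. l j * a j x)\<bar>) \<longlonglongrightarrow> 0"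
    by (auto simp: atomic_decomp_def)
  note t = atomic_decomp_terms[of a l, OF A]
  have z: "(LINT x|lebesgue. l j * a j x) = 0" for j
    using A(1)[of j] atom_integrable(3) by auto
  have "\<bar>LINT x|lebesgue. f x\<bar> \<le> (LINT x|lebesgue. \<bar>f x - (\<Sum>j<n. l j * a j x)\<bar>)" for n
  proof -
    have "(LINT x|lebesgue. f x) = (LINT x|lebesgue. f x - (\<Sum>j<n. l j * a j x))"
      using f(1) t(1) z
      by (subst Bochner_Integration.integral_diff, simp, simp, subst Bochner_Integration.integral_sum, simp)
         (simp del: integral_mult_right_zero mult_eq_0_iff)
    then show ?thesis by (metis integral_abs_bound)
  qed
  then have "\<bar>LINT x|lebesgue. f x\<bar> \<le> 0"
    by (intro LIMSEQ_le[OF tendsto_const f(2)]) auto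
  then show ?thesis by simp
qed

lemma abs_summable_infsum:
  fixes h :: "nat \<Rightarrow> real"
  assumes "summable (\<lambda>i. \<bar>h i\<bar>)"
  shows "h summable_on UNIV" "infsum h UNIV = suminf h"
proof -
  show s: "h summable_on UNIV"
    by (rule norm_summable_imp_summable_on) (use assms in simp)
  show "infsum h UNIV = suminf h"
    by (rule sums_unique[OF has_sum_imp_sums[OF has_sum_infsum[OF s]]])
qed

text \<open>
  Countable subadditivity of the norm: decompositions of the \<open>f k\<close> are merged into a single one by
  enumerating the pairs of indices.
\<close>

lemma H1_series:
  assumes fk: "\<And>k. f k \<in> H1" "\<And>k. h1_norm (f k) < c k" and c: "summable c"
    and g: "integrable lebesgue g" "(\<lambda>n. LINT x|lebesgue. \<bar>g x - (\<Sum>k<n. f k x)\<bar>) \<longlonglongrightarrow> 0"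
  shows "g \<in> H1" "h1_norm g \<le> suminf c"
proof -
  have "\<exists>l a. atomic_decomp (f k) l a \<and> (\<Sum>j. \<bar>l j\<bar>) < c k" for k
    using h1_norm_decomp[OF fk[of k]] by metis
  then obtain l a where la: "\<And>k. atomic_decomp (f k) (l k) (a k)" "\<And>k. (\<Sum>j. \<bar>l k j\<bar>) < c k" by metis
  have c0: "0 \<le> c k" for k using fk(2)[of k] h1_norm_nonneg[OF fk(1)[of k]] by linarith
  have at: "\<exists>I. atom_on I (a k j)" and sl: "summable (\<lambda>j. \<bar>l k j\<bar>)" for k j
    using la(1)[of k] by (auto simp: atomic_decomp_def)
  define m where "m = (\<lambda>i. l (fst (prod_decode i)) (snd (prod_decode i)))"
  define b where "b = (\<lambda>i. a (fst (prod_decode i)) (snd (prod_decode i)))"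
  \<comment> \<open>Finitely many pairs lie in a square, over which the coefficients are summed row by row.\<close>
  have part: "(\<Sum>i<n. \<bar>m i\<bar>) \<le> suminf c" for n
  proof -
    let ?S = "prod_decode ` {..<n}"
    have "finite ?S" by simp
    then obtain N where N: "?S \<subseteq> {..<N} \<times> {..<N}"
    proof -
      define N where "N = Suc (Max (insert 0 (fst ` ?S \<union> snd ` ?S)))"
      have "p \<in> ?S \<Longrightarrow> fst p < N \<and> snd p < N" for p
        unfolding N_def by (intro conjI le_imp_less_Suc Max_ge; simp)
      then have "?S \<subseteq> {..<N} \<times> {..<N}" unfolding subset_eq mem_Times_iff by blast
      then show ?thesis by (rule that)
    qed
    have "(\<Sum>i<n. \<bar>m i\<bar>) = (\<Sum>p\<in>?S. \<bar>l (fst p) (snd p)\<bar>)"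
      by (subst sum.reindex) (auto simp: m_def inj_prod_decode)
    also have "\<dots> \<le> (\<Sum>p\<in>{..<N} \<times> {..<N}. \<bar>l (fst p) (snd p)\<bar>)"
      by (rule sum_mono2) (use N in auto)
    also have "\<dots> = (\<Sum>k<N. \<Sum>j<N. \<bar>l k j\<bar>)"
      by (simp add: sum.cartesian_product case_prod_unfold)
    also have "\<dots> \<le> (\<Sum>k<N. c k)"
    proof (rule sum_mono)
      fix k
      have "(\<Sum>j<N. \<bar>l k j\<bar>) \<le> (\<Sum>j. \<bar>l k j\<bar>)" using sl by (intro sum_le_suminf) auto
      then show "(\<Sum>j<N. \<bar>l k j\<bar>) \<le> c k" using la(2)[of k] by linarith
    qed
    also have "\<dots> \<le> suminf c" using c c0 by (intro sum_le_suminf) auto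
    finally show ?thesis .
  qed
  have sm: "summable (\<lambda>i. \<bar>m i\<bar>)" using part by (intro bounded_imp_summable[where B="suminf c"])
     (simp_all add: lessThan_Suc_atMost[symmetric] del: sum.lessThan_Suc)
  have ms: "(\<Sum>i. \<bar>m i\<bar>) \<le> suminf c" using part sm by (intro suminf_le_const) auto
  have atb: "\<exists>I. atom_on I (b i)" for i using at by (simp add: b_def)
  note t = atomic_decomp_terms[of b m, OF atb sm]
  have L1: "(LINT x|lebesgue. \<bar>f k x\<bar>) \<le> c k" for k
    using H1_L1_le[OF fk(1)[of k]] fk(2)[of k] by linarith
  have sf: "summable (\<lambda>k. LINT x|lebesgue. \<bar>f k x\<bar>)"
    by (rule summable_comparison_test[OF _ c]) (use L1 in auto)
  note s = L1_series[of lebesgue f, OF H1_integrable[OF fk(1)] sf]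
  have gAE: "AE x in lebesgue. g x = (\<Sum>k. f k x)"
    by (rule L1_lim_AE_unique[OF g(1) s(2) _ g(2) s(3)]) (use H1_integrable[OF fk(1)] in auto)
  have fAE: "AE x in lebesgue. \<forall>k. summable (\<lambda>j. \<bar>l k j * a k j x\<bar>) \<and> f k x = (\<Sum>j. l k j * a k j x)"
    using atomic_decomp_AE[OF la(1)] by (subst AE_all_countable) blast
  have bAE: "AE x in lebesgue. summable (\<lambda>i. \<bar>m i * b i x\<bar>)"
    by (rule L1_series(1)[OF t(1) t(3)])
  have "AE x in lebesgue. g x = (\<Sum>i. m i * b i x)"
    using gAE fAE bAE s(1)
  proof eventually_elim
    case (elim x)
    \<comment> \<open>Absolute convergence allows summing the merged series row by row.\<close>
    let ?h = "\<lambda>p. l (fst p) (snd p) * a (fst p) (snd p) x"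
    have sumon: "(\<lambda>i. ?h (prod_decode i)) summable_on UNIV"
      using abs_summable_infsum(1)[OF elim(3)] by (simp add: m_def b_def)
    then have so: "?h summable_on UNIV"
      using summable_on_reindex_bij_betw[OF bij_prod_decode, of ?h] by simp
    have "(\<Sum>i. m i * b i x) = infsum (\<lambda>i. m i * b i x) UNIV"
      by (rule abs_summable_infsum(2)[OF elim(3), symmetric])
    also have "\<dots> = infsum ?h UNIV"
      using infsum_reindex_bij_betw[OF bij_prod_decode, of ?h] by (simp add: m_def b_def)
    also have "\<dots> = (\<Sum>\<^sub>\<infinity>k. \<Sum>\<^sub>\<infinity>j. l k j * a k j x)"
      using infsum_Sigma'_banach[of "\<lambda>k j. ?h (k,j)" UNIV "\<lambda>_. UNIV"] so
      by (simp add: case_prod_unfold)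
    also have "\<dots> = (\<Sum>\<^sub>\<infinity>k. f k x)"
    proof (rule infsum_cong)
      fix k
      have "summable (\<lambda>j. \<bar>l k j * a k j x\<bar>)" "f k x = (\<Sum>j. l k j * a k j x)"
        using elim(2) by blast+
      then show "(\<Sum>\<^sub>\<infinity>j. l k j * a k j x) = f k x"
        using abs_summable_infsum(2) by simp
    qed
    also have "\<dots> = (\<Sum>k. f k x)"
      by (rule abs_summable_infsum(2)[OF elim(4)])
    finally show ?case using elim(1) by simp
  qed
  then have D: "atomic_decomp g m b"
    by (intro atomic_decomp_AE_I atb sm) (use g(1) in auto)
  then show "g \<in> H1" by (rule H1_I)
  show "h1_norm g \<le> suminf c" using h1_norm_le[OF D] ms by simp
qed

lemma H1_series_le:
  assumes fk: "\<And>k. f k \<in> H1" "\<And>k. h1_norm (f k) \<le> c k" and c: "summable c"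
    and g: "integrable lebesgue g" "(\<lambda>n. LINT x|lebesgue. \<bar>g x - (\<Sum>k<n. f k x)\<bar>) \<longlonglongrightarrow> 0"
  shows "g \<in> H1" "h1_norm g \<le> suminf c"
proof -
  have ps: "(\<lambda>k. e * (1/2)^Suc k) sums e" for e :: real
    using sums_mult[OF power_half_series, of e] by simp
  have *: "g \<in> H1 \<and> h1_norm g \<le> suminf c + e" if "e > 0" for e :: real
  proof -
    have s: "(\<lambda>k. c k + e * (1/2)^Suc k) sums (suminf c + e)"
      using c by (intro sums_add ps summable_sums)
    have lt: "h1_norm (f k) < c k + e * (1/2)^Suc k" for k
    proof -
      have "0 < e * (1/2)^Suc k" using that by simp
      then show ?thesis using fk(2)[of k] by linarith
    qed
    show ?thesis
      using H1_series[OF fk(1) lt sums_summable[OF s] g] sums_unique[OF s] by simp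
  qed
  from *[of 1] show "g \<in> H1" by simp
  show "h1_norm g \<le> suminf c" by (rule field_le_epsilon) (use * in auto)
qed

lemma zero_in_H1: "(\<lambda>x. 0) \<in> H1" and h1_norm_zero: "h1_norm (\<lambda>x. 0) = 0"
proof -
  have D: "atomic_decomp (\<lambda>x. 0) (\<lambda>j. 0) (\<lambda>j x. 0)"
    using atom_on_zero by (auto simp: atomic_decomp_def)
  show "(\<lambda>x. 0) \<in> H1" using D by (rule H1_I)
  then show "h1_norm (\<lambda>x. 0) = 0" using h1_norm_le[OF D] h1_norm_nonneg by force
qed

lemma H1_add:
  assumes "f \<in> H1" "g \<in> H1"
  shows "(\<lambda>x. f x + g x) \<in> H1" "h1_norm (\<lambda>x. f x + g x) \<le> h1_norm f + h1_norm g"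
proof -
  define F where "F = (\<lambda>k::nat. if k = 0 then f else if k = 1 then g else (\<lambda>x. 0))"
  define c where "c = (\<lambda>k::nat. if k = 0 then h1_norm f else if k = 1 then h1_norm g else 0)"
  have F: "F k \<in> H1" "h1_norm (F k) \<le> c k" for k
    using assms zero_in_H1 h1_norm_zero by (auto simp: F_def c_def)
  have cs: "c sums (\<Sum>k\<in>{0,1}. c k)"
    by (rule sums_finite) (auto simp: c_def)
  have i: "integrable lebesgue (\<lambda>x. f x + g x)"
    using assms H1_integrable by auto
  have "(\<Sum>k<n. F k x) = f x + g x" if "n \<ge> 2" for n x
  proof -
    have "(\<Sum>k<n. F k x) = (\<Sum>k\<in>{0,1}. F k x)"
      by (rule sum.mono_neutral_right) (use that in \<open>auto simp: F_def\<close>)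
    then show ?thesis by (simp add: F_def)
  qed
  then have "\<forall>\<^sub>F n in sequentially. (LINT x|lebesgue. \<bar>(f x + g x) - (\<Sum>k<n. F k x)\<bar>) = 0"
    by (intro eventually_sequentiallyI[of 2]) simp
  then have t: "(\<lambda>n. LINT x|lebesgue. \<bar>(f x + g x) - (\<Sum>k<n. F k x)\<bar>) \<longlonglongrightarrow> 0"
    by (rule tendsto_eventually)
  note H = H1_series_le[OF F sums_summable[OF cs] i t]
  show "(\<lambda>x. f x + g x) \<in> H1" by (rule H)
  have "suminf c = h1_norm f + h1_norm g" using sums_unique[OF cs] by (simp add: c_def)
  then show "h1_norm (\<lambda>x. f x + g x) \<le> h1_norm f + h1_norm g" using H(2) by simp
qed

lemma H1_scale:
  assumes "f \<in> H1"
  shows "(\<lambda>x. s * f x) \<in> H1" "h1_norm (\<lambda>x. s * f x) \<le> \<bar>s\<bar> * h1_norm f"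
proof -
  have D: "atomic_decomp (\<lambda>x. s * f x) (\<lambda>j. s * l j) a" if "atomic_decomp f l a" for l a
  proof (rule atomic_decomp_AE_I)
    show "AE x in lebesgue. s * f x = (\<Sum>j. s * l j * a j x)"
      using atomic_decomp_AE[OF that]
    proof eventually_elim
      case (elim x)
      then show ?case
        using suminf_mult[of "\<lambda>j. l j * a j x" s] summable_rabs_cancel by (auto simp: mult.assoc)
    qed
    show "summable (\<lambda>j. \<bar>s * l j\<bar>)"
      using that by (auto simp: atomic_decomp_def abs_mult intro: summable_mult)
    have "integrable lebesgue f" using that by (simp add: atomic_decomp_def)
    then show "(\<lambda>x. s * f x) \<in> borel_measurable lebesgue" by auto
  qed (use that in \<open>auto simp: atomic_decomp_def\<close>)
  show "(\<lambda>x. s * f x) \<in> H1" using D assms by (auto simp: H1_def)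
  have *: "h1_norm (\<lambda>x. s * f x) \<le> \<bar>s\<bar> * c" if less: "h1_norm f < c" for c
  proof -
    obtain l a where la: "atomic_decomp f l a" "(\<Sum>j. \<bar>l j\<bar>) < c"
      using assms less by (rule h1_norm_decomp)
    have "h1_norm (\<lambda>x. s * f x) \<le> (\<Sum>j. \<bar>s * l j\<bar>)" by (rule h1_norm_le[OF D[OF la(1)]])
    also have "\<dots> = \<bar>s\<bar> * (\<Sum>j. \<bar>l j\<bar>)"
      using la(1) by (simp add: abs_mult atomic_decomp_def suminf_mult)
    also have "\<dots> \<le> \<bar>s\<bar> * c" using la(2) by (intro mult_left_mono) auto
    finally show ?thesis .
  qed
  show "h1_norm (\<lambda>x. s * f x) \<le> \<bar>s\<bar> * h1_norm f"
  proof (cases "s = 0")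
    case False
    have "h1_norm (\<lambda>x. s * f x) / \<bar>s\<bar> \<le> h1_norm f"
      by (rule dense_ge) (use * False in \<open>simp add: field_simps\<close>)
    then show ?thesis using False by (simp add: field_simps)
  qed (simp add: h1_norm_zero)
qed

lemma H1_lincomb:
  assumes "f \<in> H1" "g \<in> H1" shows "(\<lambda>x. s * f x + t * g x) \<in> H1"
  by (intro H1_add(1) H1_scale(1) assms)

lemma H1_diff:
  assumes "f \<in> H1" "g \<in> H1"
  shows "(\<lambda>x. f x - g x) \<in> H1" "h1_norm (\<lambda>x. f x - g x) \<le> h1_norm f + h1_norm g"
  using H1_add[OF assms(1) H1_scale(1)[OF assms(2), of "-1"]] H1_scale(2)[OF assms(2), of "-1"]
  by auto

text \<open>
  A bounded function with mean zero on an interval is a multiple of an atom. If its bound \<open>B\<close> is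
  zero, the division by zero in the proof produces the zero atom.
\<close>

lemma H1_bounded:
  fixes f :: "real \<Rightarrow> real"
  assumes ab: "a < b" and f: "f \<in> borel_measurable lebesgue" "\<And>x. \<bar>f x\<bar> \<le> B"
    "\<And>x. x \<notin> {a..b} \<Longrightarrow> f x = 0" "(LINT x|lebesgue. f x) = 0"
  shows "f \<in> H1" "h1_norm f \<le> B * (b - a)"
proof -
  define c where "c = B * (b - a)"
  have B0: "B \<ge> 0" using f(2)[of 0] by linarith
  then have c0: "c \<ge> 0" using ab by (simp add: c_def)
  define u where "u = (\<lambda>j::nat. if j = 0 then (\<lambda>x. f x / c) else (\<lambda>x. 0))"
  define l where "l = (\<lambda>j::nat. if j = 0 then c else 0)"
  have fx: "c * (f x / c) = f x" for x
    using f(2)[of x] ab by (cases "c = 0") (auto simp: c_def)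
  have at: "atom_on {a..b} (\<lambda>x. f x / c)"
    unfolding atom_on_def
  proof (intro conjI allI)
    have "{x. f x / c \<noteq> 0} \<subseteq> {a..b}" using f(3) by (force simp del: atLeastAtMost_iff)
    then show "closure {x. f x / c \<noteq> 0} \<subseteq> {a..b}" by (intro closure_minimal) auto
    show "\<bar>f x / c\<bar> \<le> 1 / measure lebesgue {a..b}" for x
    proof (cases "B = 0")
      case False
      then have "c > 0" using ab B0 by (simp add: c_def)
      then have "\<bar>f x / c\<bar> \<le> B / c" using f(2)[of x] by (simp add: divide_right_mono)
      also have "B / c = 1 / measure lebesgue {a..b}" using False ab by (simp add: c_def)
      finally show ?thesis .
    qed (use ab in \<open>simp add: c_def\<close>)
    have "(LINT x:{a..b}|lebesgue. f x / c) = (LINT x|lebesgue. f x / c)"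
      unfolding set_lebesgue_integral_def
      by (rule Bochner_Integration.integral_cong) (use f(3) in \<open>auto simp: indicator_def\<close>)
    then show "(LINT x:{a..b}|lebesgue. f x / c) = 0" using f(4) by simp
  qed (use ab f(1) bdd_interval_Icc in auto)
  have "\<exists>I. atom_on I (u j)" for j
    using at atom_on_zero by (cases "j = 0") (auto simp: u_def)
  moreover have ls: "(\<lambda>j. \<bar>l j\<bar>) sums (\<Sum>j\<in>{0}. \<bar>l j\<bar>)"
    by (rule sums_finite) (auto simp: l_def)
  moreover have "(\<lambda>j. l j * u j x) sums (\<Sum>j\<in>{0}. l j * u j x)" for x
    by (rule sums_finite) (auto simp: l_def)
  then have "f x = (\<Sum>j. l j * u j x)" for x
    using fx by (auto simp: l_def u_def dest!: sums_unique)
  ultimately have D: "atomic_decomp f l u"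
    by (intro atomic_decomp_AE_I f(1)) (auto intro: sums_summable)
  show "f \<in> H1" using D by (rule H1_I)
  show "h1_norm f \<le> B * (b - a)"
    using h1_norm_le[OF D] sums_unique[OF ls] c0 by (simp add: l_def c_def)
qed

lemma bdd_interval_closure:
  assumes "bdd_interval I"
  obtains a b where "a < b" "I \<subseteq> {a..b}" "closure I = {a..b}" "measure lebesgue I = b - a"
proof -
  have I: "is_interval I" "bounded I" "0 < measure lebesgue I" using assms by (auto simp: bdd_interval_def)
  then have ne: "I \<noteq> {}" by auto
  have cv: "convex I" using I by (simp add: is_interval_convex_1)
  have "connected (closure I)" "compact (closure I)"
    using convex_connected[OF convex_closure[OF cv]] I(2) by (auto simp: compact_closure)
  then obtain a b where ab: "closure I = {a..b}"
    using connected_compact_interval_1[of "closure I"] by auto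
  have "measure lebesgue (closure I) = measure lebesgue I"
    by (rule measure_closure[OF I(2) negligible_convex_frontier[OF cv]])
  then have m: "measure lebesgue I = measure lebesgue {a..b}" using ab by simp
  then have "a < b" using I(3) by (cases "a < b") (auto simp: content_real_if split: if_splits)
  then show ?thesis using that ab m closure_subset by fastforce
qed

section \<open>Functionals on \<open>H1\<close>\<close>

lemma dual_space_lin:
  assumes "L \<in> dual_space V N" "f \<in> V" "g \<in> V"
  shows "L (\<lambda>x. s * f x + t * g x) = s * L f + t * L g"
  using assms by (auto simp: dual_space_def)

lemma dual_space_bound:
  assumes "L \<in> dual_space V N" "\<And>f. f \<in> V \<Longrightarrow> 0 \<le> N f"
  obtains C where "C > 0" "\<And>f. f \<in> V \<Longrightarrow> \<bar>L f\<bar> \<le> C * N f"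
proof -
  have "\<exists>C. \<forall>f\<in>V. \<bar>L f\<bar> \<le> C * N f" using assms(1) by (simp add: dual_space_def)
  then obtain C where C: "\<And>f. f \<in> V \<Longrightarrow> \<bar>L f\<bar> \<le> C * N f" by blast
  have "\<bar>L f\<bar> \<le> (max C 1) * N f" if "f \<in> V" for f
    using C[OF that] mult_right_mono[of C "max C 1", OF _ assms(2)[OF that]] by linarith
  then show ?thesis using that[of "max C 1"] by simp
qed

lemma atom_H1:
  assumes "atom_on I a" shows "a \<in> H1" "h1_norm a \<le> 1"
proof -
  define u where "u = (\<lambda>j::nat. a)"
  define l where "l = (\<lambda>j::nat. if j = 0 then 1 else 0::real)"
  have ls: "(\<lambda>j. \<bar>l j\<bar>) sums (\<Sum>j\<in>{0}. \<bar>l j\<bar>)"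
    by (rule sums_finite) (auto simp: l_def)
  moreover have "(\<lambda>j. l j * u j x) sums (\<Sum>j\<in>{0}. l j * u j x)" for x
    by (rule sums_finite) (auto simp: l_def)
  then have "a x = (\<Sum>j. l j * u j x)" for x
    by (auto simp: l_def u_def dest!: sums_unique)
  ultimately have D: "atomic_decomp a l u"
    using assms by (intro atomic_decomp_AE_I) (auto intro: sums_summable simp: u_def atom_on_def)
  show "a \<in> H1" using D by (rule H1_I)
  show "h1_norm a \<le> 1"
    using h1_norm_le[OF D] sums_unique[OF ls] by (simp add: l_def)
qed

lemma atomic_decomp_remainder:
  assumes "atomic_decomp f l a"
  shows "atomic_decomp (\<lambda>x. f x - (\<Sum>j<n. l j * a j x)) (\<lambda>j. l (j+n)) (\<lambda>j. a (j+n))"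
proof (rule atomic_decomp_AE_I)
  have A: "\<And>j. \<exists>I. atom_on I (a j)" "summable (\<lambda>j. \<bar>l j\<bar>)" and f: "integrable lebesgue f"
    using assms by (auto simp: atomic_decomp_def)
  note t = atomic_decomp_terms[of a l, OF A]
  show "\<exists>I. atom_on I (a (j+n))" for j by (rule A)
  show "summable (\<lambda>j. \<bar>l (j+n)\<bar>)" using A(2) by (simp add: summable_iff_shift[of "\<lambda>j. \<bar>l j\<bar>"])
  show "(\<lambda>x. f x - (\<Sum>j<n. l j * a j x)) \<in> borel_measurable lebesgue"
    by (rule borel_measurable_integrable) (intro Bochner_Integration.integrable_diff f Bochner_Integration.integrable_sum t(1))
  show "AE x in lebesgue. f x - (\<Sum>j<n. l j * a j x) = (\<Sum>j. l (j+n) * a (j+n) x)"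
    using atomic_decomp_AE[OF assms]
  proof eventually_elim
    case (elim x)
    then show ?case
      using suminf_minus_initial_segment[of "\<lambda>j. l j * a j x" n] summable_rabs_cancel by fastforce
  qed
qed

text \<open>
  A bounded functional may be applied termwise to an atomic decomposition, since the remainders of
  the series are small in the norm of \<open>H1\<close>. Hence it is determined by its values on atoms.
\<close>

lemma dual_H1_sums:
  assumes L: "L \<in> dual_space H1 h1_norm" and D: "atomic_decomp f l a"
  shows "(\<lambda>j. l j * L (a j)) sums L f"
proof -
  have A: "\<And>j. \<exists>I. atom_on I (a j)" and sl: "summable (\<lambda>j. \<bar>l j\<bar>)"
    using D by (auto simp: atomic_decomp_def)
  have aH: "a j \<in> H1" for j using A[of j] atom_H1 by blast
  have z: "L (\<lambda>x. 0) = 0"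
    using dual_space_lin[OF L zero_in_H1 zero_in_H1, of 0 0] by simp
  have S: "(\<lambda>x. \<Sum>j<n. l j * a j x) \<in> H1 \<and> L (\<lambda>x. \<Sum>j<n. l j * a j x) = (\<Sum>j<n. l j * L (a j))" for n
  proof (induction n)
    case (Suc n)
    then show ?case
      using H1_lincomb[OF conjunct1[OF Suc] aH[of n], of 1 "l n"]
        dual_space_lin[OF L conjunct1[OF Suc] aH[of n], of 1 "l n"] by simp
  qed (use zero_in_H1 z in auto)
  obtain C where C: "C > 0" "\<And>f. f \<in> H1 \<Longrightarrow> \<bar>L f\<bar> \<le> C * h1_norm f"
    using dual_space_bound[OF L h1_norm_nonneg] by blast
  have fH: "f \<in> H1" using D by (rule H1_I)
  have b: "\<bar>L f - (\<Sum>j<n. l j * L (a j))\<bar> \<le> C * ((\<Sum>j. \<bar>l j\<bar>) - (\<Sum>j<n. \<bar>l j\<bar>))" for n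
  proof -
    let ?r = "\<lambda>x. f x - (\<Sum>j<n. l j * a j x)"
    have "L ?r = L f - (\<Sum>j<n. l j * L (a j))"
      using dual_space_lin[OF L fH conjunct1[OF S[of n]], of 1 "-1"] S[of n] by simp
    moreover have "\<bar>L ?r\<bar> \<le> C * h1_norm ?r" using H1_diff(1)[OF fH conjunct1[OF S[of n]]] C by simp
    moreover have "h1_norm ?r \<le> (\<Sum>j. \<bar>l (j+n)\<bar>)"
      by (rule h1_norm_le[OF atomic_decomp_remainder[OF D]])
    moreover have "(\<Sum>j. \<bar>l (j+n)\<bar>) = (\<Sum>j. \<bar>l j\<bar>) - (\<Sum>j<n. \<bar>l j\<bar>)"
      using suminf_minus_initial_segment[OF sl, of n] by simp
    ultimately have "\<bar>L f - (\<Sum>j<n. l j * L (a j))\<bar> \<le> C * h1_norm ?r"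
      "h1_norm ?r \<le> (\<Sum>j. \<bar>l j\<bar>) - (\<Sum>j<n. \<bar>l j\<bar>)" by simp_all
    then show ?thesis using C(1)
      by (meson less_imp_le mult_left_mono order_trans)
  qed
  have "(\<lambda>n. C * ((\<Sum>j. \<bar>l j\<bar>) - (\<Sum>j<n. \<bar>l j\<bar>))) \<longlonglongrightarrow> C * ((\<Sum>j. \<bar>l j\<bar>) - (\<Sum>j. \<bar>l j\<bar>))"
    by (intro tendsto_intros summable_LIMSEQ sl)
  then have "(\<lambda>n. C * ((\<Sum>j. \<bar>l j\<bar>) - (\<Sum>j<n. \<bar>l j\<bar>))) \<longlonglongrightarrow> 0" by simp
  from tendsto_sandwich[OF _ _ tendsto_const this]
  have "(\<lambda>n. \<bar>L f - (\<Sum>j<n. l j * L (a j))\<bar>) \<longlonglongrightarrow> 0" using b by simp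
  then have "(\<lambda>n. L f - (L f - (\<Sum>j<n. l j * L (a j)))) \<longlonglongrightarrow> L f - 0"
    unfolding tendsto_rabs_zero_iff by (intro tendsto_diff tendsto_const)
  then show ?thesis by (simp add: sums_def)
qed

lemma dual_H1_eqI:
  assumes "L \<in> dual_space H1 h1_norm" "L' \<in> dual_space H1 h1_norm"
    and "\<And>I a. atom_on I a \<Longrightarrow> L a = L' a"
  shows "L = L'"
proof
  fix f
  show "L f = L' f"
  proof (cases "f \<in> H1")
    case True
    then obtain l a where D: "atomic_decomp f l a" by (auto simp: H1_def)
    have "L (a j) = L' (a j)" for j
    proof -
      have "\<exists>I. atom_on I (a j)" using D by (simp add: atomic_decomp_def)
      then show ?thesis using assms(3) by blast
    qed
    then show ?thesis
      using dual_H1_sums[OF assms(1) D] dual_H1_sums[OF assms(2) D] sums_unique2 by force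
  next
    case False
    then show ?thesis using assms by (auto simp: dual_space_def extensional_def)
  qed
qed

section \<open>Bounded functions supported in an interval\<close>

text \<open>
  Bounded measurable functions vanishing off \<open>[a,b)\<close>. Half-open intervals are used because they split
  into disjoint halves.
\<close>

definition bsupp :: "real \<Rightarrow> real \<Rightarrow> (real \<Rightarrow> real) \<Rightarrow> bool" where
  "bsupp a b f \<longleftrightarrow> f \<in> borel_measurable lebesgue \<and> bounded (range f) \<and> (\<forall>x. x \<notin> {a..<b} \<longrightarrow> f x = 0)"

lemma bsupp_I:
  "f \<in> borel_measurable lebesgue \<Longrightarrow> (\<And>x. \<bar>f x\<bar> \<le> B) \<Longrightarrow> (\<And>x. x \<notin> {a..<b} \<Longrightarrow> f x = 0) \<Longrightarrow> bsupp a b f"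
  by (auto simp: bsupp_def bounded_iff)

lemma bsupp_bound:
  assumes "bsupp a b f" obtains B where "B > 0" "\<And>x. \<bar>f x\<bar> \<le> B"
  using assms by (auto simp: bsupp_def bounded_pos)

lemma bsupp_measurable: "bsupp a b f \<Longrightarrow> f \<in> borel_measurable lebesgue"
  by (simp add: bsupp_def)

lemma Ico_lebesgue[simp]: "{a..<b::real} \<in> sets lebesgue"
  by (simp add: lborelD)

lemma integral_indicator_Ico: "a \<le> b \<Longrightarrow> (LINT x|lebesgue. indicator {a..<b} x) = b - (a::real)"
  by simp

lemma integrable_indicator_Ico: "integrable lebesgue (indicator {a..<b::real} :: real \<Rightarrow> real)"
proof -
  have "{a..<b} \<in> lmeasurable"
    by (rule measurable_convex) (auto intro: convex_real_interval bounded_subset[OF bounded_closed_interval[of a b]])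
  then show ?thesis by (simp add: fmeasurable_def)
qed

lemma bsupp_integrable:
  assumes "bsupp a b f" shows "integrable lebesgue f"
proof -
  obtain B where B: "\<And>x. \<bar>f x\<bar> \<le> B" using bsupp_bound[OF assms] by blast
  have i: "integrable lebesgue (\<lambda>x. B * indicator {a..<b} x)"
    using integrable_indicator_Ico by auto
  have "norm (f x) \<le> norm (B * indicator {a..<b} x)" for x
    using assms B[of x] by (cases "x \<in> {a..<b}") (auto simp: bsupp_def)
  then show ?thesis
    by (intro Bochner_Integration.integrable_bound[OF i]) (use assms in \<open>auto simp: bsupp_def\<close>)
qed

lemma bsupp_ind: "bsupp a b (\<lambda>x. c * indicator {a..<b} x)"
proof (rule bsupp_I[where B="\<bar>c\<bar>"])
  show "(\<lambda>x. c * indicator {a..<b} x) \<in> borel_measurable lebesgue"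
    using integrable_indicator_Ico[of a b] by auto
qed (auto simp: indicator_def)

lemma bsupp_add: "bsupp a b f \<Longrightarrow> bsupp a b g \<Longrightarrow> bsupp a b (\<lambda>x. f x + g x)"
  by (auto simp: bsupp_def intro!: bounded_plus_comp)

lemma bsupp_diff: "bsupp a b f \<Longrightarrow> bsupp a b g \<Longrightarrow> bsupp a b (\<lambda>x. f x - g x)"
  by (auto simp: bsupp_def intro!: bounded_minus_comp)

lemma bsupp_mult:
  assumes "bsupp a b f" "bsupp a b g" shows "bsupp a b (\<lambda>x. f x * g x)"
proof -
  obtain A B where "A > 0" "\<And>x. \<bar>f x\<bar> \<le> A" "B > 0" "\<And>x. \<bar>g x\<bar> \<le> B"
    using bsupp_bound assms by metis
  then show ?thesis using assms
    by (intro bsupp_I[where B="A*B"]) (auto simp: bsupp_def abs_mult intro!: mult_mono)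
qed

lemma bsupp_cmult: "bsupp a b f \<Longrightarrow> bsupp a b (\<lambda>x. c * f x)"
proof -
  assume a: "bsupp a b f"
  then obtain B where "\<And>x. \<bar>f x\<bar> \<le> B" using bsupp_bound by blast
  then show ?thesis using a
    by (intro bsupp_I[where B="\<bar>c\<bar>*B"]) (auto simp: bsupp_def abs_mult intro!: mult_left_mono)
qed

lemma bsupp_abs: "bsupp a b f \<Longrightarrow> bsupp a b (\<lambda>x. \<bar>f x\<bar>)"
  by (auto simp: bsupp_def bounded_iff)

lemma bsupp_square: "bsupp a b f \<Longrightarrow> bsupp a b (\<lambda>x. (f x)\<^sup>2)"
  using bsupp_mult[of a b f f] by (simp add: power2_eq_square)

lemma bsupp_mono: "bsupp a b f \<Longrightarrow> a' \<le> a \<Longrightarrow> b \<le> b' \<Longrightarrow> bsupp a' b' f"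
  by (auto simp: bsupp_def)

lemma bsupp_H1:
  assumes "a < b" "bsupp a b f" "(LINT x|lebesgue. f x) = 0" "\<And>x. \<bar>f x\<bar> \<le> B"
  shows "f \<in> H1" "h1_norm f \<le> B * (b - a)"
proof -
  have "f x = 0" if "x \<notin> {a..b}" for x using that assms(2) by (auto simp: bsupp_def)
  then show "f \<in> H1" "h1_norm f \<le> B * (b - a)"
    using H1_bounded[of a b f B] assms by (simp_all add: bsupp_def)
qed

lemma bsupp_mean_zero_in_H1:
  assumes "bsupp a b f" "(LINT x|lebesgue. f x) = 0"
  shows "f \<in> H1"
proof -
  obtain B where "\<And>x. \<bar>f x\<bar> \<le> B" using bsupp_bound[OF assms(1)] by blast
  moreover have "bsupp a (max b (a + 1)) f" using assms(1) by (rule bsupp_mono) auto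
  ultimately show ?thesis using bsupp_H1(1)[of a "max b (a + 1)" f B] assms(2) by simp
qed

text \<open>
  Subtracting the mean \<open>m\<close> from \<open>f\<close>. The second claim is the variance identity; the third and the
  fourth, which is the Cauchy-Schwarz inequality, follow from it.
\<close>

lemma bsupp_center:
  fixes f :: "real \<Rightarrow> real"
  assumes ab: "a < b" and f: "bsupp a b f"
  defines "m \<equiv> (LINT x|lebesgue. f x) / (b - a)"
  shows "(LINT x|lebesgue. f x - m * indicator {a..<b} x) = 0"
    and "(LINT x|lebesgue. (f x - m * indicator {a..<b} x)\<^sup>2) = (LINT x|lebesgue. (f x)\<^sup>2) - m\<^sup>2 * (b - a)"
    and "(LINT x|lebesgue. (f x - m * indicator {a..<b} x)\<^sup>2) \<le> (LINT x|lebesgue. (f x)\<^sup>2)"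
    and "m\<^sup>2 * (b - a) \<le> (LINT x|lebesgue. (f x)\<^sup>2)"
proof -
  note i = bsupp_integrable[OF f] bsupp_integrable[OF bsupp_square[OF f]] integrable_indicator_Ico[of a b]
  have mb: "(LINT x|lebesgue. f x) = m * (b - a)" using ab by (simp add: m_def)
  show "(LINT x|lebesgue. f x - m * indicator {a..<b} x) = 0"
    using i ab mb by simp
  have "(f x - m * indicator {a..<b} x)\<^sup>2 = (f x)\<^sup>2 - 2 * m * f x + m\<^sup>2 * indicator {a..<b} x" for x
    using f by (cases "x \<in> {a..<b}") (auto simp: bsupp_def power2_diff)
  then have "(LINT x|lebesgue. (f x - m * indicator {a..<b} x)\<^sup>2)
     = (LINT x|lebesgue. (f x)\<^sup>2 - 2 * m * f x + m\<^sup>2 * indicator {a..<b} x)" by simp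
  also have "\<dots> = (LINT x|lebesgue. (f x)\<^sup>2) - 2 * m * (LINT x|lebesgue. f x) + m\<^sup>2 * (b - a)"
    using i ab by simp
  finally show *: "(LINT x|lebesgue. (f x - m * indicator {a..<b} x)\<^sup>2) = (LINT x|lebesgue. (f x)\<^sup>2) - m\<^sup>2 * (b - a)"
    by (simp add: mb power2_eq_square algebra_simps)
  have "0 \<le> m\<^sup>2 * (b - a)" using ab by simp
  then show "(LINT x|lebesgue. (f x - m * indicator {a..<b} x)\<^sup>2) \<le> (LINT x|lebesgue. (f x)\<^sup>2)"
    using * by linarith
  have "0 \<le> (LINT x|lebesgue. (f x - m * indicator {a..<b} x)\<^sup>2)" by simp
  then show "m\<^sup>2 * (b - a) \<le> (LINT x|lebesgue. (f x)\<^sup>2)" using * by linarith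
qed

text \<open>
  In this estimate and in those of the norm of \<open>H1\<close>, \<open>s\<close> is an upper bound for the normalised \<open>L\<^sup>2\<close> norm, the square root
  of \<open>\<integral> f\<^sup>2 / (b - a)\<close>.
\<close>

lemma bsupp_L1_L2:
  assumes ab: "a < b" and f: "bsupp a b f" and s: "s \<ge> 0" "(LINT x|lebesgue. (f x)\<^sup>2) \<le> s\<^sup>2 * (b - a)"
  shows "(LINT x|lebesgue. \<bar>f x\<bar>) \<le> s * (b - a)"
proof -
  let ?m = "(LINT x|lebesgue. \<bar>f x\<bar>) / (b - a)"
  have "?m\<^sup>2 * (b - a) \<le> s\<^sup>2 * (b - a)"
    using bsupp_center(4)[OF ab bsupp_abs[OF f]] s by simp
  then have "?m\<^sup>2 \<le> s\<^sup>2" using ab by simp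
  then have "?m \<le> s" using s(1) by (rule power2_le_imp_le)
  then show ?thesis using ab by (simp add: field_simps)
qed

section \<open>The Calderon-Zygmund decomposition of dyadic step functions\<close>

text \<open>
  The functions that are constant on each of the \<open>2\<^sup>n\<close> intervals obtained by halving \<open>[a,b)\<close> \<open>n\<close>
  times, and vanish off \<open>[a,b)\<close>.
\<close>

fun dstep :: "nat \<Rightarrow> real \<Rightarrow> real \<Rightarrow> (real \<Rightarrow> real) set" where
  "dstep 0 a b = {(\<lambda>x. c * indicator {a..<b} x) | c. True}"
| "dstep (Suc n) a b = {(\<lambda>x. f x + g x) | f g. f \<in> dstep n a ((a+b)/2) \<and> g \<in> dstep n ((a+b)/2) b}"

lemma dstep_bsupp: "a < b \<Longrightarrow> f \<in> dstep n a b \<Longrightarrow> bsupp a b f"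
proof (induction n arbitrary: a b f)
  case 0
  then show ?case using bsupp_ind by auto
next
  case (Suc n)
  then obtain g h where f: "f = (\<lambda>x. g x + h x)" "g \<in> dstep n a ((a+b)/2)" "h \<in> dstep n ((a+b)/2) b"
    by auto
  have "bsupp a b g" using Suc.IH[OF _ f(2)] Suc.prems by (auto intro: bsupp_mono)
  moreover have "bsupp a b h" using Suc.IH[OF _ f(3)] Suc.prems by (auto intro: bsupp_mono)
  ultimately show ?case unfolding f(1) by (rule bsupp_add)
qed

lemma indicator_halves:
  assumes "a < (b::real)"
  shows "(indicator {a..<b} x :: real) = indicator {a..<(a+b)/2} x + indicator {(a+b)/2..<b} x"
  using assms by (auto simp: indicator_def)

lemma dstep_lincomb:
  "f \<in> dstep n a b \<Longrightarrow> g \<in> dstep n a b \<Longrightarrow> (\<lambda>x. s * f x + t * g x) \<in> dstep n a b"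
proof (induction n arbitrary: a b f g)
  case 0
  then obtain c d where "f = (\<lambda>x. c * indicator {a..<b} x)" "g = (\<lambda>x. d * indicator {a..<b} x)" by auto
  then have "(\<lambda>x. s * f x + t * g x) = (\<lambda>x. (s * c + t * d) * indicator {a..<b} x)"
    by (auto simp: algebra_simps)
  then show ?case by auto
next
  case (Suc n)
  obtain f1 f2 g1 g2 where fg: "f = (\<lambda>x. f1 x + f2 x)" "f1 \<in> dstep n a ((a+b)/2)" "f2 \<in> dstep n ((a+b)/2) b"
    "g = (\<lambda>x. g1 x + g2 x)" "g1 \<in> dstep n a ((a+b)/2)" "g2 \<in> dstep n ((a+b)/2) b"
    using Suc.prems by auto
  have "(\<lambda>x. s * f x + t * g x) = (\<lambda>x. (s * f1 x + t * g1 x) + (s * f2 x + t * g2 x))"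
    by (auto simp: fg algebra_simps)
  then show ?case
    using Suc.IH[OF fg(2,5)] Suc.IH[OF fg(3,6)] by auto
qed

lemma dstep_const: "a < b \<Longrightarrow> (\<lambda>x. c * indicator {a..<b} x) \<in> dstep n a b"
proof (induction n arbitrary: a b)
  case (Suc n)
  have "(\<lambda>x. c * indicator {a..<b} x) = (\<lambda>x. c * indicator {a..<(a+b)/2} x + c * indicator {(a+b)/2..<b} x)"
    using indicator_halves[OF Suc.prems] by (simp add: algebra_simps)
  then show ?case using Suc.IH[of a "(a+b)/2"] Suc.IH[of "(a+b)/2" b] Suc.prems by auto
qed auto

lemma dstep_Suc: "a < b \<Longrightarrow> f \<in> dstep n a b \<Longrightarrow> f \<in> dstep (Suc n) a b"
proof (induction n arbitrary: a b f)
  case 0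
  then show ?case using dstep_const[of a b _ "Suc 0"] by auto
next
  case (Suc n)
  then obtain g h where f: "f = (\<lambda>x. g x + h x)" "g \<in> dstep n a ((a+b)/2)" "h \<in> dstep n ((a+b)/2) b"
    by auto
  have "g \<in> dstep (Suc n) a ((a+b)/2)" "h \<in> dstep (Suc n) ((a+b)/2) b"
    using Suc.IH[OF _ f(2)] Suc.IH[OF _ f(3)] Suc.prems(1) by auto
  then show ?case unfolding f(1) dstep.simps(2)[of "Suc n"] by blast
qed

lemma dstep_mono: "a < b \<Longrightarrow> n \<le> m \<Longrightarrow> f \<in> dstep n a b \<Longrightarrow> f \<in> dstep m a b"
  by (rotate_tac 1, induction rule: dec_induct) (auto intro: dstep_Suc simp del: dstep.simps)

lemma dstep_center:
  assumes "a < b" "f \<in> dstep n a b"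
  shows "(\<lambda>x. f x - m * indicator {a..<b} x) \<in> dstep n a b"
  using dstep_lincomb[OF assms(2) dstep_const[OF assms(1), of m], of 1 "-1"] by simp

text \<open>
  Calderon-Zygmund decomposition at height \<open>r\<close>, for a function whose mean square is at most \<open>r\<^sup>2\<close>.
  The first dyadic intervals on which the mean square exceeds \<open>r\<^sup>2\<close> are selected. The good part \<open>g\<close> is
  the mean of \<open>f\<close> on the selected intervals and \<open>f\<close> elsewhere; it is at most \<open>2 r\<close> because the mean
  square over a selected interval is at most twice that over its parent, hence at most \<open>2 r\<^sup>2\<close>. On a
  selected interval, the bad part \<open>f - g\<close> has fewer generations, so the hypothesis \<open>P\<close> applies to it. The selected intervals
  are never named: the estimate of the bad part by \<open>\<integral> f\<^sup>2\<close> is additive over the two halves of an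
  interval, so it is carried along the recursion.
\<close>

lemma calderon_zygmund_dyadic:
  assumes P: "\<And>k a b f s. k < n \<Longrightarrow> a < b \<Longrightarrow> f \<in> dstep k a b \<Longrightarrow> (LINT x|lebesgue. f x) = 0 \<Longrightarrow> s > 0 \<Longrightarrow>
       (LINT x|lebesgue. (f x)\<^sup>2) \<le> s\<^sup>2 * (b - a) \<Longrightarrow> h1_norm f \<le> 8 * s * (b - a)"
    and r: "r > 0"
  shows "k \<le> n \<Longrightarrow> a < b \<Longrightarrow> f \<in> dstep k a b \<Longrightarrow> (LINT x|lebesgue. (f x)\<^sup>2) \<le> r\<^sup>2 * (b - a) \<Longrightarrow>
    \<exists>g. bsupp a b g \<and> (\<forall>x. \<bar>g x\<bar> \<le> 2 * r) \<and> (LINT x|lebesgue. g x) = (LINT x|lebesgue. f x) \<and>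
      (\<lambda>x. f x - g x) \<in> H1 \<and> h1_norm (\<lambda>x. f x - g x) \<le> 8 / r * (LINT x|lebesgue. (f x)\<^sup>2)"
proof (induction k arbitrary: a b f)
  case 0
  then obtain c where f: "f = (\<lambda>x. c * indicator {a..<b} x)" by auto
  have "(LINT x|lebesgue. (f x)\<^sup>2) = (LINT x|lebesgue. c\<^sup>2 * indicator {a..<b} x)"
    by (rule Bochner_Integration.integral_cong) (auto simp: f indicator_def)
  also have "\<dots> = c\<^sup>2 * (b - a)" using 0 by simp
  finally have "c\<^sup>2 * (b - a) \<le> r\<^sup>2 * (b - a)" using 0 by simp
  then have "c\<^sup>2 \<le> r\<^sup>2" using 0 by simp
  then have "\<bar>c\<bar> \<le> r" using r by (simp add: abs_le_square_iff[symmetric])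
  then have "\<bar>f x\<bar> \<le> 2 * r" for x using r by (auto simp: f indicator_def)
  then show ?case
    using 0 r dstep_bsupp[of a b f 0] by (intro exI[of _ f]) (auto simp: zero_in_H1 h1_norm_zero)
next
  case (Suc k)
  define c where "c = (a + b) / 2"
  have c: "a < c" "c < b" "c - a = (b - a)/2" "b - c = (b - a)/2" using Suc.prems by (auto simp: c_def field_simps)
  obtain f1 f2 where f: "f = (\<lambda>x. f1 x + f2 x)" "f1 \<in> dstep k a c" "f2 \<in> dstep k c b"
    using Suc.prems unfolding c_def by auto
  note b12 = dstep_bsupp[OF c(1) f(2)] dstep_bsupp[OF c(2) f(3)]
  note i12 = bsupp_integrable[OF b12(1)] bsupp_integrable[OF b12(2)]
     bsupp_integrable[OF bsupp_square[OF b12(1)]] bsupp_integrable[OF bsupp_square[OF b12(2)]]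
  have "(f x)\<^sup>2 = (f1 x)\<^sup>2 + (f2 x)\<^sup>2" for x
    using b12 by (cases "x < c") (auto simp: bsupp_def f(1))
  then have sq: "(LINT x|lebesgue. (f x)\<^sup>2) = (LINT x|lebesgue. (f1 x)\<^sup>2) + (LINT x|lebesgue. (f2 x)\<^sup>2)"
    using i12 by simp
  have half: "\<exists>g. bsupp a' b' g \<and> (\<forall>x. \<bar>g x\<bar> \<le> 2 * r) \<and> (LINT x|lebesgue. g x) = (LINT x|lebesgue. h x) \<and>
      (\<lambda>x. h x - g x) \<in> H1 \<and> h1_norm (\<lambda>x. h x - g x) \<le> 8 / r * (LINT x|lebesgue. (h x)\<^sup>2)"
    if ab': "a' < b'" and h: "h \<in> dstep k a' b'" "(LINT x|lebesgue. (h x)\<^sup>2) \<le> 2 * r\<^sup>2 * (b' - a')" for a' b' h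
  proof (cases "(LINT x|lebesgue. (h x)\<^sup>2) \<le> r\<^sup>2 * (b' - a')")
    case True
    then show ?thesis using Suc.IH[OF _ ab' h(1)] Suc.prems(1) by simp
  next
    case False
    \<comment> \<open>The half is selected: \<open>g\<close> is the mean there.\<close>
    define q where "q = (LINT x|lebesgue. (h x)\<^sup>2)"
    define m where "m = (LINT x|lebesgue. h x) / (b' - a')"
    define s where "s = sqrt (q / (b' - a'))"
    have q: "q > r\<^sup>2 * (b' - a')" using False q_def by simp
    have q0: "q \<ge> 0" unfolding q_def by simp
    have s2: "s\<^sup>2 * (b' - a') = q" using q0 ab' by (simp add: s_def)
    have rs: "r < s" unfolding s_def using q ab' by (intro real_less_rsqrt) (simp add: field_simps)
    note bh = dstep_bsupp[OF ab' h(1)]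
    note ce = bsupp_center[OF ab' bh, folded m_def]
    let ?g = "\<lambda>x. m * indicator {a'..<b'} x"
    have m2: "m\<^sup>2 * (b' - a') \<le> (2 * r)\<^sup>2 * (b' - a')"
    proof -
      have "m\<^sup>2 * (b' - a') \<le> 2 * r\<^sup>2 * (b' - a')" using ce(4) h(2) by simp
      also have "\<dots> \<le> (2 * r)\<^sup>2 * (b' - a')" using ab' by (intro mult_right_mono) (auto simp: power2_eq_square)
      finally show ?thesis .
    qed
    then have "m\<^sup>2 \<le> (2 * r)\<^sup>2" using ab' by (simp del: power_mult_distrib)
    then have "\<bar>m\<bar> \<le> \<bar>2 * r\<bar>" unfolding abs_le_square_iff .
    then have m: "\<bar>m\<bar> \<le> 2 * r" using r by simp
    have "h1_norm (\<lambda>x. h x - ?g x) \<le> 8 * s * (b' - a')"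
    proof (rule P[OF _ ab' dstep_center[OF ab' h(1)] ce(1)])
      show "(LINT x|lebesgue. (h x - ?g x)\<^sup>2) \<le> s\<^sup>2 * (b' - a')"
        using ce(3) unfolding s2 q_def .
    qed (use Suc.prems(1) rs r in linarith)+
    \<comment> \<open>Since the half is selected, \<open>s > r\<close>; this turns the \<open>L\<^sup>2\<close> norm into its square.\<close>
    also have "\<dots> \<le> 8 * s * (b' - a') * (s / r)"
    proof -
      have "1 \<le> s / r" "0 \<le> 8 * s * (b' - a')" using rs r ab' by simp_all
      then have "8 * s * (b' - a') * 1 \<le> 8 * s * (b' - a') * (s / r)" by (rule mult_left_mono)
      then show ?thesis by simp
    qed
    also have "\<dots> = 8 / r * (s\<^sup>2 * (b' - a'))" using r by (simp add: power2_eq_square)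
    also have "\<dots> = 8 / r * q" using s2 by simp
    finally have n: "h1_norm (\<lambda>x. h x - ?g x) \<le> 8 / r * q" .
    have "(\<lambda>x. h x - ?g x) \<in> H1"
      by (rule bsupp_mean_zero_in_H1[OF bsupp_diff[OF bh bsupp_ind] ce(1)])
    moreover have "(LINT x|lebesgue. ?g x) = (LINT x|lebesgue. h x)"
      using ab' by (simp add: m_def)
    moreover have "\<bar>?g x\<bar> \<le> 2 * r" for x using m r by (auto simp: indicator_def)
    ultimately show ?thesis using n bsupp_ind unfolding q_def by blast
  qed
  have sqn: "0 \<le> (LINT x|lebesgue. (f1 x)\<^sup>2)" "0 \<le> (LINT x|lebesgue. (f2 x)\<^sup>2)" by simp_all
  have "(LINT x|lebesgue. (f1 x)\<^sup>2) \<le> 2 * r\<^sup>2 * (c - a)" "(LINT x|lebesgue. (f2 x)\<^sup>2) \<le> 2 * r\<^sup>2 * (b - c)"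
    using sq sqn(1) sqn(2) Suc.prems(4) unfolding c(3,4) by linarith+
  with half[OF c(1) f(2)] half[OF c(2) f(3)] obtain g1 g2 where
    g1: "bsupp a c g1" "\<And>x. \<bar>g1 x\<bar> \<le> 2 * r" "(LINT x|lebesgue. g1 x) = (LINT x|lebesgue. f1 x)"
      "(\<lambda>x. f1 x - g1 x) \<in> H1" "h1_norm (\<lambda>x. f1 x - g1 x) \<le> 8 / r * (LINT x|lebesgue. (f1 x)\<^sup>2)" and
    g2: "bsupp c b g2" "\<And>x. \<bar>g2 x\<bar> \<le> 2 * r" "(LINT x|lebesgue. g2 x) = (LINT x|lebesgue. f2 x)"
      "(\<lambda>x. f2 x - g2 x) \<in> H1" "h1_norm (\<lambda>x. f2 x - g2 x) \<le> 8 / r * (LINT x|lebesgue. (f2 x)\<^sup>2)"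
    by blast
  let ?g = "\<lambda>x. g1 x + g2 x"
  have eq: "(\<lambda>x. f x - ?g x) = (\<lambda>x. (f1 x - g1 x) + (f2 x - g2 x))" by (auto simp: f(1))
  have "bsupp a b ?g" using g1(1) g2(1) c by (intro bsupp_add) (auto intro: bsupp_mono)
  moreover have "\<bar>?g x\<bar> \<le> 2 * r" for x
    using g1(1) g2(1) g1(2)[of x] g2(2)[of x] by (cases "x < c") (auto simp: bsupp_def)
  moreover have "(LINT x|lebesgue. ?g x) = (LINT x|lebesgue. f x)"
    using g1(3) g2(3) i12 bsupp_integrable[OF g1(1)] bsupp_integrable[OF g2(1)] by (simp add: f(1))
  moreover have "(\<lambda>x. f x - ?g x) \<in> H1" unfolding eq by (rule H1_add(1)[OF g1(4) g2(4)])
  moreover have "h1_norm (\<lambda>x. f x - ?g x) \<le> 8 / r * (LINT x|lebesgue. (f x)\<^sup>2)"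
    unfolding eq sq using H1_add(2)[OF g1(4) g2(4)] g1(5) g2(5) by (simp add: algebra_simps)
  ultimately show ?case by blast
qed

text \<open>
  The decomposition at height \<open>2 s\<close> gives norm at most \<open>4 s (b - a)\<close> for the good part, since it is
  bounded by \<open>4 s\<close>, and, with the constant \<open>8\<close> of the induction hypothesis, at most \<open>4 s (b - a)\<close>
  for the bad part. So the constant \<open>8\<close> reproduces itself.
\<close>

lemma dstep_h1_norm:
  "a < b \<Longrightarrow> f \<in> dstep n a b \<Longrightarrow> (LINT x|lebesgue. f x) = 0 \<Longrightarrow> s > 0 \<Longrightarrow>
       (LINT x|lebesgue. (f x)\<^sup>2) \<le> s\<^sup>2 * (b - a) \<Longrightarrow> h1_norm f \<le> 8 * s * (b - a)"
proof (induction n arbitrary: a b f s rule: less_induct)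
  case (less n)
  have sq: "(LINT x|lebesgue. (f x)\<^sup>2) \<le> (2 * s)\<^sup>2 * (b - a)"
  proof -
    have "s\<^sup>2 * (b - a) \<le> (2 * s)\<^sup>2 * (b - a)" using less.prems(1) by (intro mult_right_mono) auto
    then show ?thesis using less.prems(5) by linarith
  qed
  obtain g where g: "bsupp a b g" "\<And>x. \<bar>g x\<bar> \<le> 2 * (2 * s)" "(LINT x|lebesgue. g x) = (LINT x|lebesgue. f x)"
      "(\<lambda>x. f x - g x) \<in> H1" "h1_norm (\<lambda>x. f x - g x) \<le> 8 / (2 * s) * (LINT x|lebesgue. (f x)\<^sup>2)"
    using calderon_zygmund_dyadic[of n "2 * s" n a b f] less.IH less.prems sq by auto
  have "h1_norm (\<lambda>x. f x - g x) \<le> 8 / (2 * s) * (s\<^sup>2 * (b - a))"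
    by (rule order_trans[OF g(5)]) (use less.prems in \<open>intro mult_left_mono; simp\<close>)
  also have "\<dots> = 4 * s * (b - a)" using less.prems by (simp add: power2_eq_square)
  finally have 1: "h1_norm (\<lambda>x. f x - g x) \<le> 4 * s * (b - a)" .
  have 2: "g \<in> H1" "h1_norm g \<le> 2 * (2 * s) * (b - a)"
    using bsupp_H1[OF less.prems(1) g(1) _ g(2)] g(3) less.prems(3) by simp_all
  have "h1_norm (\<lambda>x. (f x - g x) + g x) \<le> 4 * s * (b - a) + 2 * (2 * s) * (b - a)"
    using H1_add(2)[OF g(4) 2(1)] 1 2(2) by linarith
  then show ?case by simp
qed


section \<open>The \<open>L\<^sup>2\<close> bound for the atomic norm\<close>

lemma dstep_approx_continuous:
  fixes g :: "real \<Rightarrow> real"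
  assumes "a < b" "b - a \<le> 2 ^ n * d" "\<And>x y. x \<in> {a..b} \<Longrightarrow> y \<in> {a..b} \<Longrightarrow> \<bar>x - y\<bar> \<le> d \<Longrightarrow> \<bar>g x - g y\<bar> \<le> e"
  shows "\<exists>s\<in>dstep n a b. \<forall>x\<in>{a..<b}. \<bar>g x - s x\<bar> \<le> e"
  using assms
proof (induction n arbitrary: a b)
  case 0
  then have "\<forall>x\<in>{a..<b}. \<bar>g x - g a * indicator {a..<b} x\<bar> \<le> e" by auto
  then show ?case by (intro bexI[of _ "\<lambda>x. g a * indicator {a..<b} x"]) auto
next
  case (Suc n)
  define c where "c = (a + b) / 2"
  have c: "a < c" "c < b" "c - a \<le> 2 ^ n * d" "b - c \<le> 2 ^ n * d"
    using Suc.prems by (auto simp: c_def field_simps)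
  obtain s t where s: "s \<in> dstep n a c" "\<forall>x\<in>{a..<c}. \<bar>g x - s x\<bar> \<le> e"
     and t: "t \<in> dstep n c b" "\<forall>x\<in>{c..<b}. \<bar>g x - t x\<bar> \<le> e"
    using Suc.IH[OF c(1,3) Suc.prems(3)] Suc.IH[OF c(2,4) Suc.prems(3)] c by force
  have "\<bar>g x - (s x + t x)\<bar> \<le> e" if "x \<in> {a..<b}" for x
    using s(2) t(2) that dstep_bsupp[OF c(1) s(1)] dstep_bsupp[OF c(2) t(1)]
    by (cases "x < c") (auto simp: bsupp_def)
  moreover have "(\<lambda>x. s x + t x) \<in> dstep (Suc n) a b" using s(1) t(1) by (auto simp: c_def)
  ultimately show ?case by (intro bexI[of _ "\<lambda>x. s x + t x"]) auto
qed

lemma dstep_approx_uniform: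
  fixes g :: "real \<Rightarrow> real"
  assumes ab: "a < b" and g: "continuous_on {a..b} g" and e: "e > 0"
  obtains n s where "s \<in> dstep n a b" "\<And>x. x \<in> {a..<b} \<Longrightarrow> \<bar>g x - s x\<bar> \<le> e"
proof -
  have "uniformly_continuous_on {a..b} g"
    by (rule compact_uniformly_continuous[OF g]) simp
  then obtain d where d: "d > 0" "\<And>x y. x \<in> {a..b} \<Longrightarrow> y \<in> {a..b} \<Longrightarrow> dist y x < d \<Longrightarrow> dist (g y) (g x) < e"
    using e unfolding uniformly_continuous_on_def by metis
  obtain n where n: "(b - a) / (d / 2) < 2 ^ n"
    using real_arch_pow[of 2] by auto
  have "\<bar>g x - g y\<bar> \<le> e" if "x \<in> {a..b}" "y \<in> {a..b}" "\<bar>x - y\<bar> \<le> d / 2" for x y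
    using d(2)[of y x] that d(1) by (force simp: dist_real_def)
  moreover have "b - a \<le> 2 ^ n * (d / 2)" using n d(1) by (simp add: field_simps)
  ultimately show ?thesis using dstep_approx_continuous[OF ab, of n "d/2" g e] that by blast
qed

text \<open>
  A bounded measurable function is the limit almost everywhere of continuous functions, which may be
  truncated and then approximated uniformly by step functions.
\<close>

lemma dstep_dense:
  assumes ab: "a < b" and f: "bsupp a b f" and e: "e > 0"
  obtains n s where "s \<in> dstep n a b" "(LINT x|lebesgue. (f x - s x)\<^sup>2) \<le> e"
proof -
  obtain B where B: "B > 0" "\<And>x. \<bar>f x\<bar> \<le> B" using bsupp_bound[OF f] by blast
  have fm[measurable]: "f \<in> borel_measurable lebesgue" using f by (simp add: bsupp_def)
  have "f measurable_on UNIV"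
    by (rule lebesgue_measurable_imp_measurable_on_real) auto
  then obtain N g where N: "negligible N" and g: "\<And>n. continuous_on UNIV (g n :: real \<Rightarrow> real)"
    "\<And>x. x \<notin> N \<Longrightarrow> (\<lambda>n. g n x) \<longlonglongrightarrow> f x"
    unfolding measurable_on_def by auto
  define h where "h = (\<lambda>n x. max (-B) (min B (g n x)))"
  have hc: "continuous_on UNIV (h n)" for n unfolding h_def by (intro continuous_intros g)
  have hm[measurable]: "h n \<in> borel_measurable lebesgue" for n
    using borel_measurable_continuous_onI[OF hc[of n]] by (simp add: measurable_completion)
  have hB: "\<bar>h n x\<bar> \<le> B" for n x using B(1) by (auto simp: h_def)
  have hl: "(\<lambda>n. h n x) \<longlonglongrightarrow> f x" if "x \<notin> N" for x
  proof -
    have "(\<lambda>n. h n x) \<longlonglongrightarrow> max (-B) (min B (f x))"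
      unfolding h_def by (intro tendsto_intros g that)
    then show ?thesis using B(2)[of x] by (simp add: abs_le_iff min_def max_def split: if_splits)
  qed
  have im[measurable]: "(indicator {a..<b} :: real \<Rightarrow> real) \<in> borel_measurable lebesgue"
    using integrable_indicator_Ico by auto
  have "(\<lambda>n. LINT x|lebesgue. indicator {a..<b} x * (f x - h n x)\<^sup>2) \<longlonglongrightarrow> (LINT x::real|lebesgue. 0::real)"
  proof (rule integral_dominated_convergence[where f="\<lambda>x. 0" and w="\<lambda>x. (2 * B)\<^sup>2 * indicator {a..<b} x"])
    show "integrable lebesgue (\<lambda>x. (2 * B)\<^sup>2 * indicator {a..<b} x)"
      using integrable_indicator_Ico by auto
    have "AE x in lebesgue. x \<notin> N" using N by (simp add: AE_not_in negligible_iff_null_sets)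
    then show "AE x in lebesgue. (\<lambda>n. indicator {a..<b} x * (f x - h n x)\<^sup>2) \<longlonglongrightarrow> 0"
    proof eventually_elim
      case (elim x)
      have "(\<lambda>n. indicator {a..<b} x * (f x - h n x)\<^sup>2) \<longlonglongrightarrow> indicator {a..<b} x * (f x - f x)\<^sup>2"
        by (intro tendsto_intros hl elim)
      then show ?case by simp
    qed
    show "AE x in lebesgue. norm (indicator {a..<b} x * (f x - h n x)\<^sup>2) \<le> (2 * B)\<^sup>2 * indicator {a..<b} x" for n
    proof (rule AE_I2)
      fix x
      have "\<bar>f x - h n x\<bar> \<le> \<bar>2 * B\<bar>" using B(2)[of x] hB[of n x] by linarith
      then have "(f x - h n x)\<^sup>2 \<le> (2 * B)\<^sup>2" by (simp only: abs_le_square_iff)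
      then show "norm (indicator {a..<b} x * (f x - h n x)\<^sup>2) \<le> (2 * B)\<^sup>2 * indicator {a..<b} x"
        by (auto simp: indicator_def simp del: power_mult_distrib)
    qed
  qed auto
  then have "(\<lambda>n. LINT x|lebesgue. indicator {a..<b} x * (f x - h n x)\<^sup>2) \<longlonglongrightarrow> 0" by simp
  then have "\<forall>\<^sub>F n in sequentially. (LINT x|lebesgue. indicator {a..<b} x * (f x - h n x)\<^sup>2) < e / 4"
    using e by (intro order_tendstoD(2)[where y="0"]) auto
  then obtain k where k: "(LINT x|lebesgue. indicator {a..<b} x * (f x - h k x)\<^sup>2) < e / 4"
    using eventually_happens by force
  define d where "d = sqrt (e / (4 * (b - a)))"
  have d: "d > 0" "d\<^sup>2 * (b - a) = e / 4" using e ab by (simp_all add: d_def) (simp add: field_simps)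
  obtain n s where s: "s \<in> dstep n a b" "\<And>x. x \<in> {a..<b} \<Longrightarrow> \<bar>h k x - s x\<bar> \<le> d"
    using dstep_approx_uniform[OF ab continuous_on_subset[OF hc[of k]] d(1)] by blast
  note bs = dstep_bsupp[OF ab s(1)]
  let ?u = "\<lambda>x. indicator {a..<b} x * (f x - h k x)\<^sup>2"
  have iu: "integrable lebesgue ?u"
  proof (rule bsupp_integrable[of a b], rule bsupp_I[where B="(2 * B)\<^sup>2"])
    fix x
    have "\<bar>f x - h k x\<bar> \<le> \<bar>2 * B\<bar>" using B(2)[of x] hB[of k x] by linarith
    then have "(f x - h k x)\<^sup>2 \<le> (2 * B)\<^sup>2" by (simp only: abs_le_square_iff)
    then show "\<bar>?u x\<bar> \<le> (2 * B)\<^sup>2" by (auto simp: indicator_def simp del: power_mult_distrib)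
    show "x \<notin> {a..<b} \<Longrightarrow> ?u x = 0" by simp
  qed measurable
  have "(LINT x|lebesgue. (f x - s x)\<^sup>2) \<le> (LINT x|lebesgue. 2 * ?u x + 2 * (d\<^sup>2 * indicator {a..<b} x))"
  proof (rule integral_mono)
    show "integrable lebesgue (\<lambda>x. (f x - s x)\<^sup>2)"
      by (rule bsupp_integrable[OF bsupp_square[OF bsupp_diff[OF f bs]]])
    show "integrable lebesgue (\<lambda>x. 2 * ?u x + 2 * (d\<^sup>2 * indicator {a..<b} x))"
      using iu integrable_indicator_Ico[of a b] by auto
    fix x
    show "(f x - s x)\<^sup>2 \<le> 2 * ?u x + 2 * (d\<^sup>2 * indicator {a..<b} x)"
    proof (cases "x \<in> {a..<b}")
      case True
      have "\<bar>h k x - s x\<bar> \<le> \<bar>d\<bar>" using s(2)[OF True] by linarith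
      then have 1: "(h k x - s x)\<^sup>2 \<le> d\<^sup>2" by (simp only: abs_le_square_iff)
      have "0 \<le> ((f x - h k x) - (h k x - s x))\<^sup>2" by simp
      then have "(f x - s x)\<^sup>2 \<le> 2 * (f x - h k x)\<^sup>2 + 2 * (h k x - s x)\<^sup>2"
        by (simp add: power2_eq_square algebra_simps)
      then show ?thesis using 1 True by simp
    next
      case False
      then show ?thesis using f bs by (simp add: bsupp_def)
    qed
  qed
  also have "\<dots> = 2 * (LINT x|lebesgue. ?u x) + 2 * (d\<^sup>2 * (b - a))"
    using iu integrable_indicator_Ico[of a b] ab by simp
  also have "\<dots> \<le> e" using k d(2) e by simp
  finally show ?thesis using that s(1) by blast
qed

lemma dstep_dense_mean_zero:
  assumes ab: "a < b" and f: "bsupp a b f" "(LINT x|lebesgue. f x) = 0" and e: "e > 0"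
  obtains n s where "s \<in> dstep n a b" "(LINT x|lebesgue. s x) = 0" "(LINT x|lebesgue. (f x - s x)\<^sup>2) \<le> e"
proof -
  obtain n s where s: "s \<in> dstep n a b" "(LINT x|lebesgue. (f x - s x)\<^sup>2) \<le> e"
    using dstep_dense[OF ab f(1) e] by blast
  note bs = dstep_bsupp[OF ab s(1)]
  define m where "m = (LINT x|lebesgue. s x) / (b - a)"
  define t where "t = (\<lambda>x. s x - m * indicator {a..<b} x)"
  have "t \<in> dstep n a b" unfolding t_def by (rule dstep_center[OF ab s(1)])
  moreover have "(LINT x|lebesgue. t x) = 0" unfolding t_def m_def by (rule bsupp_center(1)[OF ab bs])
  moreover have "(LINT x|lebesgue. (f x - t x)\<^sup>2) \<le> e"
  proof -
    have "(LINT x|lebesgue. f x - s x) / (b - a) = - m"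
      using f bs bsupp_integrable by (simp add: m_def)
    then show ?thesis
      using bsupp_center(3)[OF ab bsupp_diff[OF f(1) bs]] s(2) by (simp add: t_def algebra_simps)
  qed
  ultimately show ?thesis using that by blast
qed

text \<open>
  The function is the sum of the differences \<open>d k\<close> of step functions \<open>t k\<close> that approximate it in
  \<open>L\<^sup>2\<close> with geometrically decreasing error. As \<open>t 0 = 0\<close>, the bounds for \<open>d k\<close> form a geometric
  series, which doubles the bound \<open>16 s (b - a)\<close> of its first term.
\<close>

lemma L2_h1_norm:
  assumes ab: "a < b" and f: "bsupp a b f" "(LINT x|lebesgue. f x) = 0" and s: "s > 0"
    and fs: "(LINT x|lebesgue. (f x)\<^sup>2) \<le> s\<^sup>2 * (b - a)"
  shows "h1_norm f \<le> 32 * s * (b - a)"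
proof -
  define e where "e = (\<lambda>k. s * (1/2)^k)"
  have e0: "e k > 0" for k using s by (simp add: e_def)
  have "\<exists>t. (\<exists>n. t \<in> dstep n a b) \<and> (LINT x|lebesgue. t x) = 0 \<and> (LINT x|lebesgue. (f x - t x)\<^sup>2) \<le> (e k)\<^sup>2 * (b - a)
      \<and> (k = 0 \<longrightarrow> t = (\<lambda>x. 0))" for k
  proof (cases "k = 0")
    case True
    have "(\<lambda>x. 0) \<in> dstep 0 a b" using dstep_const[OF ab, of 0 0] by simp
    then show ?thesis using True fs by (intro exI[of _ "\<lambda>x. 0"] conjI exI[of _ 0]) (auto simp: e_def)
  next
    case False
    have "(e k)\<^sup>2 * (b - a) > 0" using e0[of k] ab by simp
    from dstep_dense_mean_zero[OF ab f this] obtain n t where "t \<in> dstep n a b"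
      "(LINT x|lebesgue. t x) = 0" "(LINT x|lebesgue. (f x - t x)\<^sup>2) \<le> (e k)\<^sup>2 * (b - a)" by blast
    then show ?thesis using False by blast
  qed
  then have "\<forall>k. \<exists>t. (\<exists>n. t \<in> dstep n a b) \<and> (LINT x|lebesgue. t x) = 0 \<and> (LINT x|lebesgue. (f x - t x)\<^sup>2) \<le> (e k)\<^sup>2 * (b - a)
      \<and> (k = 0 \<longrightarrow> t = (\<lambda>x. 0))" by blast
  from choice[OF this] obtain t where t': "\<forall>k. (\<exists>n. t k \<in> dstep n a b) \<and> (LINT x|lebesgue. t k x) = 0 \<and>
      (LINT x|lebesgue. (f x - t k x)\<^sup>2) \<le> (e k)\<^sup>2 * (b - a) \<and> (k = 0 \<longrightarrow> t k = (\<lambda>x. 0))" by blast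
  then have "\<forall>k. \<exists>n. t k \<in> dstep n a b" by blast
  from choice[OF this] t' obtain n where t: "\<And>k. t k \<in> dstep (n k) a b" "\<And>k. (LINT x|lebesgue. t k x) = 0"
    "\<And>k. (LINT x|lebesgue. (f x - t k x)\<^sup>2) \<le> (e k)\<^sup>2 * (b - a)" "t 0 = (\<lambda>x. 0)"
    by blast
  note bt = dstep_bsupp[OF ab t(1)]
  note it = bsupp_integrable[OF bt]
  define d where "d = (\<lambda>k x. t (Suc k) x - t k x)"
  have dd: "d k \<in> dstep (max (n k) (n (Suc k))) a b" for k
    using dstep_lincomb[OF dstep_mono[OF ab _ t(1)[of "Suc k"]] dstep_mono[OF ab _ t(1)[of k]], of "max (n k) (n (Suc k))" 1 "-1"]
    by (simp add: d_def[abs_def])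
  have d0: "(LINT x|lebesgue. d k x) = 0" for k using t(2) it by (simp add: d_def)
  have dsq: "(LINT x|lebesgue. (d k x)\<^sup>2) \<le> (2 * e k)\<^sup>2 * (b - a)" for k
  proof -
    note i = bsupp_integrable[OF bsupp_square[OF bsupp_diff[OF f(1) bt]]]
    have "(LINT x|lebesgue. (d k x)\<^sup>2) \<le> (LINT x|lebesgue. 2 * (f x - t k x)\<^sup>2 + 2 * (f x - t (Suc k) x)\<^sup>2)"
    proof (rule integral_mono)
      show "integrable lebesgue (\<lambda>x. (d k x)\<^sup>2)"
        by (rule bsupp_integrable[OF bsupp_square[OF dstep_bsupp[OF ab dd]]])
      fix x
      have "0 \<le> ((f x - t k x) + (f x - t (Suc k) x))\<^sup>2" by simp
      then show "(d k x)\<^sup>2 \<le> 2 * (f x - t k x)\<^sup>2 + 2 * (f x - t (Suc k) x)\<^sup>2"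
        by (simp add: d_def power2_eq_square algebra_simps)
    qed (use i in auto)
    also have "\<dots> = 2 * (LINT x|lebesgue. (f x - t k x)\<^sup>2) + 2 * (LINT x|lebesgue. (f x - t (Suc k) x)\<^sup>2)"
      using i by simp
    also have "\<dots> \<le> 2 * ((e k)\<^sup>2 * (b - a)) + 2 * ((e (Suc k))\<^sup>2 * (b - a))"
      by (intro add_mono mult_left_mono t(3)) auto
    also have "\<dots> \<le> 2 * ((e k)\<^sup>2 * (b - a)) + 2 * ((e k)\<^sup>2 * (b - a))"
      using ab s by (intro add_mono mult_left_mono mult_right_mono power_mono) (auto simp: e_def)
    finally show ?thesis by (simp add: power_mult_distrib mult_ac)
  qed
  have dn: "h1_norm (d k) \<le> 16 * (b - a) * e k" for k
  proof -
    have "h1_norm (d k) \<le> 8 * (2 * e k) * (b - a)"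
      by (rule dstep_h1_norm[OF ab dd d0 _ dsq]) (use e0[of k] in simp)
    also have "\<dots> = 16 * (b - a) * e k" by simp
    finally show ?thesis .
  qed
  have dH: "d k \<in> H1" for k by (rule bsupp_mean_zero_in_H1[OF dstep_bsupp[OF ab dd] d0])
  have es: "(\<lambda>k. 16 * (b - a) * e k) sums (16 * (b - a) * (s * 2))"
    unfolding e_def using geometric_sums[of "1/2::real"] by (intro sums_mult) simp
  have ds: "(\<Sum>k<m. d k x) = t m x" for m x
    using sum_lessThan_telescope[of "\<lambda>k. t k x" m] t(4) by (simp add: d_def)
  have L1: "(LINT x|lebesgue. \<bar>f x - (\<Sum>k<m. d k x)\<bar>) \<le> e m * (b - a)" for m
    unfolding ds by (rule bsupp_L1_L2[OF ab bsupp_diff[OF f(1) bt] _ t(3)]) (use e0[of m] in simp)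
  have "(\<lambda>m. e m * (b - a)) \<longlonglongrightarrow> s * 0 * (b - a)"
    unfolding e_def by (intro tendsto_intros LIMSEQ_realpow_zero) auto
  then have "(\<lambda>m. e m * (b - a)) \<longlonglongrightarrow> 0" by simp
  from tendsto_sandwich[OF _ _ tendsto_const this]
  have lim: "(\<lambda>m. LINT x|lebesgue. \<bar>f x - (\<Sum>k<m. d k x)\<bar>) \<longlonglongrightarrow> 0" using L1 by simp
  show ?thesis
    using H1_series_le(2)[OF dH dn sums_summable[OF es] bsupp_integrable[OF f(1)] lim]
    unfolding sums_unique[OF es, symmetric] by (simp only: mult_ac)
qed

section \<open>Mean oscillation as the value of a functional\<close>

text \<open>
  The test function is the sign of \<open>p - mean p I\<close> on \<open>I\<close>, made mean zero by subtracting its mean.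
\<close>

lemma osc_test_function:
  fixes p :: "real \<Rightarrow> real"
  assumes I: "bdd_interval I" and p: "set_integrable lebesgue I p"
  obtains g where "g \<in> borel_measurable lebesgue" "\<And>x. \<bar>g x\<bar> \<le> 2" "\<And>x. x \<notin> I \<Longrightarrow> g x = 0"
    "(LINT x|lebesgue. g x) = 0" "(LINT x|lebesgue. g x * p x) = measure lebesgue I * mean_osc p I"
proof -
  define v where "v = measure lebesgue I"
  define m where "m = mean p I"
  have v: "v > 0" using I by (simp add: v_def bdd_interval_def)
  have Im: "I \<in> lmeasurable" by (rule interval_lmeasurable[OF I])
  have ii: "integrable lebesgue (indicator I :: real \<Rightarrow> real)" using Im by (auto simp: fmeasurable_def)
  have ip: "integrable lebesgue (\<lambda>x. indicator I x * p x)" using p by (simp add: set_integrable_def)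
  have iv: "(LINT x|lebesgue. indicator I x) = v" using Im by (simp add: v_def)
  have mv: "(LINT x|lebesgue. indicator I x * p x) = m * v"
    using v by (simp add: m_def mean_def set_lebesgue_integral_def v_def)
  define u where "u = (\<lambda>x. indicator I x * p x - m * indicator I x)"
  have iu: "integrable lebesgue u" unfolding u_def using ii ip by auto
  then have [measurable]: "u \<in> borel_measurable lebesgue" by auto
  define s where "s = (\<lambda>x. sgn (u x))"
  have s1: "\<bar>s x\<bar> \<le> 1" for x by (simp add: s_def sgn_if)
  have sm[measurable]: "s \<in> borel_measurable lebesgue" unfolding s_def by measurable
  have ints: "integrable lebesgue s"
  proof (rule Bochner_Integration.integrable_bound[OF ii sm], rule AE_I2)
    show "norm (s x) \<le> norm (indicator I x :: real)" for x
      using s1[of x] by (cases "x \<in> I") (auto simp: s_def u_def)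
  qed
  have sz: "s x = 0" if "x \<notin> I" for x using that by (simp add: s_def u_def)
  define t where "t = (LINT x|lebesgue. s x) / v"
  have tv: "(LINT x|lebesgue. s x) = t * v" using v by (simp add: t_def)
  have t1: "\<bar>t\<bar> \<le> 1"
  proof -
    have "\<bar>LINT x|lebesgue. s x\<bar> \<le> (LINT x|lebesgue. \<bar>s x\<bar>)" by (rule integral_abs_bound)
    also have "\<dots> \<le> (LINT x|lebesgue. indicator I x)"
    proof (rule integral_mono[OF integrable_abs[OF ints] ii])
      show "\<bar>s x\<bar> \<le> indicator I x" for x using s1[of x] sz[of x] by (cases "x \<in> I") auto
    qed
    finally show ?thesis using v iv tv by (simp add: abs_mult)
  qed
  define g where "g = (\<lambda>x. s x - t * indicator I x)"
  have isp: "integrable lebesgue (\<lambda>x. s x * (indicator I x * p x))"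
  proof (rule Bochner_Integration.integrable_bound[OF ip])
    show "AE x in lebesgue. norm (s x * (indicator I x * p x)) \<le> norm (indicator I x * p x)"
      using s1 by (auto simp: abs_mult intro!: AE_I2 mult_left_le_one_le)
  qed (use ip in measurable)
  show ?thesis
  proof
    show "g \<in> borel_measurable lebesgue" using ii by (auto simp: g_def)
    show "\<bar>g x\<bar> \<le> 2" for x using s1[of x] t1 unfolding g_def by (auto simp: indicator_def)
    show "g x = 0" if "x \<notin> I" for x using that sz by (simp add: g_def)
    show "(LINT x|lebesgue. g x) = 0" unfolding g_def using ints ii iv tv by simp
    have "(LINT x|lebesgue. g x * p x) = (LINT x|lebesgue. s x * (indicator I x * p x) - t * (indicator I x * p x))"
      by (rule Bochner_Integration.integral_cong) (auto simp: g_def sz indicator_def algebra_simps)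
    also have "\<dots> = (LINT x|lebesgue. s x * (indicator I x * p x)) - t * (m * v)"
      using isp ip mv by simp
    also have "\<dots> = (LINT x|lebesgue. s x * (indicator I x * p x) - m * s x)"
      using isp ints tv by (simp add: mult_ac)
    also have "\<dots> = (LINT x|lebesgue. indicator I x * \<bar>p x - m\<bar>)"
    proof (rule Bochner_Integration.integral_cong[OF refl])
      fix x
      show "s x * (indicator I x * p x) - m * s x = indicator I x * \<bar>p x - m\<bar>"
        by (cases "x \<in> I") (auto simp: sz s_def u_def sgn_if algebra_simps)
    qed
    also have "\<dots> = measure lebesgue I * mean_osc p I"
      using v by (simp add: mean_osc_def m_def[symmetric] mean_def[of "\<lambda>x. \<bar>p x - m\<bar>"] set_lebesgue_integral_def v_def)
    finally show "(LINT x|lebesgue. g x * p x) = measure lebesgue I * mean_osc p I" .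
  qed
qed

lemma mean_osc_nonneg: "0 \<le> mean_osc p I"
  unfolding mean_osc_def mean_def[of "\<lambda>x. \<bar>p x - mean p I\<bar>"] set_lebesgue_integral_def
  by (intro divide_nonneg_nonneg Bochner_Integration.integral_nonneg) auto

lemma mean_osc_zero_AE:
  fixes p :: "real \<Rightarrow> real"
  assumes I: "bdd_interval I" and p: "set_integrable lebesgue I p" and z: "mean_osc p I = 0"
  shows "AE x in lebesgue. x \<in> I \<longrightarrow> p x = mean p I"
proof -
  define m where "m = mean p I"
  have v: "measure lebesgue I > 0" using I by (simp add: bdd_interval_def)
  have ii: "integrable lebesgue (indicator I :: real \<Rightarrow> real)"
    using interval_lmeasurable[OF I] by (auto simp: fmeasurable_def)
  have ip: "integrable lebesgue (\<lambda>x. indicator I x * p x)" using p by (simp add: set_integrable_def)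
  have eq: "indicator I x * \<bar>p x - m\<bar> = \<bar>indicator I x * p x - m * indicator I x\<bar>" for x
    by (auto simp: indicator_def)
  have i: "integrable lebesgue (\<lambda>x. indicator I x * \<bar>p x - m\<bar>)"
    unfolding eq using ii ip by auto
  have "(LINT x|lebesgue. indicator I x * \<bar>p x - m\<bar>) = 0"
    using z v by (simp add: mean_osc_def m_def[symmetric] mean_def[of "\<lambda>x. \<bar>p x - m\<bar>"] set_lebesgue_integral_def)
  then have "AE x in lebesgue. indicator I x * \<bar>p x - m\<bar> = 0"
    using integral_nonneg_eq_0_iff_AE[OF i] by auto
  then show ?thesis by eventually_elim (auto simp: m_def)
qed

text \<open>
  The test function for \<open>[a,b)\<close> shows that \<open>p\<close> has vanishing mean oscillation there.
\<close>

lemma bsupp_annihilator_const: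
  fixes p :: "real \<Rightarrow> real"
  assumes ab: "a < b" and p: "set_integrable lebesgue {a..<b} p"
    and z: "\<And>g. bsupp a b g \<Longrightarrow> (LINT x|lebesgue. g x) = 0 \<Longrightarrow> (LINT x|lebesgue. g x * p x) = 0"
  shows "\<exists>c. AE x in lebesgue. x \<in> {a..<b} \<longrightarrow> p x = c"
proof -
  have I: "bdd_interval {a..<b}"
    using ab by (auto simp: bdd_interval_def is_interval_co intro: bounded_subset[OF bounded_closed_interval[of a b]])
  obtain g where g: "g \<in> borel_measurable lebesgue" "\<And>x. \<bar>g x\<bar> \<le> 2" "\<And>x. x \<notin> {a..<b} \<Longrightarrow> g x = 0"
    "(LINT x|lebesgue. g x) = 0" "(LINT x|lebesgue. g x * p x) = measure lebesgue {a..<b} * mean_osc p {a..<b}"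
    using osc_test_function[OF I p] by blast
  have "bsupp a b g" by (rule bsupp_I[OF g(1-3)])
  then have "measure lebesgue {a..<b} * mean_osc p {a..<b} = 0" using z g(4,5) by simp
  then have "mean_osc p {a..<b} = 0" using ab by simp
  then show ?thesis using mean_osc_zero_AE[OF I p] by blast
qed

section \<open>Representation of functionals on \<open>H1\<close>\<close>

lemma bsupp_lincomb: "bsupp a b f \<Longrightarrow> bsupp a b g \<Longrightarrow> bsupp a b (\<lambda>x. s * f x + t * g x)"
  by (intro bsupp_add bsupp_cmult)

text \<open>
  Riesz representation on \<open>[a,b)\<close>: the functional is bounded for the \<open>L\<^sup>2\<close> norm on the space \<open>V\<close> of
  bounded functions with mean zero, hence \<open>J f = \<integral> f\<^sup>2 / 2 - L f\<close> is bounded below on \<open>V\<close>. By the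
  parallelogram identity minimising sequences are Cauchy in \<open>L\<^sup>2\<close>, and the \<open>L\<^sup>1\<close> limit \<open>p\<close> of a
  sufficiently fast one represents \<open>L\<close>, since the derivative of \<open>J\<close> vanishes at a minimum.
\<close>

lemma dual_H1_represented_on_interval:
  assumes ab: "a < b" and L: "L \<in> dual_space H1 h1_norm"
  shows "\<exists>p. integrable lebesgue p \<and>
    (\<forall>g. bsupp a b g \<and> (LINT x|lebesgue. g x) = 0 \<longrightarrow> L g = (LINT x|lebesgue. g x * p x))"
proof -
  define V where "V = {f. bsupp a b f \<and> (LINT x|lebesgue. f x) = 0}"
  define h where "h = b - a"
  have h: "h > 0" using ab by (simp add: h_def)
  define q where "q = (\<lambda>f::real\<Rightarrow>real. LINT x|lebesgue. (f x)\<^sup>2)"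
  define J where "J = (\<lambda>f. q f / 2 - L f)"
  obtain C where C: "C > 0" "\<And>f. f \<in> H1 \<Longrightarrow> \<bar>L f\<bar> \<le> C * h1_norm f"
    using dual_space_bound[OF L h1_norm_nonneg] by blast
  have VH: "f \<in> H1" if "f \<in> V" for f using that bsupp_mean_zero_in_H1 unfolding V_def by blast
  have Vlin: "(\<lambda>x. s * f x + t * g x) \<in> V" if "f \<in> V" "g \<in> V" for s t f g
    using that bsupp_lincomb[of a b f g s t] bsupp_integrable[of a b] by (auto simp: V_def)
  have Vi: "integrable lebesgue f" "integrable lebesgue (\<lambda>x. (f x)\<^sup>2)" if "f \<in> V" for f
    using that bsupp_integrable[of a b] bsupp_square[of a b f] by (auto simp: V_def)
  have Vi2: "integrable lebesgue (\<lambda>x. f x * g x)" if "f \<in> V" "g \<in> V" for f g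
    using that bsupp_integrable[OF bsupp_mult[of a b f g]] by (auto simp: V_def)
  have Llin: "L (\<lambda>x. s * f x + t * g x) = s * L f + t * L g" if "f \<in> V" "g \<in> V" for s t f g
    by (rule dual_space_lin[OF L VH VH]) (use that in auto)
  have qlin: "q (\<lambda>x. s * f x + t * g x) = s\<^sup>2 * q f + 2 * s * t * (LINT x|lebesgue. f x * g x) + t\<^sup>2 * q g"
    if "f \<in> V" "g \<in> V" for s t f g
  proof -
    have "q (\<lambda>x. s * f x + t * g x)
      = (LINT x|lebesgue. s\<^sup>2 * (f x)\<^sup>2 + 2 * s * t * (f x * g x) + t\<^sup>2 * (g x)\<^sup>2)"
      unfolding q_def by (rule Bochner_Integration.integral_cong) (auto simp: power2_eq_square algebra_simps)
    also have "\<dots> = s\<^sup>2 * q f + 2 * s * t * (LINT x|lebesgue. f x * g x) + t\<^sup>2 * q g"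
      unfolding q_def using Vi that Vi2[OF that] by simp
    finally show ?thesis .
  qed
  have Jlow: "- (32 * C * sqrt h)\<^sup>2 / 2 - 1 / 2 \<le> J f" if "f \<in> V" for f
  proof -
    define k where "k = 32 * C * sqrt h"
    \<comment> \<open>Adding \<open>1\<close> makes \<open>s\<close> below positive, as the norm bound requires.\<close>
    define t where "t = sqrt (q f + 1)"
    have q0: "q f \<ge> 0" by (simp add: q_def)
    then have t: "t > 0" "t\<^sup>2 = q f + 1" by (auto simp: t_def)
    define s where "s = t / sqrt h"
    have s: "s > 0" "s\<^sup>2 * h = t\<^sup>2" using t h by (auto simp: s_def power_divide)
    have "h1_norm f \<le> 32 * s * (b - a)"
      by (rule L2_h1_norm[OF ab _ _ s(1)]) (use that s t in \<open>auto simp: V_def q_def h_def\<close>)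
    then have "L f \<le> C * (32 * s * h)"
      using C(2)[OF VH[OF that]] mult_left_mono[of "h1_norm f" "32 * s * h" C] C(1)
      unfolding h_def by linarith
    also have "\<dots> = k * t" using h by (simp add: k_def s_def real_div_sqrt field_simps)
    finally have "J f \<ge> (t\<^sup>2 - 1) / 2 - k * t" unfolding J_def t(2) by simp
    moreover have "0 \<le> (t - k)\<^sup>2" by simp
    ultimately show ?thesis unfolding k_def[symmetric] by (simp add: power2_eq_square algebra_simps)
  qed
  define m where "m = Inf (J ` V)"
  have bb: "bdd_below (J ` V)" using Jlow by (auto intro!: bdd_belowI2)
  have mJ: "m \<le> J f" if "f \<in> V" for f unfolding m_def using that bb by (rule cINF_lower[rotated])
  have zV: "(\<lambda>x. 0) \<in> V" using bsupp_ind[of a b 0] by (simp add: V_def)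
  \<comment> \<open>The error \<open>e k\<close> makes consecutive members of the minimising sequence differ by at most
    \<open>2\<^sup>-\<^sup>k (b - a)\<close> in \<open>L\<^sup>1\<close>.\<close>
  define e where "e = (\<lambda>k::nat. ((1/2)^k)\<^sup>2 * h / 8)"
  have e0: "e k > 0" for k using h by (simp add: e_def)
  have "\<exists>f\<in>V. J f < m + e k" for k
    using cInf_lessD[of "J ` V" "m + e k"] zV e0[of k] by (auto simp: m_def)
  then obtain f where f: "\<And>k. f k \<in> V" "\<And>k. J (f k) < m + e k" by metis
  define d where "d = (\<lambda>k x. f (Suc k) x - f k x)"
  have dV: "d k \<in> V" for k using Vlin[OF f(1)[of "Suc k"] f(1)[of k], of 1 "-1"] by (simp add: d_def)
  have dq: "q (d k) \<le> ((1/2)^k)\<^sup>2 * (b - a)" for k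
  proof -
    let ?F = "f (Suc k)" and ?G = "f k"
    have 1: "q (d k) = q ?F - 2 * (LINT x|lebesgue. ?F x * ?G x) + q ?G"
      using qlin[OF f(1)[of "Suc k"] f(1)[of k], of 1 "-1"] by (simp add: d_def)
    have "m \<le> J (\<lambda>x. 1/2 * ?F x + 1/2 * ?G x)" by (rule mJ[OF Vlin[OF f(1) f(1)]])
    also have "\<dots> = (1/4 * q ?F + 1/2 * (LINT x|lebesgue. ?F x * ?G x) + 1/4 * q ?G) / 2 - (1/2 * L ?F + 1/2 * L ?G)"
      unfolding J_def qlin[OF f(1) f(1)] Llin[OF f(1) f(1)] by (simp add: power2_eq_square)
    finally have "q (d k) \<le> 4 * (J ?F + J ?G - 2 * m)" unfolding 1 J_def by (simp add: field_simps)
    also have "\<dots> \<le> 4 * (e (Suc k) + e k)" using f(2)[of k] f(2)[of "Suc k"] by simp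
    also have "\<dots> \<le> ((1/2)^k)\<^sup>2 * (b - a)" using ab by (simp add: e_def h_def field_simps)
    finally show ?thesis .
  qed
  have d1: "(LINT x|lebesgue. \<bar>d k x\<bar>) \<le> (1/2)^k * (b - a)" for k
    by (rule bsupp_L1_L2[OF ab]) (use dV dq in \<open>auto simp: V_def q_def\<close>)
  have gs: "summable (\<lambda>k. (1/2)^k * (b - a))" by (intro summable_mult2 summable_geometric) simp
  have ds: "summable (\<lambda>k. LINT x|lebesgue. \<bar>d k x\<bar>)"
    by (rule summable_comparison_test[OF _ gs]) (use d1 in auto)
  note s = L1_series[of lebesgue d, OF Vi(1)[OF dV] ds]
  define p where "p = (\<lambda>x. f 0 x + (\<Sum>k. d k x))"
  have ip: "integrable lebesgue p" unfolding p_def by (intro Bochner_Integration.integrable_add Vi f s(2))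
  have "p x - f n x = (\<Sum>k. d k x) - (\<Sum>k<n. d k x)" for n x
    using sum_lessThan_telescope[of "\<lambda>k. f k x" n] by (simp add: d_def p_def)
  then have lim: "(\<lambda>n. LINT x|lebesgue. \<bar>p x - f n x\<bar>) \<longlonglongrightarrow> 0" using s(3) by simp
  have "L g = (LINT x|lebesgue. g x * p x)" if g: "bsupp a b g" "(LINT x|lebesgue. g x) = 0" for g
  proof -
    have gV: "g \<in> V" using g by (simp add: V_def)
    obtain B where B: "B > 0" "\<And>x. \<bar>g x\<bar> \<le> B" using bsupp_bound[OF g(1)] by blast
    have gm[measurable]: "g \<in> borel_measurable lebesgue" using g(1) by (simp add: bsupp_def)
    have igp: "integrable lebesgue (\<lambda>x. g x * p x)"
    proof (rule Bochner_Integration.integrable_bound[of _ "\<lambda>x. B * p x"])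
      show "AE x in lebesgue. norm (g x * p x) \<le> norm (B * p x)"
        using B by (intro AE_I2) (simp add: abs_mult mult_right_mono)
    qed (use ip in auto)
    have *: "\<bar>(LINT x|lebesgue. g x * p x) - L g\<bar> \<le> B * (LINT x|lebesgue. \<bar>p x - f n x\<bar>) + (1/2)^n * (q g / 2 + h / 8)" for n
    proof -
      define X where "X = (LINT x|lebesgue. f n x * g x) - L g"
      define u :: real where "u = (1/2)^n"
      have u: "u > 0" by (simp add: u_def)
      have *: "- (u\<^sup>2 * h / 8) \<le> t * X + t\<^sup>2 * q g / 2" for t
      proof -
        have "m \<le> J (\<lambda>x. 1 * f n x + t * g x)" by (rule mJ[OF Vlin[OF f(1) gV]])
        also have "\<dots> = (q (f n) + 2 * t * (LINT x|lebesgue. f n x * g x) + t\<^sup>2 * q g) / 2 - (L (f n) + t * L g)"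
          unfolding J_def qlin[OF f(1) gV] Llin[OF f(1) gV] by simp
        also have "\<dots> = J (f n) + t * X + t\<^sup>2 * q g / 2" by (simp add: J_def X_def field_simps)
        finally show ?thesis using f(2)[of n] by (simp add: e_def u_def)
      qed
      \<comment> \<open>Vary \<open>f n\<close> in the directions \<open>g\<close> and \<open>-g\<close> with step \<open>u\<close>, whose square is a
        multiple of \<open>e n\<close>.\<close>
      have "\<bar>X\<bar> * u \<le> u * (q g / 2 + h / 8) * u"
        using *[of u] *[of "-u"] u by (auto simp: abs_if power2_eq_square algebra_simps)
      then have X: "\<bar>X\<bar> \<le> u * (q g / 2 + h / 8)" using u by (simp add: mult.commute)
      have "(LINT x|lebesgue. g x * p x) - (LINT x|lebesgue. f n x * g x) = (LINT x|lebesgue. g x * p x - f n x * g x)"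
        using igp Vi2[OF f(1)[of n] gV] by simp
      then have "\<bar>(LINT x|lebesgue. g x * p x) - (LINT x|lebesgue. f n x * g x)\<bar> \<le> (LINT x|lebesgue. \<bar>g x * p x - f n x * g x\<bar>)"
        by (metis integral_abs_bound)
      also have "\<dots> \<le> (LINT x|lebesgue. B * \<bar>p x - f n x\<bar>)"
      proof (rule integral_mono)
        fix x
        have "g x * p x - f n x * g x = g x * (p x - f n x)" by (simp add: algebra_simps)
        then show "\<bar>g x * p x - f n x * g x\<bar> \<le> B * \<bar>p x - f n x\<bar>"
          using B(2)[of x] by (simp add: abs_mult mult_right_mono)
      qed (use igp Vi2[OF f(1)[of n] gV] ip Vi(1)[OF f(1)[of n]] in auto)
      finally show ?thesis using X by (simp add: X_def u_def)
    qed
    have "(\<lambda>n. B * (LINT x|lebesgue. \<bar>p x - f n x\<bar>) + (1/2)^n * (q g / 2 + h / 8)) \<longlonglongrightarrow> B * 0 + 0 * (q g / 2 + h / 8)"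
      by (intro tendsto_intros lim LIMSEQ_realpow_zero) auto
    then have "\<bar>(LINT x|lebesgue. g x * p x) - L g\<bar> \<le> B * 0 + 0 * (q g / 2 + h / 8)"
      by (rule LIMSEQ_le_const) (use * in blast)
    then show ?thesis by simp
  qed
  then show ?thesis using ip by blast
qed


text \<open>
  Integrability on compact sets, the first condition in the definition of \<open>BMO\<close>.
\<close>

definition loc_integrable :: "(real \<Rightarrow> real) \<Rightarrow> bool" where
  "loc_integrable p \<longleftrightarrow> (\<forall>K. compact K \<longrightarrow> set_integrable lebesgue K p)"

lemma loc_integrable_subset:
  assumes "loc_integrable p" "A \<in> sets lebesgue" "A \<subseteq> {a..b}"
  shows "set_integrable lebesgue A p"
  using assms set_integrable_subset[of lebesgue "{a..b}" p A] by (auto simp: loc_integrable_def)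

lemma loc_integrable_interval:
  assumes "loc_integrable p" "bdd_interval I" shows "set_integrable lebesgue I p"
proof -
  obtain a b where "a < b" "I \<subseteq> {a..b}" "closure I = {a..b}" "measure lebesgue I = b - a"
    by (rule bdd_interval_closure[OF assms(2)])
  then show ?thesis
    using loc_integrable_subset[OF assms(1) fmeasurableD[OF interval_lmeasurable[OF assms(2)]]] by blast
qed

lemma loc_integrable_measurable:
  assumes "loc_integrable p" shows "p \<in> borel_measurable lebesgue"
proof (rule borel_measurable_LIMSEQ_real)
  fix n :: nat
  have "set_integrable lebesgue {- real n..real n} p" using assms by (simp add: loc_integrable_def)
  then show "(\<lambda>x. indicator {- real n..real n} x * p x) \<in> borel_measurable lebesgue"
    by (auto simp: set_integrable_def)
next
  fix x :: real
  have "\<forall>\<^sub>F n in sequentially. indicator {- real n..real n} x * p x = p x"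
  proof (rule eventually_sequentiallyI[of "nat \<lceil>\<bar>x\<bar>\<rceil>"])
    fix n assume "nat \<lceil>\<bar>x\<bar>\<rceil> \<le> n"
    then have "\<bar>x\<bar> \<le> real n" by linarith
    then show "indicator {- real n..real n} x * p x = p x" by (auto simp: abs_le_iff)
  qed
  then show "(\<lambda>n. indicator {- real n..real n} x * p x) \<longlonglongrightarrow> p x" by (rule tendsto_eventually)
qed

lemma loc_integrable_bsupp:
  assumes p: "loc_integrable p" and g: "bsupp a b g"
  shows "integrable lebesgue (\<lambda>x. g x * p x)"
proof -
  obtain B where B: "B > 0" "\<And>x. \<bar>g x\<bar> \<le> B" using bsupp_bound[OF g] by blast
  have i: "integrable lebesgue (\<lambda>x. indicator {a..b} x * p x)"
    using p by (auto simp: loc_integrable_def set_integrable_def)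
  show ?thesis
  proof (rule Bochner_Integration.integrable_bound[of _ "\<lambda>x. B * (indicator {a..b} x * p x)"])
    show "AE x in lebesgue. norm (g x * p x) \<le> norm (B * (indicator {a..b} x * p x))"
    proof (rule AE_I2)
      fix x
      show "norm (g x * p x) \<le> norm (B * (indicator {a..b} x * p x))"
        using B g by (cases "x \<in> {a..b}") (auto simp: bsupp_def abs_mult mult_right_mono)
    qed
  qed (use i loc_integrable_measurable[OF p] bsupp_measurable[OF g] in auto)
qed

text \<open>
  The functional \<open>L\<close> is given by integration against \<open>p\<close> on bounded compactly supported functions with
  mean zero. Such functions are exactly the bounded compactly supported members of \<open>H1\<close>.
\<close>

definition represents :: "((real \<Rightarrow> real) \<Rightarrow> real) \<Rightarrow> (real \<Rightarrow> real) \<Rightarrow> bool" where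
  "represents L p \<longleftrightarrow> loc_integrable p \<and>
     (\<forall>a b g. bsupp a b g \<and> (LINT x|lebesgue. g x) = 0 \<longrightarrow> L g = (LINT x|lebesgue. g x * p x))"

lemma represents_mean_osc:
  assumes r: "represents L p" and C: "\<And>f. f \<in> H1 \<Longrightarrow> \<bar>L f\<bar> \<le> C * h1_norm f" and C0: "C \<ge> 0"
    and I: "bdd_interval I"
  shows "mean_osc p I \<le> 2 * C"
proof -
  have p: "set_integrable lebesgue I p"
    using r loc_integrable_interval[OF _ I] by (simp add: represents_def)
  obtain a b where ab: "a < b" "I \<subseteq> {a..b}" "closure I = {a..b}" "measure lebesgue I = b - a"
    by (rule bdd_interval_closure[OF I])
  obtain g where g: "g \<in> borel_measurable lebesgue" "\<And>x. \<bar>g x\<bar> \<le> 2" "\<And>x. x \<notin> I \<Longrightarrow> g x = 0"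
    "(LINT x|lebesgue. g x) = 0" "(LINT x|lebesgue. g x * p x) = measure lebesgue I * mean_osc p I"
    using osc_test_function[OF I p] by blast
  have "bsupp a (b+1) g" by (rule bsupp_I[OF g(1,2)]) (use ab(2) g(3) in force)
  then have "L g = (b - a) * mean_osc p I" using r g(4,5) ab(4) by (auto simp: represents_def)
  moreover have "g \<in> H1" "h1_norm g \<le> 2 * (b - a)"
    using H1_bounded[OF ab(1) g(1,2) _ g(4)] ab(2) g(3) by blast+
  moreover have "C * h1_norm g \<le> C * (2 * (b - a))" using C0 calculation by (intro mult_left_mono)
  ultimately have "(b - a) * mean_osc p I \<le> (b - a) * (2 * C)" using C[of g] by (simp add: mult_ac)
  then show ?thesis using ab(1) by simp
qed

lemma represents_bmo:
  assumes r: "represents L p" and C: "\<And>f. f \<in> H1 \<Longrightarrow> \<bar>L f\<bar> \<le> C * h1_norm f" and C0: "C \<ge> 0"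
  shows "p \<in> BMO" "bmo_norm p \<le> 2 * C"
proof -
  note m = represents_mean_osc[OF assms]
  show "p \<in> BMO" using r m by (auto simp: BMO_def represents_def loc_integrable_def intro!: bdd_aboveI2)
  have "Collect bdd_interval \<noteq> {}" using bdd_interval_Icc[of 0 1] by auto
  then show "bmo_norm p \<le> 2 * C" unfolding bmo_norm_def using m by (intro cSUP_least) auto
qed

text \<open>
  The representing functions on the intervals \<open>[-n-1,n+1)\<close> are normalised to have mean zero over
  \<open>[-1,1)\<close>. They are then consistent, and eventually constant at almost every point.
\<close>

lemma dual_H1_represented:
  assumes L: "L \<in> dual_space H1 h1_norm"
  obtains p where "represents L p"
proof -
  define S where "S = (\<lambda>n::nat. {- real (Suc n)..<real (Suc n)})"
  define I0 where "I0 = (\<lambda>x::real. indicator {-1..<1} x :: real)"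
  have Smono: "S n \<subseteq> S k" if "n \<le> k" for n k using that by (auto simp: S_def)
  have "\<exists>p. integrable lebesgue p \<and>
    (\<forall>g. bsupp (- real (Suc n)) (real (Suc n)) g \<and> (LINT x|lebesgue. g x) = 0 \<longrightarrow> L g = (LINT x|lebesgue. g x * p x))" for n
  proof -
    have "- real (Suc n) < real (Suc n)" by simp
    then show ?thesis using L by (rule dual_H1_represented_on_interval)
  qed
  then have "\<forall>n. \<exists>p. integrable lebesgue p \<and>
    (\<forall>g. bsupp (- real (Suc n)) (real (Suc n)) g \<and> (LINT x|lebesgue. g x) = 0 \<longrightarrow> L g = (LINT x|lebesgue. g x * p x))"
    by blast
  from choice[OF this] obtain q where q': "\<forall>n. integrable lebesgue (q n) \<and>
    (\<forall>g. bsupp (- real (Suc n)) (real (Suc n)) g \<and> (LINT x|lebesgue. g x) = 0 \<longrightarrow> L g = (LINT x|lebesgue. g x * q n x))" ..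
  have q: "integrable lebesgue (q n)"
    "bsupp (- real (Suc n)) (real (Suc n)) g \<Longrightarrow> (LINT x|lebesgue. g x) = 0 \<Longrightarrow> L g = (LINT x|lebesgue. g x * q n x)" for n g
    using q' by blast+
  define t where "t = (\<lambda>n x. q n x - (LINT x|lebesgue. I0 x * q n x) / 2)"
  have i0: "integrable lebesgue I0" unfolding I0_def by (rule integrable_indicator_Ico)
  have b0: "bsupp (-1) 1 I0" using bsupp_ind[of "-1" 1 1] by (simp add: I0_def[abs_def])
  have gq: "integrable lebesgue (\<lambda>x. g x * q n x)" if g: "bsupp a b g" for a b g n
  proof -
    obtain B where B: "B > 0" "\<And>x. \<bar>g x\<bar> \<le> B" using bsupp_bound[OF g] by blast
    show ?thesis
    proof (rule Bochner_Integration.integrable_bound[of _ "\<lambda>x. B * q n x"])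
      show "AE x in lebesgue. norm (g x * q n x) \<le> norm (B * q n x)"
        using B by (intro AE_I2) (simp add: abs_mult mult_right_mono)
    qed (use q(1)[of n] bsupp_measurable[OF g] in auto)
  qed
  have gt: "integrable lebesgue (\<lambda>x. g x * t n x)" if g: "bsupp a b g" for a b g n
    unfolding t_def right_diff_distrib by (intro Bochner_Integration.integrable_diff gq[OF g] integrable_mult_left bsupp_integrable[OF g])
  have Lt: "L g = (LINT x|lebesgue. g x * t n x)"
    if g: "bsupp (- real (Suc n)) (real (Suc n)) g" "(LINT x|lebesgue. g x) = 0" for n g
    using q(2)[OF g] gq[OF g(1), of n] bsupp_integrable[OF g(1)] g(2) by (simp add: t_def right_diff_distrib)
  have t0: "(LINT x|lebesgue. I0 x * t n x) = 0" for n
  proof -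
    have "(LINT x|lebesgue. I0 x) = 2" unfolding I0_def by (subst integral_indicator_Ico) auto
    then show ?thesis using gq[OF b0, of n] i0 by (simp add: t_def right_diff_distrib)
  qed
  have agree: "AE x in lebesgue. x \<in> S n \<longrightarrow> t n x = t k x" if nk: "n \<le> k" for n k
  proof -
    let ?a = "- real (Suc n)" and ?b = "real (Suc n)"
    have si: "set_integrable lebesgue {?a..<?b} (\<lambda>x. t n x - t k x)"
    proof -
      have bi: "bsupp ?a ?b (\<lambda>x. indicator {?a..<?b} x)" using bsupp_ind[of ?a ?b 1] by simp
      show ?thesis unfolding set_integrable_def
        using gt[OF bi, of n] gt[OF bi, of k] by (simp add: right_diff_distrib)
    qed
    have "\<exists>c. AE x in lebesgue. x \<in> {?a..<?b} \<longrightarrow> t n x - t k x = c"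
    proof (rule bsupp_annihilator_const[OF _ si])
      fix g assume g: "bsupp ?a ?b g" "(LINT x|lebesgue. g x) = 0"
      have "bsupp (- real (Suc k)) (real (Suc k)) g" by (rule bsupp_mono[OF g(1)]) (use nk in auto)
      then show "(LINT x|lebesgue. g x * (t n x - t k x)) = 0"
        using Lt[OF g] Lt[of k g] g gt[OF g(1), of n] gt[OF g(1), of k] by (simp add: right_diff_distrib)
    qed simp
    then obtain c where c: "AE x in lebesgue. x \<in> {?a..<?b} \<longrightarrow> t n x - t k x = c" by blast
    have "(LINT x|lebesgue. I0 x * t n x - I0 x * t k x) = (LINT x|lebesgue. c * I0 x)"
    proof (rule integral_cong_AE)
      show "AE x in lebesgue. I0 x * t n x - I0 x * t k x = c * I0 x"
        using c by eventually_elim (auto simp: I0_def indicator_def)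
    qed (use gt[OF b0, of n] gt[OF b0, of k] i0 in auto)
    moreover have "(LINT x|lebesgue. I0 x) = 2" unfolding I0_def by (subst integral_indicator_Ico) auto
    ultimately have c0: "c = 0" using gt[OF b0, of n] gt[OF b0, of k] t0 by simp
    show ?thesis using c unfolding c0 by eventually_elim (auto simp: S_def)
  qed
  \<comment> \<open>Glueing by a limit makes \<open>p\<close> measurable.\<close>
  define p where "p = (\<lambda>x. lim (\<lambda>n. indicator (S n) x * t n x))"
  have pt: "AE x in lebesgue. \<forall>n. x \<in> S n \<longrightarrow> p x = t n x"
  proof -
    have "AE x in lebesgue. \<forall>n. \<forall>k. n \<le> k \<longrightarrow> x \<in> S n \<longrightarrow> t n x = t k x"
      unfolding AE_all_countable using agree by auto
    then show ?thesis
    proof eventually_elim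
      case (elim x)
      show ?case
      proof (intro allI impI)
        fix n assume n: "x \<in> S n"
        have "\<forall>\<^sub>F k in sequentially. indicator (S k) x * t k x = t n x"
          using elim n Smono by (intro eventually_sequentiallyI[of n]) (force simp: indicator_def)
        then show "p x = t n x" unfolding p_def by (intro limI tendsto_eventually)
      qed
    qed
  qed
  have Sm: "S n \<in> sets lebesgue" for n by (simp add: S_def)
  have tm[measurable]: "t n \<in> borel_measurable lebesgue" for n using q(1)[of n] by (auto simp: t_def)
  have pm[measurable]: "p \<in> borel_measurable lebesgue"
    unfolding p_def using Sm tm by (intro borel_measurable_lim_metric borel_measurable_times borel_measurable_indicator) auto
  have gp: "AE x in lebesgue. g x * p x = g x * t n x" if "bsupp (- real (Suc n)) (real (Suc n)) g" for n g
    using pt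
  proof eventually_elim
    case (elim x)
    then show ?case using that by (cases "x \<in> S n") (auto simp: bsupp_def S_def)
  qed
  have ex: "\<exists>n. - real (Suc n) \<le> a \<and> b \<le> real (Suc n)" for a b
    by (rule exI[of _ "nat \<lceil>max \<bar>a\<bar> \<bar>b\<bar>\<rceil>"]) linarith
  have "represents L p" unfolding represents_def loc_integrable_def
  proof (intro conjI allI impI)
    fix K :: "real set" assume K: "compact K"
    then obtain B where B: "\<And>x. x \<in> K \<Longrightarrow> \<bar>x\<bar> \<le> B" using compact_imp_bounded bounded_iff by (metis real_norm_def)
    obtain n where n: "- real (Suc n) \<le> - B" "B + 1 \<le> real (Suc n)" using ex by blast
    have Km: "K \<in> sets lebesgue" using K by (simp add: lmeasurable_compact fmeasurableD)
    have bK: "bsupp (- real (Suc n)) (real (Suc n)) (indicator K)"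
    proof (rule bsupp_I[where B=1])
      show "indicator K x = (0::real)" if "x \<notin> {- real (Suc n)..<real (Suc n)}" for x
        using that B[of x] n by (cases "x \<in> K") (auto simp: abs_le_iff)
    qed (use Km in \<open>auto simp: indicator_def\<close>)
    have "integrable lebesgue (\<lambda>x. indicator K x * p x)"
      by (rule integrable_cong_AE_imp[OF gt[OF bK, of n]]) (use gp[OF bK] Km in auto)
    then show "set_integrable lebesgue K p" by (simp add: set_integrable_def)
  next
    fix a b g assume g: "bsupp a b g \<and> (LINT x|lebesgue. g x) = 0"
    obtain n where n: "- real (Suc n) \<le> a" "b \<le> real (Suc n)" using ex by blast
    have g': "bsupp (- real (Suc n)) (real (Suc n)) g" using g n bsupp_mono by blast
    have [measurable]: "g \<in> borel_measurable lebesgue" using g by (simp add: bsupp_def)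
    have "(LINT x|lebesgue. g x * p x) = (LINT x|lebesgue. g x * t n x)"
      by (rule integral_cong_AE) (use gp[OF g'] in auto)
    then show "L g = (LINT x|lebesgue. g x * p x)" using Lt[OF g'] g by simp
  qed
  then show ?thesis by (rule that)
qed

section \<open>The functional of a \<open>BMO\<close> function\<close>

lemma represents_AE:
  assumes "represents L p" "loc_integrable q" "AE x in lebesgue. p x = q x"
  shows "represents L q"
  unfolding represents_def
proof (intro conjI allI impI assms(2))
  fix a b g assume g: "bsupp a b g \<and> (LINT x|lebesgue. g x) = 0"
  have p: "loc_integrable p" using assms(1) by (simp add: represents_def)
  have "(LINT x|lebesgue. g x * p x) = (LINT x|lebesgue. g x * q x)"
  proof (rule integral_cong_AE)
    show "AE x in lebesgue. g x * p x = g x * q x" using assms(3) by eventually_elim simp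
  qed (use loc_integrable_measurable p assms(2) g in \<open>auto simp: bsupp_def\<close>)
  then show "L g = (LINT x|lebesgue. g x * q x)" using assms(1) g by (auto simp: represents_def)
qed

lemma dual_space_H1_lincomb:
  assumes L: "L \<in> dual_space H1 h1_norm" and M: "M \<in> dual_space H1 h1_norm"
  shows "restrict (\<lambda>f. s * L f + t * M f) H1 \<in> dual_space H1 h1_norm"
proof -
  obtain C where C: "C > 0" "\<And>f. f \<in> H1 \<Longrightarrow> \<bar>L f\<bar> \<le> C * h1_norm f"
    using dual_space_bound[OF L h1_norm_nonneg] by blast
  obtain D where D: "D > 0" "\<And>f. f \<in> H1 \<Longrightarrow> \<bar>M f\<bar> \<le> D * h1_norm f"
    using dual_space_bound[OF M h1_norm_nonneg] by blast
  have "\<bar>s * L f + t * M f\<bar> \<le> (\<bar>s\<bar> * C + \<bar>t\<bar> * D) * h1_norm f" if "f \<in> H1" for f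
  proof -
    have "\<bar>s * L f + t * M f\<bar> \<le> \<bar>s\<bar> * \<bar>L f\<bar> + \<bar>t\<bar> * \<bar>M f\<bar>"
      using abs_triangle_ineq[of "s * L f" "t * M f"] by (simp add: abs_mult)
    also have "\<dots> \<le> \<bar>s\<bar> * (C * h1_norm f) + \<bar>t\<bar> * (D * h1_norm f)"
      by (intro add_mono mult_left_mono C(2) D(2) that) auto
    finally show ?thesis by (simp add: algebra_simps)
  qed
  then have "\<exists>K. \<forall>f\<in>H1. \<bar>s * L f + t * M f\<bar> \<le> K * h1_norm f" by blast
  then show ?thesis
    using H1_lincomb dual_space_lin[OF L] dual_space_lin[OF M]
    unfolding dual_space_def by (auto simp: algebra_simps)
qed

lemma represents_lincomb:
  assumes L: "represents L p" and M: "represents M q"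
  shows "represents (restrict (\<lambda>f. s * L f + t * M f) H1) (\<lambda>x. s * p x + t * q x)"
proof -
  have pq: "loc_integrable p" "loc_integrable q" using L M by (auto simp: represents_def)
  have "loc_integrable (\<lambda>x. s * p x + t * q x)"
    using pq by (auto simp: loc_integrable_def intro!: set_integral_add)
  moreover have "restrict (\<lambda>f. s * L f + t * M f) H1 g = (LINT x|lebesgue. g x * (s * p x + t * q x))"
    if g: "bsupp a b g" "(LINT x|lebesgue. g x) = 0" for a b g
  proof -
    have "g \<in> H1"
      using g bsupp_mean_zero_in_H1 by blast
    moreover have "(LINT x|lebesgue. g x * (s * p x + t * q x)) = (LINT x|lebesgue. s * (g x * p x) + t * (g x * q x))"
      by (simp add: algebra_simps)
    ultimately show ?thesis
      using g L M loc_integrable_bsupp[OF pq(1) g(1)] loc_integrable_bsupp[OF pq(2) g(1)]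
      by (auto simp: represents_def)
  qed
  ultimately show ?thesis unfolding represents_def by blast
qed

lemma bsupp_compact_support:
  assumes "bsupp a b f" shows "bounded (range f)" "compact (closure {x. f x \<noteq> 0})"
proof -
  show "bounded (range f)" using assms by (simp add: bsupp_def)
  have "{x. f x \<noteq> 0} \<subseteq> {a..b}"
  proof
    fix x assume "x \<in> {x. f x \<noteq> 0}"
    then have "x \<in> {a..<b}" using assms by (auto simp: bsupp_def)
    then show "x \<in> {a..b}" by simp
  qed
  then show "compact (closure {x. f x \<noteq> 0})"
    unfolding compact_closure by (rule bounded_subset[OF bounded_closed_interval])
qed

lemma H1_compact_support_bsupp:
  assumes "f \<in> H1" "bounded (range f)" "compact (closure {x. f x \<noteq> 0})"
  obtains a b where "bsupp a b f"
proof -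
  have "bounded {x. f x \<noteq> 0}" using assms(3) by (simp add: compact_closure)
  then obtain B where B: "\<And>x. f x \<noteq> 0 \<Longrightarrow> \<bar>x\<bar> \<le> B" by (auto simp: bounded_iff)
  have "f x = 0" if "x \<notin> {-B..<B+1}" for x
  proof (rule ccontr)
    assume "f x \<noteq> 0"
    then show False using B[of x] that by auto
  qed
  then have "bsupp (-B) (B+1) f"
    using assms H1_integrable unfolding bsupp_def by blast
  then show ?thesis by (rule that)
qed

lemma atom_bsupp:
  assumes "atom_on I a" obtains u v where "bsupp u v a"
proof -
  have I: "bdd_interval I" and b: "\<And>x. \<bar>a x\<bar> \<le> 1 / measure lebesgue I" "a \<in> borel_measurable lebesgue"
    using assms by (auto simp: atom_on_def)
  obtain u v where uv: "u < v" "I \<subseteq> {u..v}" "closure I = {u..v}" "measure lebesgue I = v - u"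
    by (rule bdd_interval_closure[OF I])
  have "bsupp u (v+1) a"
  proof (rule bsupp_I[OF b(2,1)])
    fix x assume "x \<notin> {u..<v+1}"
    then have "x \<notin> I" using uv(2) by auto
    then show "a x = 0" using atom_on_bound[OF assms, of x] by simp
  qed
  then show ?thesis by (rule that)
qed

text \<open>
  Uniqueness in the definition of \<open>bmo_functional\<close>: atoms are bounded and compactly supported, and they
  determine a bounded functional.
\<close>

lemma bmo_functional_eqI:
  assumes L: "L \<in> dual_space H1 h1_norm" and r: "represents L p"
  shows "bmo_functional p = L"
  unfolding bmo_functional_def
proof (rule the_equality)
  show "L \<in> dual_space H1 h1_norm \<and> (\<forall>f\<in>H1. bounded (range f) \<and> compact (closure {x. f x \<noteq> 0}) \<longrightarrow>
        L f = (LINT x|lebesgue. f x * p x))"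
  proof (intro conjI L ballI impI)
    fix f assume f: "f \<in> H1" "bounded (range f) \<and> compact (closure {x. f x \<noteq> 0})"
    then obtain a b where "bsupp a b f" using H1_compact_support_bsupp by blast
    then show "L f = (LINT x|lebesgue. f x * p x)"
      using r H1_integral_zero[OF f(1)] by (auto simp: represents_def)
  qed
next
  fix M assume M: "M \<in> dual_space H1 h1_norm \<and> (\<forall>f\<in>H1. bounded (range f) \<and> compact (closure {x. f x \<noteq> 0}) \<longrightarrow>
        M f = (LINT x|lebesgue. f x * p x))"
  show "M = L"
  proof (rule dual_H1_eqI[OF conjunct1[OF M] L])
    fix I a assume a: "atom_on I a"
    obtain u v where uv: "bsupp u v a" by (rule atom_bsupp[OF a])
    have "M a = (LINT x|lebesgue. a x * p x)"
      using M atom_H1(1)[OF a] bsupp_compact_support[OF uv] by blast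
    also have "\<dots> = L a" using r uv atom_integrable(3)[OF a] by (auto simp: represents_def)
    finally show "M a = L a" .
  qed
qed

lemma BMO_loc_integrable: "p \<in> BMO \<Longrightarrow> loc_integrable p"
  by (simp add: BMO_def loc_integrable_def)

lemma mean_osc_le_bmo_norm: "p \<in> BMO \<Longrightarrow> bdd_interval I \<Longrightarrow> mean_osc p I \<le> bmo_norm p"
  unfolding bmo_norm_def by (rule cSUP_upper) (auto simp: BMO_def)

lemma bmo_norm_nonneg: "p \<in> BMO \<Longrightarrow> 0 \<le> bmo_norm p"
  using mean_osc_le_bmo_norm[OF _ bdd_interval_Icc[of 0 1]] mean_osc_nonneg[of p "{0..1}"] by force

text \<open>
  Truncation of a real number to \<open>[-N,N]\<close>.
\<close>

definition trunc_at :: "real \<Rightarrow> real \<Rightarrow> real" where "trunc_at N y = max (-N) (min N y)"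

lemma trunc_at_lipschitz: "\<bar>trunc_at N x - trunc_at N y\<bar> \<le> \<bar>x - y\<bar>"
  by (auto simp: trunc_at_def)

lemma trunc_at_bound: "N \<ge> 0 \<Longrightarrow> \<bar>trunc_at N x\<bar> \<le> N" and trunc_at_le: "N \<ge> 0 \<Longrightarrow> \<bar>trunc_at N x\<bar> \<le> \<bar>x\<bar>"
  by (auto simp: trunc_at_def)

lemma trunc_at_tendsto: "(\<lambda>n. trunc_at (real n) y) \<longlonglongrightarrow> y"
proof (rule tendsto_eventually, rule eventually_sequentiallyI[of "nat \<lceil>\<bar>y\<bar>\<rceil>"])
  fix n assume "nat \<lceil>\<bar>y\<bar>\<rceil> \<le> n"
  then have "\<bar>y\<bar> \<le> real n" by linarith
  then show "trunc_at (real n) y = y" by (auto simp: trunc_at_def)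
qed

lemma trunc_at_pairing_tendsto:
  assumes p: "loc_integrable p" and g: "bsupp a b g"
  shows "(\<lambda>n. LINT x|lebesgue. g x * trunc_at (real n) (p x)) \<longlonglongrightarrow> (LINT x|lebesgue. g x * p x)"
proof -
  have [measurable]: "p \<in> borel_measurable lebesgue" "g \<in> borel_measurable lebesgue"
    using loc_integrable_measurable[OF p] g by (auto simp: bsupp_def)
  show ?thesis
  proof (rule integral_dominated_convergence[where w="\<lambda>x. \<bar>g x * p x\<bar>"])
    show "integrable lebesgue (\<lambda>x. \<bar>g x * p x\<bar>)" using loc_integrable_bsupp[OF p g] by auto
    show "AE x in lebesgue. (\<lambda>n. g x * trunc_at (real n) (p x)) \<longlonglongrightarrow> g x * p x"
      by (intro AE_I2 tendsto_intros trunc_at_tendsto)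
    show "AE x in lebesgue. norm (g x * trunc_at (real n) (p x)) \<le> \<bar>g x * p x\<bar>" for n
      by (intro AE_I2) (auto simp: abs_mult intro!: mult_left_mono trunc_at_le)
  qed (auto simp: trunc_at_def)
qed

text \<open>
  As the atom has mean zero, the truncation of the constant \<open>mean p I\<close> may be subtracted, and the
  Lipschitz bound gives the mean oscillation of \<open>p\<close>, uniformly in \<open>N\<close>.
\<close>

lemma atom_trunc_at_pairing_le:
  assumes p: "loc_integrable p" and a: "atom_on I a" and N: "N \<ge> 0"
  shows "\<bar>LINT x|lebesgue. a x * trunc_at N (p x)\<bar> \<le> mean_osc p I"
proof -
  have I: "bdd_interval I" using a by (simp add: atom_on_def)
  define v where "v = measure lebesgue I"
  have v: "v > 0" using I by (simp add: v_def bdd_interval_def)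
  define m where "m = mean p I"
  note ia = atom_integrable[OF a]
  have [measurable]: "p \<in> borel_measurable lebesgue" "a \<in> borel_measurable lebesgue"
    using loc_integrable_measurable[OF p] ia(1) by auto
  have iac: "integrable lebesgue (\<lambda>x. a x * trunc_at N (p x))"
  proof (rule Bochner_Integration.integrable_bound[of _ "\<lambda>x. N * a x"])
    show "AE x in lebesgue. norm (a x * trunc_at N (p x)) \<le> norm (N * a x)"
    proof (rule AE_I2)
      fix x
      have "\<bar>a x\<bar> * \<bar>trunc_at N (p x)\<bar> \<le> \<bar>a x\<bar> * \<bar>N\<bar>"
        using trunc_at_bound[OF N, of "p x"] by (intro mult_left_mono) auto
      then show "norm (a x * trunc_at N (p x)) \<le> norm (N * a x)" by (simp add: abs_mult mult.commute)
    qed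
  qed (use ia in \<open>auto simp: trunc_at_def\<close>)
  have ii: "integrable lebesgue (indicator I :: real \<Rightarrow> real)"
    using interval_lmeasurable[OF I] by (auto simp: fmeasurable_def)
  have ip: "integrable lebesgue (\<lambda>x. indicator I x * p x)"
    using loc_integrable_interval[OF p I] by (simp add: set_integrable_def)
  have eq: "indicator I x * \<bar>p x - m\<bar> = \<bar>indicator I x * p x - m * indicator I x\<bar>" for x
    by (auto simp: indicator_def)
  have iosc: "integrable lebesgue (\<lambda>x. indicator I x * \<bar>p x - m\<bar>)"
    unfolding eq using ii ip by auto
  have "(LINT x|lebesgue. a x * trunc_at N (p x)) = (LINT x|lebesgue. a x * trunc_at N (p x) - trunc_at N m * a x)"
    using iac ia by simp
  then have "\<bar>LINT x|lebesgue. a x * trunc_at N (p x)\<bar> \<le> (LINT x|lebesgue. \<bar>a x * trunc_at N (p x) - trunc_at N m * a x\<bar>)"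
    by (metis integral_abs_bound)
  also have "\<dots> \<le> (LINT x|lebesgue. indicator I x * \<bar>p x - m\<bar> / v)"
  proof (rule integral_mono)
    fix x
    have "\<bar>a x * trunc_at N (p x) - trunc_at N m * a x\<bar> = \<bar>a x\<bar> * \<bar>trunc_at N (p x) - trunc_at N m\<bar>"
      by (simp add: abs_mult[symmetric] algebra_simps)
    also have "\<dots> \<le> (indicator I x / v) * \<bar>p x - m\<bar>"
      using atom_on_bound[OF a, of x] v by (intro mult_mono trunc_at_lipschitz) (auto simp: v_def)
    finally show "\<bar>a x * trunc_at N (p x) - trunc_at N m * a x\<bar> \<le> indicator I x * \<bar>p x - m\<bar> / v" by simp
  qed (use iac ia iosc in auto)
  also have "\<dots> = mean_osc p I"
    by (simp add: mean_osc_def m_def[symmetric] mean_def[of "\<lambda>x. \<bar>p x - m\<bar>"] set_lebesgue_integral_def v_def)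
  finally show ?thesis .
qed

lemma bounded_pairing_sums:
  assumes D: "atomic_decomp f l a" and q: "q \<in> borel_measurable lebesgue" "\<And>x. \<bar>q x\<bar> \<le> N"
  shows "integrable lebesgue (\<lambda>x. f x * q x)"
    "(\<lambda>j. l j * (LINT x|lebesgue. a j x * q x)) sums (LINT x|lebesgue. f x * q x)"
proof -
  have A: "\<And>j. \<exists>I. atom_on I (a j)" "summable (\<lambda>j. \<bar>l j\<bar>)" and f: "integrable lebesgue f"
    "(\<lambda>n. LINT x|lebesgue. \<bar>f x - (\<Sum>j<n. l j * a j x)\<bar>) \<longlonglongrightarrow> 0"
    using D by (auto simp: atomic_decomp_def)
  have ia: "integrable lebesgue (a j)" for j using A(1)[of j] atom_integrable(1) by blast
  have iq: "integrable lebesgue (\<lambda>x. g x * q x)" if "integrable lebesgue g" for g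
  proof (rule Bochner_Integration.integrable_bound[of _ "\<lambda>x. N * g x"])
    show "AE x in lebesgue. norm (g x * q x) \<le> norm (N * g x)"
    proof (rule AE_I2)
      fix x
      have "\<bar>g x\<bar> * \<bar>q x\<bar> \<le> \<bar>g x\<bar> * \<bar>N\<bar>"
        using q(2)[of x] by (intro mult_left_mono) auto
      then show "norm (g x * q x) \<le> norm (N * g x)" by (simp add: abs_mult mult.commute)
    qed
  qed (use that q in auto)
  show "integrable lebesgue (\<lambda>x. f x * q x)" by (rule iq[OF f(1)])
  have le: "\<bar>(LINT x|lebesgue. f x * q x) - (\<Sum>j<n. l j * (LINT x|lebesgue. a j x * q x))\<bar>
      \<le> N * (LINT x|lebesgue. \<bar>f x - (\<Sum>j<n. l j * a j x)\<bar>)" for n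
  proof -
    let ?r = "\<lambda>x. f x - (\<Sum>j<n. l j * a j x)"
    have ir: "integrable lebesgue ?r" using f(1) ia by auto
    have "(LINT x|lebesgue. f x * q x) - (\<Sum>j<n. l j * (LINT x|lebesgue. a j x * q x))
       = (LINT x|lebesgue. f x * q x - (\<Sum>j<n. l j * (a j x * q x)))"
      using iq[OF f(1)] iq[OF ia] by simp
    also have "\<dots> = (LINT x|lebesgue. ?r x * q x)"
      by (rule Bochner_Integration.integral_cong) (auto simp: left_diff_distrib sum_distrib_right mult.assoc)
    finally have "\<bar>(LINT x|lebesgue. f x * q x) - (\<Sum>j<n. l j * (LINT x|lebesgue. a j x * q x))\<bar>
       \<le> (LINT x|lebesgue. \<bar>?r x * q x\<bar>)" using integral_abs_bound by metis
    also have "\<dots> \<le> (LINT x|lebesgue. N * \<bar>?r x\<bar>)"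
    proof (rule integral_mono)
      show "\<bar>?r x * q x\<bar> \<le> N * \<bar>?r x\<bar>" for x
        using q(2)[of x] unfolding abs_mult by (subst mult.commute) (rule mult_right_mono, auto)
    qed (use iq[OF ir] ir in auto)
    finally show ?thesis by simp
  qed
  have "(\<lambda>n. N * (LINT x|lebesgue. \<bar>f x - (\<Sum>j<n. l j * a j x)\<bar>)) \<longlonglongrightarrow> N * 0"
    by (intro tendsto_intros f(2))
  then have lim: "(\<lambda>n. N * (LINT x|lebesgue. \<bar>f x - (\<Sum>j<n. l j * a j x)\<bar>)) \<longlonglongrightarrow> 0" by simp
  have "(\<lambda>n. (\<Sum>j<n. l j * (LINT x|lebesgue. a j x * q x)) - (LINT x|lebesgue. f x * q x)) \<longlonglongrightarrow> 0"
    by (rule Lim_null_comparison[OF always_eventually lim]) (use le in \<open>auto simp: abs_minus_commute\<close>)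
  then show "(\<lambda>j. l j * (LINT x|lebesgue. a j x * q x)) sums (LINT x|lebesgue. f x * q x)"
    unfolding sums_def by (rule LIM_zero_cancel)
qed

text \<open>
  The functional is the limit of the pairings \<open>P n f\<close> of \<open>f\<close> with the truncations of \<open>p\<close>. Along any
  atomic decomposition of \<open>f\<close>, the limit may be taken termwise by Tannery's theorem.
\<close>

lemma BMO_representing_functional:
  assumes p: "p \<in> BMO"
  shows "\<exists>L. L \<in> dual_space H1 h1_norm \<and> represents L p \<and> (\<forall>f\<in>H1. \<bar>L f\<bar> \<le> bmo_norm p * h1_norm f)"
proof -
  have pl: "loc_integrable p" by (rule BMO_loc_integrable[OF p])
  have [measurable]: "p \<in> borel_measurable lebesgue" by (rule loc_integrable_measurable[OF pl])
  define b where "b = bmo_norm p"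
  have b0: "b \<ge> 0" unfolding b_def by (rule bmo_norm_nonneg[OF p])
  define P where "P = (\<lambda>n f. LINT x|lebesgue. f x * trunc_at (real n) (p x))"
  have cm: "(\<lambda>x. trunc_at (real n) (p x)) \<in> borel_measurable lebesgue" for n unfolding trunc_at_def by measurable
  have cb: "\<bar>trunc_at (real n) (p x)\<bar> \<le> real n" for n x by (rule trunc_at_bound) simp
  have lim: "convergent (\<lambda>n. P n f) \<and> \<bar>lim (\<lambda>n. P n f)\<bar> \<le> b * (\<Sum>j. \<bar>l j\<bar>)"
    if D: "atomic_decomp f l a" for f l a
  proof -
    have sl: "summable (\<lambda>j. \<bar>l j\<bar>)" using D by (simp add: atomic_decomp_def)
    have at: "\<exists>I. atom_on I (a j)" for j using D by (simp add: atomic_decomp_def)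
    have Pa: "\<bar>P n (a j)\<bar> \<le> b" for n j
    proof -
      obtain I where I: "atom_on I (a j)" using at by blast
      then have "\<bar>P n (a j)\<bar> \<le> mean_osc p I" unfolding P_def by (intro atom_trunc_at_pairing_le[OF pl]) auto
      also have "\<dots> \<le> b" unfolding b_def by (rule mean_osc_le_bmo_norm[OF p]) (use I in \<open>simp add: atom_on_def\<close>)
      finally show ?thesis .
    qed
    define c where "c = (\<lambda>j. LINT x|lebesgue. a j x * p x)"
    have Pc: "(\<lambda>n. P n (a j)) \<longlonglongrightarrow> c j" for j
    proof -
      obtain I where I: "atom_on I (a j)" using at by blast
      obtain u v where "bsupp u v (a j)" by (rule atom_bsupp[OF I])
      then show ?thesis unfolding P_def c_def by (rule trunc_at_pairing_tendsto[OF pl])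
    qed
    have Pf: "(\<lambda>j. l j * P n (a j)) sums P n f" for n
      unfolding P_def by (rule bounded_pairing_sums(2)[OF D cm cb])
    have bd: "norm (l j * P n (a j)) \<le> b * \<bar>l j\<bar>" for j n
      using mult_right_mono[OF Pa[of n j], of "\<bar>l j\<bar>"] by (simp add: abs_mult mult.commute)
    have "(\<lambda>n. \<Sum>j. l j * P n (a j)) \<longlonglongrightarrow> (\<Sum>j. l j * c j)"
      by (rule conjunct2[OF conjunct2[OF tannerys_theorem[where M="\<lambda>j. b * \<bar>l j\<bar>"]]])
         (use bd sl in \<open>auto intro!: tendsto_intros Pc summable_mult always_eventually\<close>)
    moreover have "(\<Sum>j. l j * P n (a j)) = P n f" for n using Pf sums_unique by metis
    ultimately have T: "(\<lambda>n. P n f) \<longlonglongrightarrow> (\<Sum>j. l j * c j)" by simp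
    have "\<bar>P n f\<bar> \<le> b * (\<Sum>j. \<bar>l j\<bar>)" for n
    proof -
      have s: "summable (\<lambda>j. norm (l j * P n (a j)))"
        by (rule summable_comparison_test[OF _ summable_mult[OF sl, of b]]) (use bd in auto)
      have "\<bar>P n f\<bar> \<le> (\<Sum>j. norm (l j * P n (a j)))"
        using summable_norm[OF s] sums_unique[OF Pf[of n]] by simp
      also have "\<dots> \<le> (\<Sum>j. b * \<bar>l j\<bar>)" by (rule suminf_le[OF bd s summable_mult[OF sl]])
      also have "\<dots> = b * (\<Sum>j. \<bar>l j\<bar>)" by (rule suminf_mult[OF sl])
      finally show ?thesis .
    qed
    then have "\<bar>\<Sum>j. l j * c j\<bar> \<le> b * (\<Sum>j. \<bar>l j\<bar>)"
      by (intro LIMSEQ_le_const2[OF tendsto_rabs[OF T]]) auto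
    then show ?thesis using T limI convergentI by metis
  qed
  define L where "L = restrict (\<lambda>f. lim (\<lambda>n. P n f)) H1"
  have PL: "(\<lambda>n. P n f) \<longlonglongrightarrow> L f" if "f \<in> H1" for f
  proof -
    obtain l a where "atomic_decomp f l a" using \<open>f \<in> H1\<close> by (auto simp: H1_def)
    then have "convergent (\<lambda>n. P n f)" using lim by blast
    then show ?thesis using that by (simp add: L_def convergent_LIMSEQ_iff)
  qed
  have bound: "\<bar>L f\<bar> \<le> b * h1_norm f" if f: "f \<in> H1" for f
  proof -
    have *: "\<bar>L f\<bar> \<le> b * c" if less: "h1_norm f < c" for c
    proof -
      obtain l a where la: "atomic_decomp f l a" "(\<Sum>j. \<bar>l j\<bar>) < c"
        using f less by (rule h1_norm_decomp)
      have "\<bar>L f\<bar> \<le> b * (\<Sum>j. \<bar>l j\<bar>)" using lim[OF la(1)] f by (simp add: L_def)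
      also have "\<dots> \<le> b * c" using la(2) b0 by (intro mult_left_mono) auto
      finally show ?thesis .
    qed
    have "((\<lambda>c. b * c) \<longlongrightarrow> b * h1_norm f) (at_right (h1_norm f))" by (intro tendsto_intros)
    moreover have "\<forall>\<^sub>F c in at_right (h1_norm f). \<bar>L f\<bar> \<le> b * c"
      using * by (auto simp: eventually_at_right_field intro!: exI[of _ "h1_norm f + 1"])
    ultimately show ?thesis by (intro tendsto_lowerbound) auto
  qed
  have Pi: "integrable lebesgue (\<lambda>x. f x * trunc_at (real n) (p x))" if "f \<in> H1" for f n
  proof -
    obtain l a where "atomic_decomp f l a" using \<open>f \<in> H1\<close> by (auto simp: H1_def)
    then show ?thesis by (rule bounded_pairing_sums(1)[OF _ cm cb])
  qed
  have lin: "L (\<lambda>x. s * f x + t * g x) = s * L f + t * L g" if fg: "f \<in> H1" "g \<in> H1" for f g s t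
  proof (rule LIMSEQ_unique[OF PL[OF H1_lincomb[OF fg]]])
    have "P n (\<lambda>x. s * f x + t * g x) = s * P n f + t * P n g" for n
    proof -
      have "P n (\<lambda>x. s * f x + t * g x)
        = (LINT x|lebesgue. s * (f x * trunc_at (real n) (p x)) + t * (g x * trunc_at (real n) (p x)))"
        unfolding P_def by (rule Bochner_Integration.integral_cong) (auto simp: algebra_simps)
      also have "\<dots> = s * P n f + t * P n g" unfolding P_def using Pi[OF fg(1)] Pi[OF fg(2)] by simp
      finally show ?thesis .
    qed
    then show "(\<lambda>n. P n (\<lambda>x. s * f x + t * g x)) \<longlonglongrightarrow> s * L f + t * L g"
      by (simp only:) (intro tendsto_intros PL fg)
  qed
  have "L \<in> dual_space H1 h1_norm"
  proof -
    have "\<exists>C. \<forall>f\<in>H1. \<bar>L f\<bar> \<le> C * h1_norm f" using bound by blast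
    moreover have "L \<in> extensional H1" by (simp add: L_def)
    ultimately show ?thesis unfolding dual_space_def using lin by blast
  qed
  moreover have "represents L p"
    unfolding represents_def
  proof (intro conjI allI impI pl)
    fix u v g assume g: "bsupp u v g \<and> (LINT x|lebesgue. g x) = 0"
    have gH: "g \<in> H1"
      using g bsupp_mean_zero_in_H1 by blast
    show "L g = (LINT x|lebesgue. g x * p x)"
      using LIMSEQ_unique[OF PL[OF gH]] trunc_at_pairing_tendsto[OF pl, of u v g] g by (simp add: P_def)
  qed
  ultimately show ?thesis using bound b_def by blast
qed

lemma bmo_functional:
  assumes "p \<in> BMO"
  shows "bmo_functional p \<in> dual_space H1 h1_norm" "represents (bmo_functional p) p"
    "\<And>f. f \<in> H1 \<Longrightarrow> \<bar>bmo_functional p f\<bar> \<le> bmo_norm p * h1_norm f"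
  using BMO_representing_functional[OF assms] bmo_functional_eqI by auto


section \<open>The subspace \<open>HA\<close> and its projection\<close>

text \<open>
  The functional whose kernel is \<open>HA\<close>, as an extensional function on \<open>H1\<close>.
\<close>

definition half_functional :: "(real \<Rightarrow> real) \<Rightarrow> real" where
  "half_functional = restrict (\<lambda>f. LINT x:{0..}|lebesgue. f x) H1"

lemma half_line_sets: "{0::real..} \<in> sets lebesgue" by (simp add: lborelD)

lemma integrable_half_line:
  "integrable lebesgue f \<Longrightarrow> integrable lebesgue (\<lambda>x. indicator {0::real..} x * (f x :: real))"
  using integrable_mult_indicator[OF half_line_sets, of f] by simp

lemma half_functional_eq: "f \<in> H1 \<Longrightarrow> half_functional f = (LINT x|lebesgue. indicator {0..} x * f x)"
  by (simp add: half_functional_def set_lebesgue_integral_def)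

lemma half_functional_le:
  assumes "f \<in> H1" shows "\<bar>half_functional f\<bar> \<le> h1_norm f"
proof -
  note i = H1_integrable[OF assms]
  have "\<bar>half_functional f\<bar> \<le> (LINT x|lebesgue. \<bar>indicator {0..} x * f x\<bar>)"
    unfolding half_functional_eq[OF assms] by (rule integral_abs_bound)
  also have "\<dots> \<le> (LINT x|lebesgue. \<bar>f x\<bar>)"
    using integrable_half_line[OF i] i by (intro integral_mono) (auto simp: indicator_def)
  also have "\<dots> \<le> h1_norm f" by (rule H1_L1_le[OF assms])
  finally show ?thesis .
qed

lemma half_functional_lin:
  assumes "f \<in> H1" "g \<in> H1"
  shows "half_functional (\<lambda>x. s * f x + t * g x) = s * half_functional f + t * half_functional g"
proof -
  have "(LINT x|lebesgue. indicator {0..} x * (s * f x + t * g x))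
     = (LINT x|lebesgue. s * (indicator {0..} x * f x) + t * (indicator {0..} x * g x))"
    by (simp add: algebra_simps)
  then show ?thesis
    using assms integrable_half_line[OF H1_integrable[OF assms(1)]] integrable_half_line[OF H1_integrable[OF assms(2)]]
    by (simp add: half_functional_eq H1_lincomb)
qed

lemma half_functional_dual: "half_functional \<in> dual_space H1 h1_norm"
proof -
  have "\<exists>C. \<forall>f\<in>H1. \<bar>half_functional f\<bar> \<le> C * h1_norm f"
    using half_functional_le by (intro exI[of _ 1]) simp
  then show ?thesis unfolding dual_space_def using half_functional_lin by (auto simp: half_functional_def)
qed

lemma half_functional_represents: "represents half_functional (indicator {0..})"
  unfolding represents_def loc_integrable_def
proof (intro conjI allI impI)
  fix K :: "real set" assume "compact K"
  then have "K \<in> lmeasurable" by (rule lmeasurable_compact)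
  then have "integrable lebesgue (indicator K :: real \<Rightarrow> real)" by (auto simp: fmeasurable_def)
  from integrable_half_line[OF this] show "set_integrable lebesgue K (indicator {0..} :: real \<Rightarrow> real)"
    by (simp add: set_integrable_def mult.commute)
next
  fix a b g assume g: "bsupp a b g \<and> (LINT x|lebesgue. g x) = 0"
  have "g \<in> H1"
    using g bsupp_mean_zero_in_H1 by blast
  then show "half_functional g = (LINT x|lebesgue. g x * indicator {0..} x)"
    by (simp add: half_functional_eq mult.commute)
qed

lemma HA_iff: "f \<in> HA \<longleftrightarrow> f \<in> H1 \<and> half_functional f = 0"
  by (auto simp: HA_def half_functional_def)

text \<open>
  An element of \<open>H1\<close> on which \<open>half_functional\<close> is one, spanning a complement of \<open>HA\<close>.
\<close>

definition jump :: "real \<Rightarrow> real" where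
  "jump x = indicator {0..<1} x - indicator {-1..<0} x"

lemma jump_H1: "jump \<in> H1" "h1_norm jump \<le> 2" and jump_half: "half_functional jump = 1"
proof -
  note i = integrable_indicator_Ico[of 0 1] integrable_indicator_Ico[of "-1" 0]
  have b: "bsupp (-1) 1 jump"
    using bsupp_diff[OF bsupp_mono[OF bsupp_ind[of 0 1 1], of "-1" 1] bsupp_mono[OF bsupp_ind[of "-1" 0 1], of "-1" 1]]
    by (simp add: jump_def[abs_def])
  have z: "(LINT x|lebesgue. jump x) = 0" unfolding jump_def using i by simp
  have le: "\<bar>jump x\<bar> \<le> 1" for x by (auto simp: jump_def indicator_def)
  show H: "jump \<in> H1" "h1_norm jump \<le> 2" using bsupp_H1[OF _ b z le] by simp_all
  have "(LINT x|lebesgue. indicator {0..} x * jump x) = (LINT x|lebesgue. indicator {0..<1::real} x)"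
    by (rule Bochner_Integration.integral_cong) (auto simp: jump_def indicator_def)
  then show "half_functional jump = 1" by (simp add: half_functional_eq[OF H(1)])
qed

text \<open>
  The projection of \<open>H1\<close> onto \<open>HA\<close> along \<open>jump\<close>.
\<close>

definition HA_proj :: "(real \<Rightarrow> real) \<Rightarrow> real \<Rightarrow> real" where
  "HA_proj f = (\<lambda>x. f x - half_functional f * jump x)"

lemma HA_proj_HA:
  assumes "f \<in> H1" shows "HA_proj f \<in> HA" "h1_norm (HA_proj f) \<le> 3 * h1_norm f"
proof -
  have eq: "HA_proj f = (\<lambda>x. 1 * f x + (- half_functional f) * jump x)" by (simp add: HA_proj_def)
  show "HA_proj f \<in> HA"
    unfolding HA_iff eq half_functional_lin[OF assms jump_H1(1)] jump_half
    using H1_lincomb[OF assms jump_H1(1), of 1 "- half_functional f"] by simp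
  have "h1_norm (HA_proj f) \<le> h1_norm f + h1_norm (\<lambda>x. half_functional f * jump x)"
    unfolding HA_proj_def by (rule H1_diff(2)[OF assms H1_scale(1)[OF jump_H1(1)]])
  also have "h1_norm (\<lambda>x. half_functional f * jump x) \<le> \<bar>half_functional f\<bar> * h1_norm jump"
    by (rule H1_scale(2)[OF jump_H1(1)])
  also have "\<dots> \<le> h1_norm f * 2"
    by (intro mult_mono half_functional_le jump_H1 assms h1_norm_nonneg)
  finally show "h1_norm (HA_proj f) \<le> 3 * h1_norm f" by simp
qed

lemma HA_proj_id: "f \<in> HA \<Longrightarrow> HA_proj f = f"
  by (simp add: HA_proj_def HA_iff)

lemma HA_H1: "f \<in> HA \<Longrightarrow> f \<in> H1" by (simp add: HA_iff)

lemma HA_lincomb: "f \<in> HA \<Longrightarrow> g \<in> HA \<Longrightarrow> (\<lambda>x. s * f x + t * g x) \<in> HA"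
  by (simp add: HA_iff H1_lincomb half_functional_lin)

lemma zero_in_HA: "(\<lambda>x. 0) \<in> HA"
  using HA_lincomb[OF HA_proj_HA(1)[OF zero_in_H1] HA_proj_HA(1)[OF zero_in_H1], of 0 0] by simp

lemma restrict_dual_HA:
  assumes L: "L \<in> dual_space H1 h1_norm" shows "restrict L HA \<in> dual_space HA h1_norm"
proof -
  have "\<exists>C. \<forall>f\<in>H1. \<bar>L f\<bar> \<le> C * h1_norm f" using L by (simp add: dual_space_def)
  then have "\<exists>C. \<forall>f\<in>HA. \<bar>L f\<bar> \<le> C * h1_norm f" using HA_H1 by blast
  then show ?thesis
    unfolding dual_space_def using HA_lincomb HA_H1 dual_space_lin[OF L] by auto
qed

lemma dual_norm_le:
  assumes "\<And>f. f \<in> HA \<Longrightarrow> \<bar>L f\<bar> \<le> C * h1_norm f" "C \<ge> 0"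
  shows "dual_norm HA h1_norm L \<le> C"
  unfolding dual_norm_def
proof (rule cSup_least)
  show "{\<bar>L f\<bar> |f. f \<in> HA \<and> h1_norm f \<le> 1} \<noteq> {}" using zero_in_HA h1_norm_zero by force
  fix x assume "x \<in> {\<bar>L f\<bar> |f. f \<in> HA \<and> h1_norm f \<le> 1}"
  then obtain f where f: "x = \<bar>L f\<bar>" "f \<in> HA" "h1_norm f \<le> 1" by blast
  have "C * h1_norm f \<le> C" using f(3) assms(2) by (simp add: mult_left_le)
  then show "x \<le> C" using assms(1)[OF f(2)] f(1) by simp
qed

lemma dual_norm_bdd:
  assumes L: "L \<in> dual_space HA h1_norm"
  shows "bdd_above {\<bar>L f\<bar> |f. f \<in> HA \<and> h1_norm f \<le> 1}"
proof -
  obtain C where C: "C > 0" "\<And>f. f \<in> HA \<Longrightarrow> \<bar>L f\<bar> \<le> C * h1_norm f"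
    using dual_space_bound[OF L h1_norm_nonneg[OF HA_H1]] by blast
  show ?thesis
  proof (rule bdd_aboveI)
    fix x assume "x \<in> {\<bar>L f\<bar> |f. f \<in> HA \<and> h1_norm f \<le> 1}"
    then obtain f where f: "x = \<bar>L f\<bar>" "f \<in> HA" "h1_norm f \<le> 1" by blast
    have "C * h1_norm f \<le> C" using f(3) C(1) by (simp add: mult_left_le)
    then show "x \<le> C" using C(2)[OF f(2)] f(1) by simp
  qed
qed

lemma dual_norm_nonneg:
  assumes L: "L \<in> dual_space HA h1_norm" shows "0 \<le> dual_norm HA h1_norm L"
proof -
  have "\<bar>L (\<lambda>x. 0)\<bar> \<le> dual_norm HA h1_norm L"
    unfolding dual_norm_def
  proof (rule cSup_upper[OF _ dual_norm_bdd[OF L]])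
    show "\<bar>L (\<lambda>x. 0)\<bar> \<in> {\<bar>L f\<bar> |f. f \<in> HA \<and> h1_norm f \<le> 1}"
      using zero_in_HA h1_norm_zero by force
  qed
  then show ?thesis by linarith
qed

lemma dual_norm_bound:
  assumes L: "L \<in> dual_space HA h1_norm" and f: "f \<in> HA"
  shows "\<bar>L f\<bar> \<le> dual_norm HA h1_norm L * h1_norm f"
proof -
  obtain C where C: "C > 0" "\<And>f. f \<in> HA \<Longrightarrow> \<bar>L f\<bar> \<le> C * h1_norm f"
    using dual_space_bound[OF L h1_norm_nonneg[OF HA_H1]] by blast
  note bdd = dual_norm_bdd[OF L]
  define n where "n = h1_norm f"
  have n0: "n \<ge> 0" unfolding n_def by (rule h1_norm_nonneg[OF HA_H1[OF f]])
  show ?thesis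
  proof (cases "n = 0")
    case True
    then show ?thesis using C(2)[OF f] by (simp add: n_def)
  next
    case False
    define g where "g = (\<lambda>x. (1 / n) * f x + 0 * f x)"
    have g: "g \<in> HA" unfolding g_def by (rule HA_lincomb[OF f f])
    have "h1_norm g \<le> \<bar>1 / n\<bar> * h1_norm f" using H1_scale(2)[OF HA_H1[OF f], of "1 / n"] by (simp add: g_def)
    also have "\<dots> = 1" using False n0 by (simp add: n_def)
    finally have "\<bar>L g\<bar> \<le> dual_norm HA h1_norm L"
      unfolding dual_norm_def using g bdd by (intro cSup_upper) auto
    moreover have "L g = L f / n" using dual_space_lin[OF L f f, of "1 / n" 0] by (simp add: g_def)
    ultimately show ?thesis using False n0 by (simp add: n_def abs_divide field_simps)
  qed
qed

section \<open>The quotient of \<open>BMO\<close>\<close>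

text \<open>
  That \<open>BMO\<close> is a linear space is read off from its functionals: a linear combination represents a
  bounded functional, and hence has bounded mean oscillation.
\<close>

lemma bmo_lincomb:
  assumes "p \<in> BMO" "q \<in> BMO"
  shows "(\<lambda>x. s * p x + t * q x) \<in> BMO"
    "bmo_functional (\<lambda>x. s * p x + t * q x) = restrict (\<lambda>f. s * bmo_functional p f + t * bmo_functional q f) H1"
proof -
  note P = bmo_functional[OF assms(1)] and Q = bmo_functional[OF assms(2)]
  note d = dual_space_H1_lincomb[OF P(1) Q(1), of s t]
  note r = represents_lincomb[OF P(2) Q(2), of s t]
  obtain C where "C > 0" "\<And>f. f \<in> H1 \<Longrightarrow> \<bar>restrict (\<lambda>f. s * bmo_functional p f + t * bmo_functional q f) H1 f\<bar> \<le> C * h1_norm f"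
    using dual_space_bound[OF d h1_norm_nonneg] by blast
  then show "(\<lambda>x. s * p x + t * q x) \<in> BMO" using represents_bmo(1)[OF r] by (meson less_imp_le)
  show "bmo_functional (\<lambda>x. s * p x + t * q x) = restrict (\<lambda>f. s * bmo_functional p f + t * bmo_functional q f) H1"
    by (rule bmo_functional_eqI[OF d r])
qed

lemma AE_step_function:
  "AE x::real in lebesgue. d * indicator {..0} x + c * indicator {0..} x = (c - d) * indicator {0..} x + (d::real)"
proof -
  have "AE x in lebesgue. x \<noteq> (0::real)"
    using AE_completion[OF AE_lborel_singleton[of "0::real"]] .
  then show ?thesis
  proof eventually_elim
    case (elim x)
    then show ?case by (auto simp: indicator_def)
  qed
qed

text \<open>
  Up to the null set \<open>{0}\<close>, a combination of the indicators of the two half-lines is a multiple of one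
  of them plus a constant. Integration against the former vanishes on \<open>HA\<close>, and against the latter
  already on \<open>H1\<close>.
\<close>

lemma sim2_iff:
  "(p, q) \<in> sim2 \<longleftrightarrow> p \<in> BMO \<and> q \<in> BMO \<and> (\<exists>c d. AE x in lebesgue. p x - q x = c * indicator {0..} x + d)"
proof -
  have "(\<exists>c d. AE x in lebesgue. p x - q x = d * indicator {..0} x + c * indicator {0..} x) \<longleftrightarrow>
     (\<exists>c d. AE x in lebesgue. p x - q x = c * indicator {0..} x + d)"
  proof
    assume "\<exists>c d. AE x in lebesgue. p x - q x = d * indicator {..0} x + c * indicator {0..} x"
    then obtain c d where "AE x in lebesgue. p x - q x = d * indicator {..0} x + c * indicator {0..} x" by blast
    then have "AE x in lebesgue. p x - q x = (c - d) * indicator {0..} x + d"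
      using AE_step_function[of d c] by eventually_elim simp
    then show "\<exists>c d. AE x in lebesgue. p x - q x = c * indicator {0..} x + d" by blast
  next
    assume "\<exists>c d. AE x in lebesgue. p x - q x = c * indicator {0..} x + d"
    then obtain c d where "AE x in lebesgue. p x - q x = c * indicator {0..} x + d" by blast
    then have "AE x in lebesgue. p x - q x = d * indicator {..0} x + (c + d) * indicator {0..} x"
      using AE_step_function[of d "c + d"] by eventually_elim simp
    then show "\<exists>c d. AE x in lebesgue. p x - q x = d * indicator {..0} x + c * indicator {0..} x" by blast
  qed
  then show ?thesis by (simp add: sim2_def)
qed

lemma equiv_sim2: "equiv BMO sim2"
proof (rule equivI)
  show "sim2 \<subseteq> BMO \<times> BMO" by (auto simp: sim2_def)
  show "refl_on BMO sim2"
  proof (rule refl_onI)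
    fix p assume "p \<in> BMO"
    then show "(p, p) \<in> sim2" unfolding sim2_iff by (intro conjI exI[of _ 0]) auto
  qed
  show "sym sim2"
  proof (rule symI)
    fix p q assume "(p, q) \<in> sim2"
    then obtain c d where pq: "p \<in> BMO" "q \<in> BMO" and a: "AE x in lebesgue. p x - q x = c * indicator {0..} x + d"
      unfolding sim2_iff by blast
    have "AE x in lebesgue. q x - p x = (-c) * indicator {0..} x + (-d)"
      using a by eventually_elim simp
    then show "(q, p) \<in> sim2" unfolding sim2_iff using pq by blast
  qed
  show "trans sim2"
  proof (rule transI)
    fix p q r assume "(p, q) \<in> sim2" "(q, r) \<in> sim2"
    then obtain c d c' d' where pq: "p \<in> BMO" "q \<in> BMO" "r \<in> BMO"
      and a: "AE x in lebesgue. p x - q x = c * indicator {0..} x + d" "AE x in lebesgue. q x - r x = c' * indicator {0..} x + d'"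
      unfolding sim2_iff by blast
    have "AE x in lebesgue. p x - r x = (c + c') * indicator {0..} x + (d + d')"
      using a by eventually_elim (simp add: algebra_simps)
    then show "(p, r) \<in> sim2" unfolding sim2_iff using pq by blast
  qed
qed

lemma sim2_functional_eq:
  assumes "(p, q) \<in> sim2" "f \<in> HA" shows "bmo_functional p f = bmo_functional q f"
proof -
  obtain c d where pq: "p \<in> BMO" "q \<in> BMO" and a: "AE x in lebesgue. p x - q x = c * indicator {0..} x + d"
    using assms(1) unfolding sim2_iff by blast
  let ?L = "restrict (\<lambda>f. 1 * bmo_functional q f + c * half_functional f) H1"
  note Q = bmo_functional[OF pq(2)]
  have r: "represents ?L (\<lambda>x. 1 * q x + c * indicator {0..} x)"
    by (rule represents_lincomb[OF Q(2) half_functional_represents])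
  have pl: "loc_integrable p" by (rule BMO_loc_integrable[OF pq(1)])
  have "represents ?L (\<lambda>x. p x - d)"
  proof (rule represents_AE[OF r])
    have "set_integrable lebesgue K (\<lambda>x. d)" if "compact K" for K :: "real set"
      using lmeasurable_compact[OF that] by (auto simp: set_integrable_def fmeasurable_def)
    then show "loc_integrable (\<lambda>x. p x - d)"
      using pl by (auto simp: loc_integrable_def intro!: set_integral_diff)
    show "AE x in lebesgue. 1 * q x + c * indicator {0..} x = p x - d"
      using a by eventually_elim simp
  qed
  then have rd: "represents ?L (\<lambda>x. p x - d)" .
  have "represents ?L p"
    unfolding represents_def
  proof (intro conjI pl allI impI)
    fix a b g assume g: "bsupp a b g \<and> (LINT x|lebesgue. g x) = 0"
    then have "?L g = (LINT x|lebesgue. g x * (p x - d))" using rd unfolding represents_def by blast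
    also have "\<dots> = (LINT x|lebesgue. g x * p x)"
      using g loc_integrable_bsupp[OF pl, of a b g] bsupp_integrable[of a b g] by (simp add: right_diff_distrib)
    finally show "?L g = (LINT x|lebesgue. g x * p x)" .
  qed
  then have "bmo_functional p = ?L"
    by (rule bmo_functional_eqI[OF dual_space_H1_lincomb[OF Q(1) half_functional_dual]])
  then show ?thesis using assms(2) by (simp add: HA_iff)
qed

text \<open>
  Subtracting \<open>k\<close> times the indicator of \<open>[0,\<infinity>)\<close>, with \<open>k\<close> the value at \<open>jump\<close>, turns the functional of
  \<open>p\<close> into its composition with \<open>HA_proj\<close>. The constant \<open>6\<close> is the bound \<open>3\<close> for the projection
  times the factor \<open>2\<close> from \<open>represents_bmo\<close>.
\<close>

lemma BMO_representative:
  assumes p: "p \<in> BMO" and M: "\<And>f. f \<in> HA \<Longrightarrow> \<bar>bmo_functional p f\<bar> \<le> M * h1_norm f" "M \<ge> 0"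
  obtains k where "(\<lambda>x. p x - k * indicator {0..} x) \<in> BMO" "bmo_norm (\<lambda>x. p x - k * indicator {0..} x) \<le> 6 * M"
proof -
  note P = bmo_functional[OF p]
  define k where "k = bmo_functional p jump"
  let ?L = "restrict (\<lambda>f. 1 * bmo_functional p f + (-k) * half_functional f) H1"
  have r: "represents ?L (\<lambda>x. 1 * p x + (-k) * indicator {0..} x)"
    by (rule represents_lincomb[OF P(2) half_functional_represents])
  have "\<bar>?L f\<bar> \<le> (3 * M) * h1_norm f" if f: "f \<in> H1" for f
  proof -
    have "?L f = bmo_functional p (HA_proj f)"
      using dual_space_lin[OF P(1) f jump_H1(1), of 1 "- half_functional f"] f by (simp add: HA_proj_def k_def)
    also have "\<bar>\<dots>\<bar> \<le> M * h1_norm (HA_proj f)" by (rule M(1)[OF HA_proj_HA(1)[OF f]])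
    also have "\<dots> \<le> M * (3 * h1_norm f)" by (intro mult_left_mono HA_proj_HA(2) f M(2))
    finally show ?thesis by simp
  qed
  from represents_bmo[OF r this] M(2) show ?thesis by (intro that[of k]) auto
qed

text \<open>
  The values on the intervals \<open>[-n-1,n+1]\<close> agree, since all of them are the mean over \<open>[-1,1]\<close>.
\<close>

lemma bmo_norm_zero_const:
  assumes v: "v \<in> BMO" and z: "bmo_norm v \<le> 0"
  shows "\<exists>d. AE x in lebesgue. v x = d"
proof -
  have I: "bdd_interval {- real (Suc n)..real (Suc n)}" for n by (rule bdd_interval_Icc) simp
  have vl: "loc_integrable v" by (rule BMO_loc_integrable[OF v])
  have "mean_osc v {- real (Suc n)..real (Suc n)} = 0" for n
    using mean_osc_le_bmo_norm[OF v I[of n]] mean_osc_nonneg[of v "{- real (Suc n)..real (Suc n)}"] z by linarith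
  then have "\<exists>m. AE x in lebesgue. x \<in> {- real (Suc n)..real (Suc n)} \<longrightarrow> v x = m" for n
    using mean_osc_zero_AE[OF I loc_integrable_interval[OF vl I]] by blast
  then obtain m where m: "\<And>n. AE x in lebesgue. x \<in> {- real (Suc n)..real (Suc n)} \<longrightarrow> v x = m n" by metis
  define d where "d = (LINT x|lebesgue. indicator {-1..1} x * v x) / 2"
  have md: "m n = d" for n
  proof -
    have "(LINT x|lebesgue. indicator {-1..1} x * v x) = (LINT x|lebesgue. m n * indicator {-1..1::real} x)"
    proof (rule integral_cong_AE)
      show "AE x in lebesgue. indicator {-1..1} x * v x = m n * indicator {-1..1} x"
        using m[of n] by eventually_elim (auto simp: indicator_def)
    qed (use loc_integrable_measurable[OF vl] in \<open>auto intro!: borel_measurable_times borel_measurable_indicator\<close>)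
    then show ?thesis by (simp add: d_def)
  qed
  have "AE x in lebesgue. \<forall>n. x \<in> {- real (Suc n)..real (Suc n)} \<longrightarrow> v x = d"
    unfolding AE_all_countable using m md by simp
  then have "AE x in lebesgue. v x = d"
  proof eventually_elim
    case (elim x)
    have "x \<in> {- real (Suc (nat \<lceil>\<bar>x\<bar>\<rceil>))..real (Suc (nat \<lceil>\<bar>x\<bar>\<rceil>))}" by simp linarith
    then show ?case using elim by blast
  qed
  then show ?thesis by blast
qed

lemma functional_eq_sim2:
  assumes p: "p \<in> BMO" and q: "q \<in> BMO" and eq: "\<And>f. f \<in> HA \<Longrightarrow> bmo_functional p f = bmo_functional q f"
  shows "(p, q) \<in> sim2"
proof -
  let ?u = "\<lambda>x. 1 * p x + (-1) * q x"
  have u: "?u \<in> BMO" by (rule bmo_lincomb(1)[OF p q])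
  have z: "\<bar>bmo_functional ?u f\<bar> \<le> 0 * h1_norm f" if "f \<in> HA" for f
    using bmo_lincomb(2)[OF p q, of 1 "-1"] eq[OF that] HA_H1[OF that] by simp
  obtain k where k: "(\<lambda>x. ?u x - k * indicator {0..} x) \<in> BMO" "bmo_norm (\<lambda>x. ?u x - k * indicator {0..} x) \<le> 6 * 0"
    by (rule BMO_representative[OF u z order_refl])
  then obtain d where "AE x in lebesgue. ?u x - k * indicator {0..} x = d"
    using bmo_norm_zero_const[OF k(1)] by auto
  then have "AE x in lebesgue. p x - q x = k * indicator {0..} x + d" by eventually_elim simp
  then show ?thesis unfolding sim2_iff using p q by blast
qed

lemma dual_HA_extension:
  assumes L: "L \<in> dual_space HA h1_norm"
  obtains p where "p \<in> BMO" "restrict (bmo_functional p) HA = L"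
proof -
  define E where "E = restrict (\<lambda>f. L (HA_proj f)) H1"
  obtain C where C: "C > 0" "\<And>f. f \<in> HA \<Longrightarrow> \<bar>L f\<bar> \<le> C * h1_norm f"
    using dual_space_bound[OF L h1_norm_nonneg[OF HA_H1]] by blast
  have b: "\<bar>E f\<bar> \<le> (3 * C) * h1_norm f" if "f \<in> H1" for f
  proof -
    have "\<bar>E f\<bar> \<le> C * h1_norm (HA_proj f)" using C(2)[OF HA_proj_HA(1)[OF that]] that by (simp add: E_def)
    also have "\<dots> \<le> C * (3 * h1_norm f)" by (intro mult_left_mono HA_proj_HA(2) that) (use C(1) in simp)
    finally show ?thesis by simp
  qed
  have lin: "E (\<lambda>x. s * f x + t * g x) = s * E f + t * E g" if fg: "f \<in> H1" "g \<in> H1" for s t f g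
  proof -
    have "HA_proj (\<lambda>x. s * f x + t * g x) = (\<lambda>x. s * HA_proj f x + t * HA_proj g x)"
      unfolding HA_proj_def half_functional_lin[OF fg] by (auto simp: algebra_simps)
    then show ?thesis
      using fg H1_lincomb[OF fg] dual_space_lin[OF L HA_proj_HA(1)[OF fg(1)] HA_proj_HA(1)[OF fg(2)]]
      by (simp add: E_def)
  qed
  have "\<exists>C. \<forall>f\<in>H1. \<bar>E f\<bar> \<le> C * h1_norm f" using b by blast
  then have E: "E \<in> dual_space H1 h1_norm" unfolding dual_space_def using lin by (auto simp: E_def)
  obtain p where p: "represents E p" by (rule dual_H1_represented[OF E])
  have "p \<in> BMO" using represents_bmo(1)[OF p b] C(1) by simp
  moreover have "restrict (bmo_functional p) HA = L"
  proof
    fix f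
    show "restrict (bmo_functional p) HA f = L f"
      using bmo_functional_eqI[OF E p] L
      by (cases "f \<in> HA") (auto simp: E_def HA_proj_id HA_H1 dual_space_def extensional_def)
  qed
  ultimately show ?thesis by (rule that)
qed

theorem mainTheorem8:
  "\<exists>T :: (real \<Rightarrow> real) set \<Rightarrow> (real \<Rightarrow> real) \<Rightarrow> real.
     (\<forall>\<phi>\<in>BMO. T (sim2 `` {\<phi>}) = restrict (bmo_functional \<phi>) HA) \<and>
     (\<forall>\<phi>\<in>BMO. \<forall>\<psi>\<in>BMO. \<forall>s t. \<forall>f\<in>HA.
        T (sim2 `` {\<lambda>x. s * \<phi> x + t * \<psi> x}) f
          = s * T (sim2 `` {\<phi>}) f + t * T (sim2 `` {\<psi>}) f) \<and>
     bij_betw T bmo_quot (dual_space HA h1_norm) \<and>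
     (\<exists>c>0. \<exists>C>0. \<forall>\<Phi>\<in>bmo_quot.
        c * bmo_quot_norm \<Phi> \<le> dual_norm HA h1_norm (T \<Phi>) \<and>
        dual_norm HA h1_norm (T \<Phi>) \<le> C * bmo_quot_norm \<Phi>)"
proof -
  define T where "T = (\<lambda>\<Phi>. restrict (bmo_functional (SOME p. p \<in> \<Phi>)) HA)"
  have T: "T (sim2 `` {p}) = restrict (bmo_functional p) HA" if p: "p \<in> BMO" for p
  proof -
    have "p \<in> sim2 `` {p}" using equiv_class_self[OF equiv_sim2 p] .
    then have "(SOME q. q \<in> sim2 `` {p}) \<in> sim2 `` {p}" by (rule someI[of "\<lambda>q. q \<in> sim2 `` {p}"])
    then have "(p, SOME q. q \<in> sim2 `` {p}) \<in> sim2" by simp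
    then show ?thesis unfolding T_def using sim2_functional_eq by (auto simp: restrict_def fun_eq_iff)
  qed
  have T1: "\<forall>\<phi>\<in>BMO. T (sim2 `` {\<phi>}) = restrict (bmo_functional \<phi>) HA" using T by blast
  have T2: "\<forall>\<phi>\<in>BMO. \<forall>\<psi>\<in>BMO. \<forall>s t. \<forall>f\<in>HA.
        T (sim2 `` {\<lambda>x. s * \<phi> x + t * \<psi> x}) f
          = s * T (sim2 `` {\<phi>}) f + t * T (sim2 `` {\<psi>}) f"
    using T bmo_lincomb HA_H1 by simp
  have quot: "\<exists>p\<in>BMO. \<Phi> = sim2 `` {p}" if "\<Phi> \<in> bmo_quot" for \<Phi>
    using that unfolding bmo_quot_def by (blast elim: quotientE)
  have T3: "bij_betw T bmo_quot (dual_space HA h1_norm)"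
    unfolding bij_betw_def
  proof (intro conjI subset_antisym subsetI)
    show "inj_on T bmo_quot"
    proof (rule inj_onI)
      fix \<Phi> \<Psi> assume q: "\<Phi> \<in> bmo_quot" "\<Psi> \<in> bmo_quot" and eq: "T \<Phi> = T \<Psi>"
      obtain p where p: "p \<in> BMO" "\<Phi> = sim2 `` {p}" using quot[OF q(1)] by blast
      obtain r where r: "r \<in> BMO" "\<Psi> = sim2 `` {r}" using quot[OF q(2)] by blast
      have eq': "restrict (bmo_functional p) HA = restrict (bmo_functional r) HA"
        using eq T p r by simp
      have "(p, r) \<in> sim2"
        by (rule functional_eq_sim2[OF p(1) r(1)]) (metis eq' restrict_apply')
      then show "\<Phi> = \<Psi>" unfolding p(2) r(2) by (rule equiv_class_eq[OF equiv_sim2])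
    qed
    fix L
    show "L \<in> dual_space HA h1_norm" if "L \<in> T ` bmo_quot"
    proof -
      obtain \<Phi> where "\<Phi> \<in> bmo_quot" "L = T \<Phi>" using \<open>L \<in> T ` bmo_quot\<close> by blast
      then obtain p where p: "p \<in> BMO" "L = T (sim2 `` {p})" using quot by blast
      show ?thesis unfolding p(2) T[OF p(1)] by (rule restrict_dual_HA[OF bmo_functional(1)[OF p(1)]])
    qed
    show "L \<in> T ` bmo_quot" if "L \<in> dual_space HA h1_norm"
    proof -
      obtain p where p: "p \<in> BMO" "restrict (bmo_functional p) HA = L"
        using \<open>L \<in> dual_space HA h1_norm\<close> by (rule dual_HA_extension)
      have "sim2 `` {p} \<in> bmo_quot" unfolding bmo_quot_def by (rule quotientI[OF p(1)])
      then show ?thesis using T[OF p(1)] p(2) by (metis image_eqI)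
    qed
  qed
  have T4: "1/6 * bmo_quot_norm \<Phi> \<le> dual_norm HA h1_norm (T \<Phi>) \<and>
        dual_norm HA h1_norm (T \<Phi>) \<le> 1 * bmo_quot_norm \<Phi>" if \<Phi>: "\<Phi> \<in> bmo_quot" for \<Phi>
  proof
    obtain p where p: "p \<in> BMO" "\<Phi> = sim2 `` {p}" using quot[OF \<Phi>] by blast
    have cls: "q \<in> BMO" "T \<Phi> = restrict (bmo_functional q) HA" if "q \<in> \<Phi>" for q
    proof -
      have pq: "(p, q) \<in> sim2" using that p(2) by simp
      then show q: "q \<in> BMO" by (simp add: sim2_def)
      have "\<Phi> = sim2 `` {q}" unfolding p(2) by (rule equiv_class_eq[OF equiv_sim2 pq])
      then show "T \<Phi> = restrict (bmo_functional q) HA" using T[OF q] by simp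
    qed
    have p\<Phi>: "p \<in> \<Phi>" unfolding p(2) by (rule equiv_class_self[OF equiv_sim2 p(1)])
    let ?M = "dual_norm HA h1_norm (T \<Phi>)"
    have d: "T \<Phi> \<in> dual_space HA h1_norm" using T3 \<Phi> by (auto simp: bij_betw_def)
    have "?M \<le> bmo_quot_norm \<Phi>"
      unfolding bmo_quot_norm_def
    proof (rule cINF_greatest)
      show "\<Phi> \<noteq> {}" using p\<Phi> by blast
      fix q assume q: "q \<in> \<Phi>"
      show "?M \<le> bmo_norm q"
        unfolding cls(2)[OF q] using bmo_functional(3)[OF cls(1)[OF q] HA_H1] bmo_norm_nonneg[OF cls(1)[OF q]]
        by (intro dual_norm_le) auto
    qed
    then show "?M \<le> 1 * bmo_quot_norm \<Phi>" by simp
    have M0: "?M \<ge> 0" by (rule dual_norm_nonneg[OF d])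
    have "\<bar>bmo_functional p f\<bar> \<le> ?M * h1_norm f" if "f \<in> HA" for f
      using dual_norm_bound[OF d that] cls(2)[OF p\<Phi>] that by simp
    then obtain k where k: "(\<lambda>x. p x - k * indicator {0..} x) \<in> BMO" "bmo_norm (\<lambda>x. p x - k * indicator {0..} x) \<le> 6 * ?M"
      using BMO_representative[OF p(1) _ M0] by blast
    have "(p, \<lambda>x. p x - k * indicator {0..} x) \<in> sim2"
      unfolding sim2_iff using p(1) k(1) by (intro conjI exI[of _ k] exI[of _ 0]) auto
    then have "bmo_quot_norm \<Phi> \<le> bmo_norm (\<lambda>x. p x - k * indicator {0..} x)"
      unfolding bmo_quot_norm_def using bmo_norm_nonneg cls(1)
      by (intro cINF_lower bdd_belowI2[where m=0]) (auto simp: p(2))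
    then show "1/6 * bmo_quot_norm \<Phi> \<le> ?M" using k(2) by simp
  qed
  show ?thesis
  proof (intro exI[of _ T] conjI T1 T2 T3)
    show "\<exists>c>0. \<exists>C>0. \<forall>\<Phi>\<in>bmo_quot.
        c * bmo_quot_norm \<Phi> \<le> dual_norm HA h1_norm (T \<Phi>) \<and>
        dual_norm HA h1_norm (T \<Phi>) \<le> C * bmo_quot_norm \<Phi>"
      using T4 by (intro exI[of _ "1/6"] exI[of _ 1] conjI) auto
  qed
qed

end
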